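(* Let $K,E\subseteq\mathbb{R}^n$ be convex bodies with nonempty interior, and let $K_\lambda$ denote the parallel bodies of $K$ relative to $E$. Then the function $$\mathrm{I}(\lambda)=\frac{\mathrm{S}(K_\lambda;E)^n}{\mathrm{vol}(K_\lambda)^{n-1}}$$ is monotonically decreasing on $(-\mathrm{r}(K;E),\infty)$. Moreover, the following are equivalent for all $-\mathrm{r}(K;E)<\lambda_0<\lambda_1<\infty$: (i) $\mathrm{I}(\lambda_0)=\mathrm{I}(\lambda_1)$; (ii) $K_{\lambda_0}$ is homothetic to $K_{\lambda_1}$; (iii) $K_{\lambda_1}$ is homothetic to a tangential body of $E$; (iv) $\mathrm{I}(\lambda)$ is constant on $(-\mathrm{r}(K;E),\lambda_1]$. If $\lambda_1>0$, the equivalent conditions (i)-(iv) are satisfied if and only if $K$ is homothetic to $E$ and, consequently, if and only if $\mathrm{I}(\lambda)=n^n\,\mathrm{vol}(E)$ for all $\lambda\in(-\mathrm{r}(K;E),\infty)$.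
   Context: A convex body is a nonempty compact convex subset of $\mathbb{R}^n$; $\mathrm{vol}$ is $n$-dimensional Lebesgue measure. The inradius of $K$ relative to $E$ is $\mathrm{r}(K;E)=\sup\{r\ge 0:\text{there is }x\in\mathbb{R}^n\text{ with }x+rE\subseteq K\}$. The parallel bodies of $K$ relative to $E$ are $K_\lambda=\{x\in\mathbb{R}^n: x+|\lambda|E\subseteq K\}$ for $-\mathrm{r}(K;E)\le\lambda\le 0$ and $K_\lambda=K+\lambda E$ (Minkowski sum) for $\lambda\ge 0$. The relative quermassintegrals $\mathrm{W}_i(K;E)$ are the coefficients in the relative Steiner formula $\mathrm{vol}(K+\lambda E)=\sum_{i=0}^n\binom{n}{i}\mathrm{W}_i(K;E)\lambda^i$, $\lambda\ge 0$, and the surface area of $K$ relative to $E$ is $\mathrm{S}(K;E)=n\mathrm{W}_1(K;E)$. Two convex bodies $K,L$ are homothetic if $L=\alpha K+x$ for some $\alpha>0$ and $x\in\mathbb{R}^n$. For convex bodies $L,E$ with nonempty interior and $E\subseteq L$, $L$ is a tangential body of $E$ if through each boundary point of $L$ there is a supporting hyperplane of $L$ that also supports $E$. "Monotonically decreasing" is meant in the weak sense (non-increasing). *)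

theory Defs
  imports "HOL-Analysis.Analysis"
begin

type_synonym 'n body = "(real ^ 'n) set"

definition convex_body :: "'n::finite body \<Rightarrow> bool" where
  "convex_body K \<longleftrightarrow> K \<noteq> {} \<and> compact K \<and> convex K"

abbreviation vol :: "'n::finite body \<Rightarrow> real" where
  "vol K \<equiv> measure lebesgue K"

definition inradius :: "'n::finite body \<Rightarrow> 'n body \<Rightarrow> real" where
  "inradius K E = Sup {r. 0 \<le> r \<and> (\<exists>x. (\<lambda>y. x + r *\<^sub>R y) ` E \<subseteq> K)}"

text \<open>The sum in the second branch is the Minkowski sum. The function is total in \<open>l\<close>;
  for \<open>l < - inradius K E\<close> its value is the empty set and plays no role. At \<open>l = 0\<close> both
  branches give \<open>K\<close>, provided that \<open>E\<close> is nonempty.\<close>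

definition parallel_body :: "'n::finite body \<Rightarrow> 'n body \<Rightarrow> real \<Rightarrow> 'n body" where
  "parallel_body K E l =
     (if l < 0 then {x. (\<lambda>y. x + \<bar>l\<bar> *\<^sub>R y) ` E \<subseteq> K}
      else K + (*\<^sub>R) l ` E)"

text \<open>The relative quermassintegrals are the coefficients in the relative Steiner formula.
  A polynomial function on the nonnegative reals determines its coefficients, so
  \<open>w 0, \<dots>, w n\<close> below are unique; the sequence is padded with zeros beyond the dimension
  \<open>n = CARD('n)\<close> only in order to be unique as a function.\<close>

definition steiner_coeffs :: "'n::finite body \<Rightarrow> 'n body \<Rightarrow> (nat \<Rightarrow> real) \<Rightarrow> bool" where
  "steiner_coeffs K E w \<longleftrightarrow>
     (\<forall>l\<ge>0. vol (K + (*\<^sub>R) l ` E) = (\<Sum>i\<le>CARD('n). real (CARD('n) choose i) * w i * l ^ i)) \<and>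
     (\<forall>i>CARD('n). w i = 0)"

lemma steiner_coeffs_unique:
  fixes K E :: "'n::finite body"
  assumes v: "steiner_coeffs K E v" and w: "steiner_coeffs K E w"
  shows "v = w"
proof
  fix i
  let ?n = "CARD('n)"
  define d where "d j = real (?n choose j) * (v j - w j)" for j
  have zero: "(\<Sum>j\<le>?n. d j * l ^ j) = 0" if "l \<ge> 0" for l
  proof -
    have "(\<Sum>j\<le>?n. d j * l ^ j)
        = (\<Sum>j\<le>?n. real (?n choose j) * v j * l ^ j) - (\<Sum>j\<le>?n. real (?n choose j) * w j * l ^ j)"
      unfolding d_def sum_subtractf [symmetric]
      by (rule sum.cong) (simp_all only: left_diff_distrib right_diff_distrib)
    also have "(\<Sum>j\<le>?n. real (?n choose j) * v j * l ^ j) = vol (K + (*\<^sub>R) l ` E)"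
      using v that unfolding steiner_coeffs_def by (simp only:)
    also have "(\<Sum>j\<le>?n. real (?n choose j) * w j * l ^ j) = vol (K + (*\<^sub>R) l ` E)"
      using w that unfolding steiner_coeffs_def by (simp only:)
    finally show ?thesis by simp
  qed
  have "infinite {0..1::real}"
    by (rule infinite_Icc [OF zero_less_one])
  moreover have "{0..1} \<subseteq> {l. (\<Sum>j\<le>?n. d j * l ^ j) = 0}"
    using zero by (intro subsetI) (simp only: mem_Collect_eq atLeastAtMost_iff)
  ultimately have "infinite {l. (\<Sum>j\<le>?n. d j * l ^ j) = 0}"
    by (rule infinite_super [rotated])
  then have d0: "\<forall>j\<le>?n. d j = 0"
    unfolding polyfun_finite_roots by simp
  show "v i = w i"
  proof (cases "i \<le> ?n")
    case True
    then have "?n choose i \<noteq> 0" by simp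
    then show ?thesis using d0 True unfolding d_def by simp
  next
    case False
    then show ?thesis using v w unfolding steiner_coeffs_def by simp
  qed
qed

definition quermassintegral :: "nat \<Rightarrow> 'n::finite body \<Rightarrow> 'n body \<Rightarrow> real" where
  "quermassintegral i K E = (THE w. steiner_coeffs K E w) i"

definition surface_area :: "'n::finite body \<Rightarrow> 'n body \<Rightarrow> real" where
  "surface_area K E = real CARD('n) * quermassintegral 1 K E"

definition isoperimetric_ratio :: "'n::finite body \<Rightarrow> 'n body \<Rightarrow> real \<Rightarrow> real" where
  "isoperimetric_ratio K E l =
     surface_area (parallel_body K E l) E ^ CARD('n) / vol (parallel_body K E l) ^ (CARD('n) - 1)"

definition homothetic :: "'n::finite body \<Rightarrow> 'n body \<Rightarrow> bool" where
  "homothetic K L \<longleftrightarrow> (\<exists>a>0. \<exists>x. L = (\<lambda>y. a *\<^sub>R y + x) ` K)"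

text \<open>Replacing \<open>(u, c)\<close> by \<open>(- u, - c)\<close> shows that the body may lie on either side
  of the hyperplane.\<close>

definition supporting_hyperplane :: "(real ^ 'n::finite) set \<Rightarrow> 'n body \<Rightarrow> bool" where
  "supporting_hyperplane H K \<longleftrightarrow>
     (\<exists>u c. u \<noteq> 0 \<and> H = {y. u \<bullet> y = c} \<and> K \<subseteq> {y. u \<bullet> y \<le> c} \<and> H \<inter> K \<noteq> {})"

definition tangential_body :: "'n::finite body \<Rightarrow> 'n body \<Rightarrow> bool" where
  "tangential_body L E \<longleftrightarrow>
     convex_body L \<and> interior L \<noteq> {} \<and> convex_body E \<and> interior E \<noteq> {} \<and> E \<subseteq> L \<and>
     (\<forall>x\<in>frontier L. \<exists>H. x \<in> H \<and> supporting_hyperplane H L \<and> supporting_hyperplane H E)"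

end

theory Submission
  imports Defs
begin

text \<open>For \<open>l0 < l1\<close> the body \<open>M = K_l0\<close> is the set of all \<open>x\<close> with \<open>x + \<delta> E \<subseteq> L\<close>, where \<open>L = K_l1\<close>
  and \<open>\<delta> = l1 - l0\<close>. Let \<open>v\<close> denote the \<open>n\<close>-th root of the volume, so that
  \<open>S / v ^ (n - 1)\<close> is the \<open>n\<close>-th root of the isoperimetric ratio. Convexity and
  \<open>M + \<delta> E \<subseteq> L\<close> give \<open>(1 - s) M + s (L + \<epsilon> E) \<subseteq> L\<close> for \<open>s = \<delta> / (\<delta> + \<epsilon>)\<close>, and the
  Brunn--Minkowski inequality yields \<open>\<delta> S(L) \<le> n v(L) ^ (n - 1) (v(L) - v(M))\<close> as \<open>\<epsilon> \<rightarrow> 0\<close>. Conversely, the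
  supporting hyperplane at a smooth boundary point of \<open>M\<close> is parallel to a hyperplane that supports
  both \<open>L\<close> and \<open>M + \<delta> E\<close> at a common point, so \<open>vol (M + t L)\<close> and \<open>vol (M + t (M + \<delta> E))\<close> have the same
  derivative at \<open>t = 0\<close>. The latter derivative is \<open>n vol(M) + \<delta> S(M)\<close>, and by Brunn--Minkowski the
  former is at least \<open>n v(M) ^ (n - 1) (v(M + L) - v(M)) \<ge> n v(M) ^ (n - 1) v(L)\<close>. Thus
  \<open>\<delta> S(M) / v(M) ^ (n - 1) \<ge> n (v(L) - v(M)) \<ge> \<delta> S(L) / v(L) ^ (n - 1)\<close>, and equality forces equality in
  Brunn--Minkowski, so that \<open>M\<close> and \<open>L\<close> are homothetic.

  If the erosion of \<open>L\<close> by \<open>\<delta> E\<close> is \<open>b L\<close> after a translation, then every boundary point \<open>x\<close> of \<open>L\<close> gives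
  a boundary point \<open>b x\<close> of the erosion, so some \<open>b x + \<delta> e\<close> lies on the boundary of \<open>L\<close>. With
  \<open>c = \<delta> / (1 - b)\<close> it is a convex combination of \<open>x\<close> and \<open>c e\<close>, and a supporting hyperplane of \<open>L\<close>
  there contains both; hence \<open>L / c\<close> is a tangential body of \<open>E\<close>. Conversely, the erosions of
  a tangential body \<open>T\<close> by \<open>d E\<close> are the copies \<open>(1 - d) T\<close>. For \<open>l1 > 0\<close> cancellation in
  \<open>K + l1 E = a K + x\<close> shows that \<open>K\<close> is homothetic to \<open>E\<close>.\<close>

section \<open>Volume and reindexing of coordinates\<close>

text \<open>The library states the change-of-variables theorems for \<open>real ^ 'n\<close> with a well-ordered
  index type; \<open>'n ordered\<close> is a copy of \<open>'n\<close> that carries such an order.\<close>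

typedef 'n ordered = "UNIV :: 'n set" ..

instance ordered :: (finite) finite
proof
  have "surj (Abs_ordered :: 'a \<Rightarrow> _)"
    by (metis Abs_ordered_cases surjI surj_def)
  then show "finite (UNIV :: 'a ordered set)"
    by (metis finite finite_imageI)
qed

instantiation ordered :: (finite) wellorder
begin

definition ordered_rank :: "'a ordered \<Rightarrow> nat" where
  "ordered_rank = (SOME f. inj f)"

definition less_eq_ordered :: "'a ordered \<Rightarrow> 'a ordered \<Rightarrow> bool" where
  "less_eq_ordered x y \<longleftrightarrow> ordered_rank x \<le> ordered_rank y"

definition less_ordered :: "'a ordered \<Rightarrow> 'a ordered \<Rightarrow> bool" where
  "less_ordered x y \<longleftrightarrow> ordered_rank x < ordered_rank y"

lemma inj_ordered_rank: "inj (ordered_rank :: 'a ordered \<Rightarrow> nat)"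
proof -
  have "\<exists>f :: 'a ordered \<Rightarrow> nat. inj f"
    using finite_imp_inj_to_nat_seg[OF finite_class.finite_UNIV] by blast
  then show ?thesis unfolding ordered_rank_def by (rule someI_ex)
qed

instance
proof
  fix x y :: "'a ordered"
  show "x \<le> y \<Longrightarrow> y \<le> x \<Longrightarrow> x = y"
    unfolding less_eq_ordered_def using inj_ordered_rank by (meson antisym injD)
next
  fix P :: "'a ordered \<Rightarrow> bool" and a
  assume *: "\<And>x. (\<And>y. y < x \<Longrightarrow> P y) \<Longrightarrow> P x"
  show "P a"
    by (induction a rule: measure_induct_rule[of ordered_rank]) (use * in \<open>auto simp: less_ordered_def\<close>)
qed (auto simp: less_eq_ordered_def less_ordered_def)

end

definition reindex :: "real ^ 'n::finite \<Rightarrow> real ^ 'n ordered" where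
  "reindex x = (\<chi> i. x $ Rep_ordered i)"

lemma linear_reindex: "linear reindex"
  by (auto intro!: linearI simp: reindex_def vec_eq_iff)

lemma bij_reindex: "bij (reindex :: real ^ 'n::finite \<Rightarrow> real ^ 'n ordered)"
proof (rule bijI)
  show "inj (reindex :: real ^ 'n \<Rightarrow> real ^ 'n ordered)"
    by (rule injI) (metis Rep_ordered_cases UNIV_I reindex_def vec_eq_iff vec_lambda_beta)
  show "surj (reindex :: real ^ 'n \<Rightarrow> real ^ 'n ordered)"
  proof (rule surjI)
    fix y :: "real ^ 'n ordered"
    show "reindex (\<chi> i. y $ Abs_ordered i) = y"
      by (simp add: reindex_def vec_eq_iff Rep_ordered_inverse)
  qed
qed

lemma card_ordered: "CARD('n::finite ordered) = CARD('n)"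
  using type_definition.card[OF type_definition_ordered] by simp

lemma continuous_on_reindex: "continuous_on S reindex"
  by (simp add: linear_continuous_on linear_conv_bounded_linear[symmetric] linear_reindex)

lemma measure_reindex:
  fixes S :: "(real ^ 'n::finite) set"
  assumes "compact S"
  shows "measure lebesgue (reindex ` S) = measure lebesgue S"
proof -
  let ?r = "reindex :: real ^ 'n \<Rightarrow> real ^ 'n ordered"
  have meas: "?r \<in> borel_measurable borel"
    by (rule borel_measurable_continuous_onI[OF continuous_on_reindex])
  have bij: "bij (Rep_ordered :: 'n ordered \<Rightarrow> 'n)"
    by (metis Abs_ordered_inverse Rep_ordered_inverse UNIV_I o_bij comp_apply eq_id_iff)
  have eq: "lborel = distr lborel borel ?r"
  proof (rule lborel_eqI)
    fix l u :: "real ^ 'n ordered"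
    assume lu: "\<And>b. b \<in> Basis \<Longrightarrow> l \<bullet> b \<le> u \<bullet> b"
    obtain l' u' where l': "?r l' = l" "?r u' = u"
      using bij_reindex by (metis bij_pointE)
    have le: "l $ i \<le> u $ i" for i
      using lu[of "axis i 1"] by (simp add: inner_axis axis_in_Basis_iff)
    have le': "l' $ i \<le> u' $ i" for i
      using le[of "Abs_ordered i"] by (simp add: l'[symmetric] reindex_def Abs_ordered_inverse)
    have vim: "?r -` box l u = box l' u'"
      by (auto simp: mem_box_cart l'[symmetric] reindex_def) (metis Abs_ordered_inverse UNIV_I)+
    have "emeasure (distr lborel borel ?r) (box l u) = emeasure lborel (box l' u')"
      using meas by (simp add: emeasure_distr vim)
    also have "\<dots> = ennreal (\<Prod>b\<in>Basis. (u' - l') \<bullet> b)"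
      using le' by (subst emeasure_lborel_box) (auto simp: Basis_vec_def inner_axis)
    also have "(\<Prod>b\<in>Basis. (u' - l') \<bullet> b) = (\<Prod>i\<in>UNIV. (u' - l') $ i)"
      by (simp add: Basis_vec_def UNION_singleton_eq_range prod.reindex inj_on_def axis_eq_axis inner_axis)
    also have "\<dots> = (\<Prod>i\<in>UNIV. (u' - l') $ Rep_ordered i)"
      by (rule prod.reindex_bij_betw[OF bij, symmetric])
    also have "\<dots> = (\<Prod>i\<in>UNIV. (u - l) $ i)"
      by (simp add: l'[symmetric] reindex_def)
    also have "\<dots> = (\<Prod>b\<in>Basis. (u - l) \<bullet> b)"
      by (simp add: Basis_vec_def UNION_singleton_eq_range prod.reindex inj_on_def axis_eq_axis inner_axis)
    finally show "emeasure (distr lborel borel ?r) (box l u) = (\<Prod>b\<in>Basis. (u - l) \<bullet> b)" .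
  qed simp
  have c: "compact (?r ` S)"
    by (rule compact_continuous_image[OF continuous_on_reindex assms])
  have "measure lebesgue (?r ` S) = measure lborel (?r ` S)"
    using c by (simp add: borel_compact)
  also have "\<dots> = measure lborel (?r -` ?r ` S)"
    by (subst eq) (use meas c in \<open>simp add: measure_distr borel_compact\<close>)
  also have "?r -` ?r ` S = S"
    by (rule inj_vimage_image_eq[OF bij_is_inj[OF bij_reindex]])
  finally show ?thesis using assms by (simp add: borel_compact)
qed

section \<open>The Steiner polynomial\<close>

lemma exp_taylor1_bound:
  fixes s :: real
  assumes "\<bar>s\<bar> \<le> 1"
  shows "\<bar>exp s - 1 - s\<bar> \<le> s\<^sup>2"
proof -
  have "exp s \<le> 1 + s + s\<^sup>2"
  proof (cases "s \<ge> 0")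
    case True
    then show ?thesis using exp_bound[of s] assms by auto
  next
    case False
    define u where "u = - s"
    have u: "u > 0" using False u_def by auto
    have "exp s = inverse (exp u)" by (simp add: u_def exp_minus)
    also have "\<dots> \<le> inverse (1 + u)"
      using exp_ge_add_one_self[of u] u by (intro le_imp_inverse_le) auto
    also have "\<dots> \<le> 1 - u + u\<^sup>2"
      using u by (simp add: field_simps power2_eq_square)
    finally show ?thesis by (simp add: u_def)
  qed
  with exp_ge_add_one_self[of s] zero_le_power2[of s] show ?thesis by linarith
qed

lemma set_integrable_continuous_compact:
  fixes f :: "'a::euclidean_space \<Rightarrow> 'b::{banach,second_countable_topology}"
  assumes "compact K" "continuous_on K f"
  shows "set_integrable lborel K f"
  using borel_integrable_compact[OF assms] by (simp add: set_integrable_def)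

lemma has_derivative_exponential_integral:
  fixes f :: "'a::euclidean_space \<Rightarrow> 'b::euclidean_space"
  assumes K: "compact K" and f: "continuous_on K f"
  shows "((\<lambda>x. LINT y:K|lborel. exp (x \<bullet> y) *\<^sub>R f y) has_derivative
    (\<lambda>h. LINT y:K|lborel. (exp (x \<bullet> y) * (h \<bullet> y)) *\<^sub>R f y)) (at x)"
proof -
  obtain R where R: "R > 0" "\<And>y. y \<in> K \<Longrightarrow> norm y \<le> R"
    using compact_imp_bounded[OF K] unfolding bounded_pos by auto
  obtain B where B: "B > 0" "\<And>y. y \<in> K \<Longrightarrow> norm (f y) \<le> B"
    using compact_imp_bounded[OF compact_continuous_image[OF f K]] unfolding bounded_pos by auto
  define C where "C = exp (norm x * R) * R\<^sup>2 * B * measure lborel K"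
  have int: "set_integrable lborel K g" if "continuous_on K g" for g :: "'a \<Rightarrow> 'b"
    by (rule set_integrable_continuous_compact[OF K that])
  have intr: "set_integrable lborel K g" if "continuous_on K g" for g :: "'a \<Rightarrow> real"
    by (rule set_integrable_continuous_compact[OF K that])
  let ?D = "\<lambda>h. LINT y:K|lborel. (exp (x \<bullet> y) * (h \<bullet> y)) *\<^sub>R f y"
  have lin: "linear ?D"
  proof (rule linearI)
    fix h k :: 'a and c :: real
    show "?D (h + k) = ?D h + ?D k"
      by (subst set_integral_add(2)[symmetric])
         (auto intro!: int continuous_intros f simp: inner_add_left algebra_simps)
    show "?D (c *\<^sub>R h) = c *\<^sub>R ?D h"
      by (subst set_integral_scaleR_right[symmetric]) (simp add: mult_ac)
  qed
  have bound: "norm ((LINT y:K|lborel. exp (z \<bullet> y) *\<^sub>R f y) - (LINT y:K|lborel. exp (x \<bullet> y) *\<^sub>R f y) - ?D (z - x))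
      / norm (z - x) \<le> C * norm (z - x)"
    if z: "z \<noteq> x" "dist z x < 1 / R" for z
  proof -
    let ?h = "z - x"
    have eq: "(LINT y:K|lborel. exp (z \<bullet> y) *\<^sub>R f y) - (LINT y:K|lborel. exp (x \<bullet> y) *\<^sub>R f y) - ?D ?h
      = (LINT y:K|lborel. (exp (z \<bullet> y) - exp (x \<bullet> y) - exp (x \<bullet> y) * (?h \<bullet> y)) *\<^sub>R f y)"
      by (subst set_integral_diff(2)[symmetric], (intro int continuous_intros f)+)+
         (simp add: algebra_simps)
    have pt: "norm ((exp (z \<bullet> y) - exp (x \<bullet> y) - exp (x \<bullet> y) * (?h \<bullet> y)) *\<^sub>R f y)
        \<le> exp (norm x * R) * R\<^sup>2 * B * (norm ?h)\<^sup>2" if y: "y \<in> K" for y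
    proof -
      have hy: "\<bar>?h \<bullet> y\<bar> \<le> norm ?h * R"
        by (rule order_trans[OF Cauchy_Schwarz_ineq2]) (use R(2)[OF y] in \<open>simp add: mult_left_mono\<close>)
      have "norm ?h * R \<le> 1"
        using z R(1) by (simp add: dist_norm field_simps)
      then have "\<bar>exp (?h \<bullet> y) - 1 - ?h \<bullet> y\<bar> \<le> (?h \<bullet> y)\<^sup>2"
        using hy by (intro exp_taylor1_bound) auto
      also have "\<dots> \<le> (norm ?h * R)\<^sup>2"
        using hy by (rule abs_le_square_iff[THEN iffD1, OF order_trans]) (use R in auto)
      finally have 1: "\<bar>exp (?h \<bullet> y) - 1 - ?h \<bullet> y\<bar> \<le> (norm ?h)\<^sup>2 * R\<^sup>2"
        by (simp add: power_mult_distrib)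
      have "x \<bullet> y \<le> norm x * norm y" by (rule norm_cauchy_schwarz)
      also have "\<dots> \<le> norm x * R" using R(2)[OF y] by (simp add: mult_left_mono)
      finally have 2: "exp (x \<bullet> y) \<le> exp (norm x * R)" by simp
      have "exp (z \<bullet> y) = exp (x \<bullet> y) * exp (?h \<bullet> y)"
        by (simp add: exp_add[symmetric] inner_diff_left)
      then have "exp (z \<bullet> y) - exp (x \<bullet> y) - exp (x \<bullet> y) * (?h \<bullet> y) = exp (x \<bullet> y) * (exp (?h \<bullet> y) - 1 - ?h \<bullet> y)"
        by (simp add: algebra_simps)
      then have "norm ((exp (z \<bullet> y) - exp (x \<bullet> y) - exp (x \<bullet> y) * (?h \<bullet> y)) *\<^sub>R f y)
         = exp (x \<bullet> y) * \<bar>exp (?h \<bullet> y) - 1 - ?h \<bullet> y\<bar> * norm (f y)"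
        by (simp add: abs_mult)
      also have "\<dots> \<le> exp (norm x * R) * ((norm ?h)\<^sup>2 * R\<^sup>2) * B"
        using 1 2 B(2)[OF y] B(1) by (intro mult_mono) auto
      finally show ?thesis by (simp add: mult_ac)
    qed
    have "norm (LINT y:K|lborel. (exp (z \<bullet> y) - exp (x \<bullet> y) - exp (x \<bullet> y) * (?h \<bullet> y)) *\<^sub>R f y)
      \<le> (LINT y:K|lborel. norm ((exp (z \<bullet> y) - exp (x \<bullet> y) - exp (x \<bullet> y) * (?h \<bullet> y)) *\<^sub>R f y))"
      by (intro set_integral_norm_bound int continuous_intros f)
    also have "\<dots> \<le> (LINT y:K|lborel. exp (norm x * R) * R\<^sup>2 * B * (norm ?h)\<^sup>2)"
      by (intro set_integral_mono intr continuous_intros f) (use pt in auto)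
    also have "\<dots> = C * (norm ?h)\<^sup>2"
      using K by (simp add: set_lebesgue_integral_def C_def mult_ac)
    finally show ?thesis unfolding eq using z by (simp add: field_simps power2_eq_square)
  qed
  show ?thesis
  proof (rule has_derivativeI_sandwich[where e = "1 / R" and H = "\<lambda>z. C * norm (z - x)"])
    show "bounded_linear ?D" using lin by (simp add: linear_conv_bounded_linear)
    show "((\<lambda>z. C * norm (z - x)) \<longlongrightarrow> 0) (at x)"
      by (auto intro!: tendsto_eq_intros)
  qed (use R bound in auto)
qed

definition laplace :: "'a::euclidean_space set \<Rightarrow> 'a \<Rightarrow> real" where
  "laplace K x = (LINT y:K|lborel. exp (x \<bullet> y))"

definition gibbs_mean :: "'a::euclidean_space set \<Rightarrow> 'a \<Rightarrow> 'a" where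
  "gibbs_mean K x = (LINT y:K|lborel. exp (x \<bullet> y) *\<^sub>R y) /\<^sub>R laplace K x"

lemma set_integral_pos:
  fixes f :: "'a::euclidean_space \<Rightarrow> real"
  assumes K: "compact K" "interior K \<noteq> {}" and f: "continuous_on K f"
    and nn: "\<And>y. y \<in> K \<Longrightarrow> f y \<ge> 0" and N: "negligible {y \<in> K. f y = 0}"
  shows "(LINT y:K|lborel. f y) > 0"
proof (rule ccontr)
  assume "\<not> ?thesis"
  moreover have "(LINT y:K|lborel. f y) \<ge> 0"
    unfolding set_lebesgue_integral_def by (intro integral_nonneg_AE AE_I2) (auto simp: indicator_def nn)
  ultimately have 0: "(LINT y|lborel. indicator K y *\<^sub>R f y) = 0"
    by (simp add: set_lebesgue_integral_def)
  have "integrable lborel (\<lambda>y. indicator K y *\<^sub>R f y)"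
    using borel_integrable_compact[OF K(1) f] .
  then have "AE y in lborel. indicator K y *\<^sub>R f y = 0"
    using 0 by (subst (asm) integral_nonneg_eq_0_iff_AE) (auto simp: indicator_def nn)
  then obtain N' where N': "N' \<in> null_sets lborel" "{y. indicator K y *\<^sub>R f y \<noteq> 0} \<subseteq> N'"
    by (auto simp: eventually_ae_filter)
  have "negligible N'"
    using null_sets_completionI[OF N'(1)] by (simp add: negligible_iff_null_sets)
  then have "negligible {y \<in> K. f y \<noteq> 0}"
    by (rule negligible_subset) (use N'(2) in \<open>auto simp: indicator_def\<close>)
  then have "negligible ({y \<in> K. f y = 0} \<union> {y \<in> K. f y \<noteq> 0})"
    by (rule negligible_Un[OF N])
  then have "negligible (interior K)"
    by (rule negligible_subset) (use interior_subset in auto)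
  then show False using K(2) open_not_negligible by blast
qed

lemma laplace_pos:
  assumes "compact K" "interior K \<noteq> {}"
  shows "laplace K x > 0"
  unfolding laplace_def by (rule set_integral_pos[OF assms]) (auto intro!: continuous_intros)

lemma has_derivative_laplace:
  assumes "compact K"
  shows "(laplace K has_derivative (\<lambda>h. h \<bullet> (LINT y:K|lborel. exp (x \<bullet> y) *\<^sub>R y))) (at x)"
proof -
  have "((\<lambda>x. LINT y:K|lborel. exp (x \<bullet> y) *\<^sub>R 1) has_derivative
    (\<lambda>h. LINT y:K|lborel. (exp (x \<bullet> y) * (h \<bullet> y)) *\<^sub>R (1::real))) (at x)"
    by (rule has_derivative_exponential_integral[OF assms]) (auto intro: continuous_intros)
  moreover have "(LINT y:K|lborel. (exp (x \<bullet> y) * (h \<bullet> y)) *\<^sub>R (1::real)) = h \<bullet> (LINT y:K|lborel. exp (x \<bullet> y) *\<^sub>R y)" for h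
  proof -
    have "integrable lborel (\<lambda>y. indicator K y *\<^sub>R exp (x \<bullet> y) *\<^sub>R y)"
      by (rule borel_integrable_compact[OF assms]) (intro continuous_intros)
    from integral_inner_right[OF this, of h] show ?thesis
      by (simp add: set_lebesgue_integral_def mult_ac)
  qed
  ultimately show ?thesis by (simp add: laplace_def[abs_def])
qed

lemma has_derivative_ln_laplace:
  assumes "compact K" "interior K \<noteq> {}"
  shows "((\<lambda>x. ln (laplace K x)) has_derivative (\<lambda>h. gibbs_mean K x \<bullet> h)) (at x)"
  by (rule has_derivative_eq_rhs[OF has_derivative_ln[OF laplace_pos[OF assms] has_derivative_laplace[OF assms(1)]]])
     (auto simp: gibbs_mean_def inner_commute divide_inverse mult_ac)

lemma gibbs_mean_differentiable:
  assumes "compact K" "interior K \<noteq> {}"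
  shows "gibbs_mean K differentiable (at x)"
  unfolding gibbs_mean_def[abs_def]
proof (intro differentiable_scaleR differentiable_inverse)
  show "laplace K differentiable (at x)"
    using has_derivative_laplace[OF assms(1)] by (auto simp: differentiable_def)
  show "laplace K x \<noteq> 0" using laplace_pos[OF assms, of x] by simp
  show "(\<lambda>x. LINT y:K|lborel. exp (x \<bullet> y) *\<^sub>R y) differentiable (at x)"
    using has_derivative_exponential_integral[OF assms(1), of "\<lambda>y. y" x] continuous_on_id
    by (auto simp: differentiable_def)
qed

lemma inner_gibbs_mean:
  assumes "compact K" "interior K \<noteq> {}"
  shows "a \<bullet> gibbs_mean K x = (LINT y:K|lborel. exp (x \<bullet> y) * (a \<bullet> y)) / laplace K x"
proof -
  have "integrable lborel (\<lambda>y. indicator K y *\<^sub>R exp (x \<bullet> y) *\<^sub>R y)"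
    by (rule borel_integrable_compact[OF assms(1)]) (intro continuous_intros)
  from integral_inner_right[OF this, of a] show ?thesis
    by (simp add: set_lebesgue_integral_def gibbs_mean_def divide_inverse mult_ac)
qed

lemma gibbs_mean_in:
  assumes K: "compact K" "interior K \<noteq> {}" "convex K"
  shows "gibbs_mean K x \<in> K"
proof (rule ccontr)
  assume "gibbs_mean K x \<notin> K"
  then obtain a b where ab: "a \<bullet> gibbs_mean K x < b" "\<And>y. y \<in> K \<Longrightarrow> a \<bullet> y > b"
    using separating_hyperplane_closed_point[OF K(3) compact_imp_closed[OF K(1)]] by blast
  have "b * laplace K x = (LINT y:K|lborel. exp (x \<bullet> y) * b)"
    by (simp add: laplace_def)
  also have "\<dots> \<le> (LINT y:K|lborel. exp (x \<bullet> y) * (a \<bullet> y))"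
    by (intro set_integral_mono set_integrable_continuous_compact K continuous_intros)
       (use ab(2) in \<open>auto intro: less_imp_le\<close>)
  finally have "b \<le> a \<bullet> gibbs_mean K x"
    unfolding inner_gibbs_mean[OF K(1,2)] using laplace_pos[OF K(1,2), of x] by (simp add: field_simps)
  with ab(1) show False by simp
qed

text \<open>With \<open>m\<close> the mean of \<open>v \<bullet> y\<close> at \<open>x\<close>, the mean at \<open>x + v\<close> exceeds \<open>m\<close> because
  \<open>(s - m) (exp s - exp m) > 0\<close> for \<open>s \<noteq> m\<close>.\<close>

lemma gibbs_mean_strict_mono:
  assumes K: "compact K" "interior K \<noteq> {}" and v: "v \<noteq> 0"
  shows "v \<bullet> gibbs_mean K x < v \<bullet> gibbs_mean K (x + v)"
proof -
  define m where "m = v \<bullet> gibbs_mean K x"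
  have int: "set_integrable lborel K g" if "continuous_on K g" for g :: "'a \<Rightarrow> real"
    by (rule set_integrable_continuous_compact[OF K(1) that])
  have m: "(LINT y:K|lborel. exp (x \<bullet> y) * (v \<bullet> y)) = m * laplace K x"
    using laplace_pos[OF K, of x] by (simp add: m_def inner_gibbs_mean[OF K])
  have "(LINT y:K|lborel. exp (x \<bullet> y) * ((v \<bullet> y - m) * (exp (v \<bullet> y) - exp m))) > 0"
  proof (rule set_integral_pos[OF K])
    show "negligible {y \<in> K. exp (x \<bullet> y) * ((v \<bullet> y - m) * (exp (v \<bullet> y) - exp m)) = 0}"
      by (rule negligible_subset[OF negligible_hyperplane[of v m]]) (use v in auto)
    show "exp (x \<bullet> y) * ((v \<bullet> y - m) * (exp (v \<bullet> y) - exp m)) \<ge> 0" for y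
      using mult_nonneg_nonneg[of "v \<bullet> y - m" "exp (v \<bullet> y) - exp m"]
        mult_nonpos_nonpos[of "v \<bullet> y - m" "exp (v \<bullet> y) - exp m"]
      by (cases "v \<bullet> y \<le> m") auto
  qed (intro continuous_intros)
  also have "(LINT y:K|lborel. exp (x \<bullet> y) * ((v \<bullet> y - m) * (exp (v \<bullet> y) - exp m)))
    = (LINT y:K|lborel. exp ((x + v) \<bullet> y) * (v \<bullet> y) - m * exp ((x + v) \<bullet> y)
        - exp m * (exp (x \<bullet> y) * (v \<bullet> y) - m * exp (x \<bullet> y)))"
    by (intro set_lebesgue_integral_cong) (use K in \<open>auto simp: inner_add_left exp_add algebra_simps borel_compact\<close>)
  also have "\<dots> = (LINT y:K|lborel. exp ((x + v) \<bullet> y) * (v \<bullet> y)) - m * laplace K (x + v)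
      - exp m * ((LINT y:K|lborel. exp (x \<bullet> y) * (v \<bullet> y)) - m * laplace K x)"
    unfolding laplace_def
    by (subst set_integral_diff, (intro int continuous_intros)+,
        subst set_integral_diff, (intro int continuous_intros)+,
        subst set_integral_mult_right, subst set_integral_mult_right,
        subst set_integral_diff, (intro int continuous_intros)+) simp
  finally show ?thesis
    using m laplace_pos[OF K, of "x + v"]
    unfolding m_def[symmetric] inner_gibbs_mean[OF K, of v "x + v"] by (simp add: less_divide_eq)
qed

lemma ln_laplace_lower_bound:
  assumes K: "compact K" and k: "k \<in> interior K"
  shows "\<exists>c>0. \<exists>d. \<forall>x. ln (laplace K x) \<ge> k \<bullet> x + c * norm x - d"
proof -
  obtain r where r: "r > 0" "cball k r \<subseteq> K"
    using k by (auto simp: mem_interior_cball)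
  define c where "c = r / 4"
  let ?V = "measure lborel (cball (0::'a) c)"
  have V: "?V > 0" using content_cball_pos[of c] r by (simp add: c_def)
  have iK: "interior K \<noteq> {}" using k by auto
  have "ln (laplace K x) \<ge> k \<bullet> x + c * norm x - (- ln ?V)" for x
  proof -
    define v where "v = (if x = 0 then 0 else (r / 2 / norm x) *\<^sub>R x)"
    have v: "norm v \<le> r / 2" "v \<bullet> x = r / 2 * norm x"
      using r by (auto simp: v_def dot_square_norm power2_eq_square)
    have sub: "cball (k + v) c \<subseteq> K"
    proof (rule order_trans[OF _ r(2)])
      show "cball (k + v) c \<subseteq> cball k r"
        using v r by (subst cball_subset_cball_iff) (auto simp: c_def dist_norm)
    qed
    have low: "exp (x \<bullet> y) \<ge> exp (k \<bullet> x + c * norm x)" if "y \<in> cball (k + v) c" for y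
    proof -
      have "norm (y - (k + v)) \<le> c" using that by (simp add: dist_norm norm_minus_commute)
      then have "\<bar>(y - (k + v)) \<bullet> x\<bar> \<le> c * norm x"
        by (intro order_trans[OF Cauchy_Schwarz_ineq2] mult_right_mono) auto
      then have "(y - (k + v)) \<bullet> x \<ge> - (c * norm x)" by linarith
      then show ?thesis
        using v by (simp add: inner_diff_left inner_add_left c_def inner_commute[of x y])
    qed
    have "exp (k \<bullet> x + c * norm x) * ?V = (LINT y:cball (k + v) c|lborel. exp (k \<bullet> x + c * norm x))"
      using r by (simp add: set_lebesgue_integral_def c_def content_cball)
    also have "\<dots> \<le> (LINT y:cball (k + v) c|lborel. exp (x \<bullet> y))"
      by (intro set_integral_mono set_integrable_continuous_compact continuous_intros) (use low in auto)
    also have "\<dots> \<le> laplace K x"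
      unfolding laplace_def set_lebesgue_integral_def
      by (intro integral_mono borel_integrable_compact continuous_intros K)
         (use sub in \<open>auto simp: indicator_def\<close>)
    finally have "ln (exp (k \<bullet> x + c * norm x) * ?V) \<le> ln (laplace K x)"
      using V laplace_pos[OF K iK, of x] by (subst ln_le_cancel_iff) auto
    then show ?thesis using V by (simp add: ln_mult)
  qed
  then show ?thesis using r by (intro exI[of _ c] conjI exI[of _ "- ln ?V"]) (auto simp: c_def)
qed

lemma gibbs_mean_sum_surj:
  assumes K: "compact K" and E: "compact E" and l: "l \<ge> 0"
    and k: "k \<in> interior K" and e: "e \<in> interior E"
  shows "\<exists>x. gibbs_mean K x + l *\<^sub>R gibbs_mean E x = k + l *\<^sub>R e"
proof -
  have iK: "interior K \<noteq> {}" and iE: "interior E \<noteq> {}" using k e by auto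
  define \<psi> where "\<psi> x = ln (laplace K x) + l * ln (laplace E x) - (k + l *\<^sub>R e) \<bullet> x" for x
  obtain c d where c: "c > 0" "\<And>x. ln (laplace K x) \<ge> k \<bullet> x + c * norm x - d"
    using ln_laplace_lower_bound[OF K k] by blast
  obtain c' d' where c': "c' > 0" "\<And>x. ln (laplace E x) \<ge> e \<bullet> x + c' * norm x - d'"
    using ln_laplace_lower_bound[OF E e] by blast
  have low: "\<psi> x \<ge> c * norm x - (d + l * d')" for x
  proof -
    have "l * ln (laplace E x) \<ge> l * (e \<bullet> x + c' * norm x - d')"
      using c'(2) l by (intro mult_left_mono) auto
    moreover have "l * (c' * norm x) \<ge> 0" using l c' by simp
    ultimately show ?thesis
      using c(2)[of x] by (simp add: \<psi>_def inner_add_left algebra_simps)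
  qed
  have der: "(\<psi> has_derivative (\<lambda>h. gibbs_mean K x \<bullet> h + l * (gibbs_mean E x \<bullet> h) - (k + l *\<^sub>R e) \<bullet> h)) (at x)" for x
    unfolding \<psi>_def
    by (intro has_derivative_diff has_derivative_add has_derivative_mult_right
        has_derivative_ln_laplace has_derivative_inner_right has_derivative_ident K E iK iE)
  define R where "R = max 0 ((\<psi> 0 + (d + l * d')) / c)"
  have "continuous_on (cball 0 R) \<psi>"
    by (rule has_derivative_continuous_on) (rule has_derivative_at_withinI[OF der])
  then obtain x where x: "x \<in> cball 0 R" "\<And>y. y \<in> cball 0 R \<Longrightarrow> \<psi> x \<le> \<psi> y"
    using continuous_attains_inf[of "cball 0 R" \<psi>] by (auto simp: R_def)
  have "\<psi> x \<le> \<psi> y" for y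
  proof (cases "y \<in> cball 0 R")
    case False
    then have "norm y > (\<psi> 0 + (d + l * d')) / c" by (auto simp: R_def)
    then have "\<psi> 0 \<le> \<psi> y" using low[of y] c(1) by (simp add: field_simps)
    moreover have "\<psi> x \<le> \<psi> 0" using x(2) by (simp add: R_def)
    ultimately show ?thesis by simp
  qed (use x in auto)
  then have "(\<lambda>h. gibbs_mean K x \<bullet> h + l * (gibbs_mean E x \<bullet> h) - (k + l *\<^sub>R e) \<bullet> h) = (\<lambda>h. 0)"
    using der by (intro differential_zero_maxmin[of x UNIV \<psi>]) auto
  then have "(gibbs_mean K x + l *\<^sub>R gibbs_mean E x - (k + l *\<^sub>R e)) \<bullet> h = 0" for h
    by (simp add: fun_eq_iff inner_add_left inner_diff_left)
  then have "gibbs_mean K x + l *\<^sub>R gibbs_mean E x - (k + l *\<^sub>R e) = 0"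
    using inner_eq_zero_iff by blast
  then show ?thesis by auto
qed

lemma det_nonneg_of_monotone:
  fixes H :: "real ^ 'n::finite \<Rightarrow> real ^ 'n"
  assumes lin: "linear H" and pos: "\<And>h. h \<bullet> H h \<ge> 0"
  shows "det (matrix H) \<ge> 0"
proof (rule ccontr)
  assume neg: "\<not> ?thesis"
  define A where "A s = (1 - s) *\<^sub>R mat 1 + s *\<^sub>R matrix H" for s :: real
  have "\<exists>s. 0 \<le> s \<and> s \<le> 1 \<and> det (A s) = 0"
  proof (rule IVT2')
    show "continuous_on {0..1} (\<lambda>s. det (A s))"
      unfolding A_def det_def by (intro continuous_intros)
  qed (use neg in \<open>auto simp: A_def\<close>)
  then obtain s where s: "0 \<le> s" "s \<le> 1" "det (A s) = 0" by blast
  have "s \<noteq> 1" using s(3) neg by (auto simp: A_def)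
  then have "s < 1" using s by simp
  have "\<not> invertible (A s)" using s(3) by (simp add: invertible_det_nz)
  then obtain h where h: "h \<noteq> 0" "A s *v h = 0"
    using invertible_left_inverse matrix_left_invertible_ker by blast
  have "0 = h \<bullet> (A s *v h)" using h by simp
  also have "\<dots> = (1 - s) * (h \<bullet> h) + s * (h \<bullet> H h)"
    using lin by (simp add: A_def matrix_vector_mult_add_rdistrib inner_add_right
        scaleR_matrix_vector_assoc[symmetric] matrix_works)
  also have "\<dots> > 0"
    using h \<open>s < 1\<close> s pos[of h] by (intro add_pos_nonneg) auto
  finally show False by simp
qed

lemma monotone_derivative_nonneg:
  fixes G :: "'a::euclidean_space \<Rightarrow> 'a"
  assumes der: "(G has_derivative D) (at x)" and mono: "\<And>x v. v \<bullet> G x \<le> v \<bullet> G (x + v)"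
  shows "h \<bullet> D h \<ge> 0"
proof -
  have "((\<lambda>s. h \<bullet> G (x + s *\<^sub>R h)) has_derivative (\<lambda>s. h \<bullet> D (s *\<^sub>R h))) (at 0)"
    using der by (auto intro!: derivative_eq_intros has_derivative_compose[of "\<lambda>s. x + s *\<^sub>R h" _ 0 UNIV G D])
  moreover have "linear D" using der by (rule has_derivative_linear)
  ultimately have "((\<lambda>s. h \<bullet> G (x + s *\<^sub>R h)) has_real_derivative (h \<bullet> D h)) (at 0)"
    by (simp add: has_field_derivative_def linear_cmul mult.commute[of _ "h \<bullet> D h"] fun_eq_iff)
  then have "((\<lambda>s. (h \<bullet> G (x + s *\<^sub>R h) - h \<bullet> G x) / s) \<longlongrightarrow> h \<bullet> D h) (at_right 0)"
    by (simp add: DERIV_def filterlim_at_split)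
  moreover have "\<forall>\<^sub>F s in at_right 0. (h \<bullet> G (x + s *\<^sub>R h) - h \<bullet> G x) / s \<ge> 0"
    unfolding eventually_at_filter
  proof (intro always_eventually allI impI)
    fix s :: real assume "s \<in> {0<..}"
    then have s: "s > 0" by simp
    have "s * (h \<bullet> G x) \<le> s * (h \<bullet> G (x + s *\<^sub>R h))"
      using mono[of "s *\<^sub>R h" x] by simp
    then show "(h \<bullet> G (x + s *\<^sub>R h) - h \<bullet> G x) / s \<ge> 0" using s by simp
  qed
  ultimately show ?thesis by (rule tendsto_lowerbound) simp
qed

lemma det_pencil_poly:
  fixes A B :: "real ^ 'n::finite ^ 'n"
  shows "\<exists>p. degree p \<le> CARD('n) \<and> (\<forall>l. det (A + l *\<^sub>R B) = poly p l)"
proof (intro exI conjI allI)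
  let ?p = "\<Sum>\<sigma> | \<sigma> permutes UNIV. smult (of_int (sign \<sigma>)) (\<Prod>i\<in>UNIV. [:A $ i $ \<sigma> i, B $ i $ \<sigma> i:])"
  show "degree ?p \<le> CARD('n)"
  proof (intro degree_sum_le)
    fix \<sigma> :: "'n \<Rightarrow> 'n"
    have "degree (\<Prod>i\<in>UNIV. [:A $ i $ \<sigma> i, B $ i $ \<sigma> i:]) \<le> (\<Sum>i\<in>(UNIV::'n set). degree [:A $ i $ \<sigma> i, B $ i $ \<sigma> i:])"
      by (rule degree_prod_sum_le[unfolded o_def]) simp
    also have "\<dots> \<le> (\<Sum>i\<in>(UNIV::'n set). 1)" by (intro sum_mono) auto
    finally show "degree (smult (of_int (sign \<sigma>)) (\<Prod>i\<in>UNIV. [:A $ i $ \<sigma> i, B $ i $ \<sigma> i:])) \<le> CARD('n)"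
      using degree_smult_le order_trans by force
  qed simp
  show "det (A + l *\<^sub>R B) = poly ?p l" for l
    by (simp add: det_def poly_sum poly_prod mult.commute)
qed

definition lagrange_basis :: "nat \<Rightarrow> nat \<Rightarrow> real poly" where
  "lagrange_basis n j = (\<Prod>k\<in>{..n} - {j}. smult (1 / (real j - real k)) [:- real k, 1:])"

lemma poly_lagrange_basis:
  assumes "i \<le> n" "j \<le> n"
  shows "poly (lagrange_basis n j) (real i) = (if i = j then 1 else 0)"
  using assms by (auto simp: lagrange_basis_def poly_prod diff_divide_distrib[symmetric] intro!: prod.neutral)

lemma degree_lagrange_basis:
  assumes "j \<le> n"
  shows "degree (lagrange_basis n j) \<le> n"
proof -
  have "degree (lagrange_basis n j) \<le> (\<Sum>k\<in>{..n} - {j}. degree (smult (1 / (real j - real k)) [:- real k, 1:]))"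
    unfolding lagrange_basis_def by (rule degree_prod_sum_le[unfolded o_def]) simp
  also have "\<dots> \<le> (\<Sum>k\<in>{..n} - {j}. 1)"
    by (intro sum_mono order_trans[OF degree_smult_le]) auto
  also have "\<dots> = n" using assms by simp
  finally show ?thesis .
qed

lemma lagrange_interpolation:
  assumes "degree p \<le> n"
  shows "p = (\<Sum>j\<le>n. smult (poly p (real j)) (lagrange_basis n j))"
proof (rule poly_eqI_degree[where A = "real ` {..n}"])
  have c: "card (real ` {..n}) = Suc n" by (subst card_image) auto
  show "degree p < card (real ` {..n})" using assms c by simp
  have "degree (\<Sum>j\<le>n. smult (poly p (real j)) (lagrange_basis n j)) \<le> n"
    by (intro degree_sum_le order_trans[OF degree_smult_le] degree_lagrange_basis) auto
  then show "degree (\<Sum>j\<le>n. smult (poly p (real j)) (lagrange_basis n j)) < card (real ` {..n})"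
    using c by simp
  fix x assume "x \<in> real ` {..n}"
  then obtain i where i: "i \<le> n" "x = real i" by auto
  then show "poly p x = poly (\<Sum>j\<le>n. smult (poly p (real j)) (lagrange_basis n j)) x"
    by (simp add: poly_sum poly_lagrange_basis if_distrib[of "\<lambda>x. _ * x"] sum.delta' cong: if_cong)
qed

lemma measure_eq_of_convex_sandwich:
  fixes U :: "'a::euclidean_space set"
  assumes "open U" "convex U" "bounded U" "U \<subseteq> I" "I \<subseteq> closure U"
  shows "I \<in> lmeasurable" "measure lebesgue I = measure lebesgue U"
proof -
  have U: "U \<in> lmeasurable" using assms by (simp add: lmeasurable_open)
  have "U \<union> I - U \<inter> I \<subseteq> frontier U"
    using assms by (auto simp: frontier_def interior_open)
  then have n: "negligible ((U - I) \<union> (I - U))"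
    by (intro negligible_subset[OF negligible_convex_frontier[OF assms(2)]]) auto
  show "I \<in> lmeasurable" by (rule lmeasurable_negligible_symdiff[OF U n])
  show "measure lebesgue I = measure lebesgue U" by (rule measure_negligible_symdiff[OF U n])
qed

lemma compact_set_plus:
  fixes K L :: "'a::real_normed_vector set"
  assumes "compact K" "compact L"
  shows "compact (K + L)"
proof -
  have "K + L = (\<lambda>(x, y). x + y) ` (K \<times> L)" by (auto simp: set_plus_def)
  then show ?thesis
    using compact_Times[OF assms] by (auto intro!: compact_continuous_image continuous_intros simp: case_prod_beta')
qed

lemma gibbs_mean_sum_range:
  fixes K E :: "'a::euclidean_space set"
  assumes K: "compact K" "convex K" "interior K \<noteq> {}"
    and E: "compact E" "convex E" "interior E \<noteq> {}" and l: "l \<ge> 0"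
  defines "I \<equiv> range (\<lambda>x. gibbs_mean K x + l *\<^sub>R gibbs_mean E x)"
  shows "I \<in> lmeasurable" "measure lebesgue I = measure lebesgue (K + (*\<^sub>R) l ` E)"
proof -
  define U where "U = interior K + (*\<^sub>R) l ` interior E"
  let ?W = "K + (*\<^sub>R) l ` E"
  have "U = (\<Union>y\<in>(*\<^sub>R) l ` interior E. (+) y ` interior K)"
    by (auto simp: U_def set_plus_def add.commute)
  then have oU: "open U" by (auto intro: open_translation)
  have cU: "convex U"
    unfolding U_def using K E by (intro convex_set_plus convex_scaling) auto
  have cW: "compact ?W"
    using K E by (intro compact_set_plus compact_scaling)
  have UW: "U \<subseteq> ?W"
    unfolding U_def by (intro set_plus_mono2 image_mono interior_subset)
  have bU: "bounded U" using cW UW compact_imp_bounded bounded_subset by blast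
  have WU: "?W \<subseteq> closure U"
  proof
    fix z assume "z \<in> ?W"
    then obtain x y where z: "z = x + l *\<^sub>R y" "x \<in> K" "y \<in> E" by (auto elim: set_plus_elim)
    have "x \<in> closure (interior K)" "y \<in> closure (interior E)"
      using z K E by (simp_all add: convex_closure_interior compact_imp_closed)
    then obtain f g where f: "\<And>n. f n \<in> interior K" "f \<longlonglongrightarrow> x" and g: "\<And>n. g n \<in> interior E" "g \<longlonglongrightarrow> y"
      unfolding closure_sequential by blast
    have "(\<lambda>n. f n + l *\<^sub>R g n) \<longlonglongrightarrow> z"
      unfolding z by (intro tendsto_intros f g)
    moreover have "f n + l *\<^sub>R g n \<in> U" for n
      unfolding U_def using f g by (intro set_plus_intro) auto
    ultimately show "z \<in> closure U"
      unfolding closure_sequential by (intro exI[of _ "\<lambda>n. f n + l *\<^sub>R g n"]) auto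
  qed
  have IW: "I \<subseteq> ?W"
    using gibbs_mean_in K E by (auto simp: I_def intro!: set_plus_intro)
  have UI: "U \<subseteq> I"
  proof
    fix z assume "z \<in> U"
    then obtain k e where ke: "z = k + l *\<^sub>R e" "k \<in> interior K" "e \<in> interior E"
      unfolding U_def by (auto elim: set_plus_elim)
    obtain x where "gibbs_mean K x + l *\<^sub>R gibbs_mean E x = z"
      using gibbs_mean_sum_surj[OF K(1) E(1) l ke(2,3)] ke(1) by auto
    then show "z \<in> I" unfolding I_def by auto
  qed
  show "I \<in> lmeasurable"
    using measure_eq_of_convex_sandwich(1)[OF oU cU bU UI] IW WU by auto
  show "measure lebesgue I = measure lebesgue ?W"
    using measure_eq_of_convex_sandwich(2)[OF oU cU bU UI] IW WU
      measure_eq_of_convex_sandwich(2)[OF oU cU bU UW WU] by auto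
qed

text \<open>The sum of the two gradient maps is injective with image \<open>K + l E\<close> up to a null set, and its
  Jacobian is for each point a polynomial in \<open>l\<close>. Interpolation moves the polynomial dependence
  through the integral.\<close>

lemma steiner_polynomial_ordered:
  fixes K E :: "(real ^ 'n::{finite,wellorder}) set"
  assumes K: "compact K" "convex K" "interior K \<noteq> {}"
    and E: "compact E" "convex E" "interior E \<noteq> {}"
  shows "\<exists>p. degree p \<le> CARD('n) \<and> (\<forall>l\<ge>0. measure lebesgue (K + (*\<^sub>R) l ` E) = poly p l)"
proof -
  have "\<forall>x. \<exists>D. (gibbs_mean K has_derivative D) (at x)" "\<forall>x. \<exists>D. (gibbs_mean E has_derivative D) (at x)"
    using gibbs_mean_differentiable K E by (auto simp: differentiable_def)
  then obtain A B where A: "\<And>x. (gibbs_mean K has_derivative A x) (at x)"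
    and B: "\<And>x. (gibbs_mean E has_derivative B x) (at x)"
    by metis
  have "\<forall>x. \<exists>p. degree p \<le> CARD('n) \<and> (\<forall>l. det (matrix (A x) + l *\<^sub>R matrix (B x)) = poly p l)"
    using det_pencil_poly by blast
  then obtain p where p: "\<And>x. degree (p x) \<le> CARD('n)"
    "\<And>x l. det (matrix (A x) + l *\<^sub>R matrix (B x)) = poly (p x) l"
    by metis
  let ?V = "\<lambda>l. measure lebesgue (K + (*\<^sub>R) l ` E)"
  have V: "((\<lambda>x. poly (p x) l) has_integral ?V l) UNIV" if l: "l \<ge> 0" for l
  proof -
    let ?G = "\<lambda>x. gibbs_mean K x + l *\<^sub>R gibbs_mean E x" and ?D = "\<lambda>x h. A x h + l *\<^sub>R B x h"
    have mono: "v \<bullet> ?G x < v \<bullet> ?G (x + v)" if "v \<noteq> 0" for x v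
      using gibbs_mean_strict_mono[OF K(1,3) that, of x] gibbs_mean_strict_mono[OF E(1,3) that, of x] l
      by (simp add: inner_add_right add_less_le_mono mult_left_mono)
    have der: "(?G has_derivative ?D x) (at x)" for x
      by (intro has_derivative_add has_derivative_scaleR_right A B)
    have inj: "inj ?G"
    proof (rule injI, rule ccontr)
      fix x y assume "?G x = ?G y" "x \<noteq> y"
      then show False using mono[of "y - x" x] by simp
    qed
    have "((\<lambda>x. \<bar>det (matrix (?D x))\<bar>) has_integral ?V l) UNIV"
      using has_measure_differentiable_image[of UNIV ?G ?D "?V l"] der inj gibbs_mean_sum_range[OF K E l]
      by simp
    moreover have "\<bar>det (matrix (?D x))\<bar> = poly (p x) l" for x
    proof -
      have "matrix (?D x) = matrix (A x) + l *\<^sub>R matrix (B x)"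
        by (simp add: matrix_def vec_eq_iff)
      moreover have "det (matrix (?D x)) \<ge> 0"
      proof (rule det_nonneg_of_monotone)
        show "linear (?D x)" by (rule has_derivative_linear[OF der])
        show "h \<bullet> ?D x h \<ge> 0" for h
        proof (rule monotone_derivative_nonneg[OF der])
          show "v \<bullet> ?G x \<le> v \<bullet> ?G (x + v)" for x v
            using mono[of v x] by (cases "v = 0") auto
        qed
      qed
      ultimately show ?thesis by (simp add: p(2))
    qed
    ultimately show ?thesis by simp
  qed
  define q where "q = (\<Sum>j\<le>CARD('n). smult (?V (real j)) (lagrange_basis CARD('n) j))"
  have "?V l = poly q l" if l: "l \<ge> 0" for l
  proof -
    have "((\<lambda>x. \<Sum>j\<le>CARD('n). poly (p x) (real j) * poly (lagrange_basis CARD('n) j) l) has_integral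
       (\<Sum>j\<le>CARD('n). ?V (real j) * poly (lagrange_basis CARD('n) j) l)) UNIV"
      by (intro has_integral_sum has_integral_mult_left V) auto
    moreover have "(\<Sum>j\<le>CARD('n). poly (p x) (real j) * poly (lagrange_basis CARD('n) j) l) = poly (p x) l" for x
      by (subst (2) lagrange_interpolation[OF p(1)]) (simp add: poly_sum)
    ultimately have "((\<lambda>x. poly (p x) l) has_integral poly q l) UNIV"
      by (simp add: q_def poly_sum)
    with V[OF l] show ?thesis by (rule has_integral_unique)
  qed
  moreover have "degree q \<le> CARD('n)"
    unfolding q_def by (intro degree_sum_le order_trans[OF degree_smult_le] degree_lagrange_basis) auto
  ultimately show ?thesis by blast
qed

section \<open>Brunn--Minkowski inequality with equality case\<close>

lemma cdf_properties:
  fixes a :: "real \<Rightarrow> real"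
  assumes pq: "p < q" and cont: "continuous_on {p<..<q} a" and pos: "\<And>s. s \<in> {p<..<q} \<Longrightarrow> a s > 0"
    and int: "a integrable_on {p..q}"
  defines "F \<equiv> \<lambda>s. integral {p..s} a"
  shows "continuous_on {p..q} F" "\<And>s. s \<in> {p<..<q} \<Longrightarrow> (F has_real_derivative a s) (at s)"
    "strict_mono_on {p..q} F" "F p = 0" "F q > 0"
proof -
  show c: "continuous_on {p..q} F"
    unfolding F_def by (rule indefinite_integral_continuous_1[OF int])
  show d: "(F has_real_derivative a s) (at s)" if s: "s \<in> {p<..<q}" for s
  proof -
    have "continuous (at s) a"
      using cont s by (simp add: continuous_on_eq_continuous_at)
    then have "(F has_vector_derivative a s) (at s within {p..q})"
      using integral_has_vector_derivative_continuous_at[OF int, of s "{}"] s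
      by (simp add: F_def continuous_at_imp_continuous_at_within)
    then show ?thesis
      using s by (simp add: has_real_derivative_iff_has_vector_derivative at_within_Icc_at)
  qed
  show m: "strict_mono_on {p..q} F"
  proof (rule strict_mono_onI)
    fix r s assume rs: "r \<in> {p..q}" "s \<in> {p..q}" "r < s"
    show "F r < F s"
    proof (rule DERIV_pos_imp_increasing_open[OF rs(3)])
      show "\<exists>y. DERIV F x :> y \<and> y > 0" if "r < x" "x < s" for x
        using d[of x] pos[of x] that rs by auto
      show "continuous_on {r..s} F"
        using c by (rule continuous_on_subset) (use rs in auto)
    qed
  qed
  show "F p = 0" by (simp add: F_def)
  with strict_mono_onD[OF m, of p q] pq show "F q > 0" by simp
qed

lemma monotone_transport:
  fixes a b :: "real \<Rightarrow> real"
  assumes pq: "p < q" "continuous_on {p<..<q} a" "\<And>s. s \<in> {p<..<q} \<Longrightarrow> a s > 0" "a integrable_on {p..q}"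
    and pq': "p' < q'" "continuous_on {p'<..<q'} b" "\<And>s. s \<in> {p'<..<q'} \<Longrightarrow> b s > 0" "b integrable_on {p'..q'}"
  defines "\<alpha> \<equiv> integral {p..q} a" and "\<beta> \<equiv> integral {p'..q'} b"
  obtains T where "T ` {p<..<q} = {p'<..<q'}" "strict_mono_on {p<..<q} T"
    "\<And>s. s \<in> {p<..<q} \<Longrightarrow> (T has_real_derivative (a s / \<alpha>) / (b (T s) / \<beta>)) (at s)"
proof -
  define F where "F s = integral {p..s} a / \<alpha>" for s
  define G where "G s = integral {p'..s} b / \<beta>" for s
  note A = cdf_properties[OF pq, folded \<alpha>_def] and B = cdf_properties[OF pq', folded \<beta>_def]
  have \<alpha>: "\<alpha> > 0" and \<beta>: "\<beta> > 0" using A B by auto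
  have F: "continuous_on {p..q} F" "\<And>s. s \<in> {p<..<q} \<Longrightarrow> (F has_real_derivative a s / \<alpha>) (at s)"
    "strict_mono_on {p..q} F" "F p = 0" "F q = 1"
    using A \<alpha> unfolding F_def
    by (auto intro!: continuous_intros derivative_eq_intros simp: strict_mono_on_def divide_strict_right_mono \<alpha>_def)
  have G: "continuous_on {p'..q'} G" "\<And>s. s \<in> {p'<..<q'} \<Longrightarrow> (G has_real_derivative b s / \<beta>) (at s)"
    "strict_mono_on {p'..q'} G" "G p' = 0" "G q' = 1"
    using B \<beta> unfolding G_def
    by (auto intro!: continuous_intros derivative_eq_intros simp: strict_mono_on_def divide_strict_right_mono \<beta>_def)
  have Fim: "F s \<in> {0<..<1}" if "s \<in> {p<..<q}" for s
    using strict_mono_onD[OF F(3), of p s] strict_mono_onD[OF F(3), of s q] F(4,5) that by auto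
  have Gim: "G s \<in> {0<..<1}" if "s \<in> {p'<..<q'}" for s
    using strict_mono_onD[OF G(3), of p' s] strict_mono_onD[OF G(3), of s q'] G(4,5) that by auto
  have injG: "inj_on G {p'..q'}" using G(3) by (rule strict_mono_on_imp_inj_on)
  have Gsurj: "G ` {p'..q'} = {0..1}"
  proof
    show "G ` {p'..q'} \<subseteq> {0..1}"
    proof safe
      fix s assume "s \<in> {p'..q'}"
      then show "G s \<in> {0..1}"
        using strict_mono_on_leD[OF G(3), of p' s] strict_mono_on_leD[OF G(3), of s q'] G(4,5) by auto
    qed
    show "{0..1} \<subseteq> G ` {p'..q'}"
      using IVT'[of G p' _ q'] G pq'(1) by (force simp: image_iff)
  qed
  define Q where "Q = inv_into {p'..q'} G"
  have QG: "Q (G s) = s" if "s \<in> {p'..q'}" for s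
    unfolding Q_def using inv_into_f_f[OF injG that] .
  have GQ: "G (Q t) = t" "Q t \<in> {p'..q'}" if "t \<in> {0..1}" for t
    unfolding Q_def using f_inv_into_f[of t G "{p'..q'}"] inv_into_into[of t G "{p'..q'}"] Gsurj that by auto
  have contQ: "continuous_on {0..1} Q"
    using continuous_on_inv[OF G(1) compact_Icc, of Q] QG Gsurj by simp
  have Qim: "Q t \<in> {p'<..<q'}" if t: "t \<in> {0<..<1}" for t
  proof -
    have "Q t \<noteq> p'" "Q t \<noteq> q'" using GQ(1)[of t] t G(4,5) by auto
    with GQ(2)[of t] t show ?thesis by auto
  qed
  have dQ: "(Q has_real_derivative inverse (b (Q t) / \<beta>)) (at t)" if t: "t \<in> {0<..<1}" for t
  proof (rule DERIV_inverse_function[where a = 0 and b = 1 and f = G])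
    show "DERIV G (Q t) :> b (Q t) / \<beta>" by (rule G(2)[OF Qim[OF t]])
    show "b (Q t) / \<beta> \<noteq> 0" using pq'(3)[OF Qim[OF t]] \<beta> by simp
    show "isCont Q t" using contQ t by (intro continuous_on_interior[of "{0..1}"]) auto
  qed (use t GQ in auto)
  have smQ: "strict_mono_on {0..1} Q"
  proof (rule strict_mono_onI)
    fix r s :: real assume "r \<in> {0..1}" "s \<in> {0..1}" "r < s"
    then show "Q r < Q s"
      using GQ[of r] GQ[of s] strict_mono_on_leD[OF G(3), of "Q s" "Q r"] by (metis linorder_not_less)
  qed
  define T where "T = Q \<circ> F"
  show ?thesis
  proof (rule that[of T])
    show "strict_mono_on {p<..<q} T"
    proof (rule strict_mono_onI)
      fix r s assume rs: "r \<in> {p<..<q}" "s \<in> {p<..<q}" "r < s"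
      have "F r < F s" using strict_mono_onD[OF F(3), of r s] rs by auto
      then show "T r < T s"
        unfolding T_def using strict_mono_onD[OF smQ, of "F r" "F s"] Fim[OF rs(1)] Fim[OF rs(2)] by auto
    qed
    show "(T has_real_derivative (a s / \<alpha>) / (b (T s) / \<beta>)) (at s)" if s: "s \<in> {p<..<q}" for s
      using DERIV_chain[OF dQ[OF Fim[OF s]] F(2)[OF s]] by (simp add: T_def field_simps)
    show "T ` {p<..<q} = {p'<..<q'}"
    proof
      show "T ` {p<..<q} \<subseteq> {p'<..<q'}" using Qim Fim by (auto simp: T_def)
      show "{p'<..<q'} \<subseteq> T ` {p<..<q}"
      proof
        fix y assume y: "y \<in> {p'<..<q'}"
        then have "G y \<in> {0<..<1}" by (rule Gim)
        then obtain s where s: "p \<le> s" "s \<le> q" "F s = G y"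
          using IVT'[of F p "G y" q] F pq(1) by auto
        have "s \<noteq> p" "s \<noteq> q" using s(3) F(4,5) \<open>G y \<in> {0<..<1}\<close> by auto
        then have "s \<in> {p<..<q}" using s by auto
        moreover have "T s = y" using s(3) QG[of y] y by (simp add: T_def)
        ultimately show "y \<in> T ` {p<..<q}" by blast
      qed
    qed
  qed
qed

lemma weighted_am_gm:
  fixes r t :: real
  assumes "r > 0" "0 < t" "t < 1"
  shows "r powr t \<le> 1 - t + t * r" and "r \<noteq> 1 \<Longrightarrow> r powr t < 1 - t + t * r"
proof -
  define y where "y = 1 - t + t * r"
  have y: "y > 0" using assms by (simp add: y_def add_pos_pos)
  have eq: "t * ln r - ln y = (1 - t) * ln (1 / y) + t * ln (r / y)"
    using assms y by (simp add: ln_div algebra_simps)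
  have le1: "ln (1 / y) \<le> 1 / y - 1" "ln (r / y) \<le> r / y - 1"
    using y assms by (auto intro!: ln_le_minus_one)
  have sum0: "(1 - t) * (1 / y - 1) + t * (r / y - 1) = 0"
    using y by (simp add: field_simps y_def)
  have powr: "r powr t = exp (t * ln r)" using assms by (simp add: powr_def)
  have "t * ln r - ln y \<le> 0"
    unfolding eq sum0[symmetric] using le1 assms by (intro add_mono mult_left_mono) auto
  then have "t * ln r \<le> ln y" by simp
  then have "exp (t * ln r) \<le> exp (ln y)" by (subst exp_le_cancel_iff)
  then show "r powr t \<le> 1 - t + t * r" by (metis exp_ln powr y y_def)
  assume r: "r \<noteq> 1"
  have "1 / y \<noteq> 1"
    using r assms y by (auto simp: y_def field_simps)
  then have "ln (1 / y) \<noteq> 1 / y - 1"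
    using ln_eq_minus_one[of "1 / y"] y by auto
  then have lt1: "ln (1 / y) < 1 / y - 1" using le1 by simp
  have "t * ln r - ln y < 0"
    unfolding eq sum0[symmetric] using lt1 le1 assms by (intro add_less_le_mono mult_left_mono mult_strict_left_mono) auto
  then have "exp (t * ln r) < exp (ln y)" by (subst exp_less_cancel_iff) simp
  then show "r powr t < 1 - t + t * r" by (metis exp_ln powr y y_def)
qed

lemma prekopa_1d:
  fixes a b c :: "real \<Rightarrow> real"
  assumes t: "0 < t" "t < 1"
    and pq: "p < q" "continuous_on {p<..<q} a" "\<And>s. s \<in> {p<..<q} \<Longrightarrow> a s > 0" "a integrable_on {p..q}"
    and pq': "p' < q'" "continuous_on {p'<..<q'} b" "\<And>s. s \<in> {p'<..<q'} \<Longrightarrow> b s > 0" "b integrable_on {p'..q'}"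
    and c: "\<And>s. c s \<ge> 0" "c absolutely_integrable_on UNIV"
    and abc: "\<And>s s'. s \<in> {p<..<q} \<Longrightarrow> s' \<in> {p'<..<q'} \<Longrightarrow>
        a s powr (1 - t) * b s' powr t \<le> c ((1 - t) * s + t * s')"
  defines "\<alpha> \<equiv> integral {p..q} a" and "\<beta> \<equiv> integral {p'..q'} b"
  shows "\<alpha> powr (1 - t) * \<beta> powr t \<le> integral UNIV c" (is ?inequality)
    and "\<alpha> = \<beta> \<Longrightarrow> integral UNIV c \<le> \<alpha> \<Longrightarrow>
      \<exists>d. p' = p + d \<and> q' = q + d \<and> (\<forall>s\<in>{p<..<q}. b (s + d) = a s)" (is "_ \<Longrightarrow> _ \<Longrightarrow> ?equality")
proof -
  obtain T where T: "T ` {p<..<q} = {p'<..<q'}" "strict_mono_on {p<..<q} T"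
    and dT: "\<And>s. s \<in> {p<..<q} \<Longrightarrow> (T has_real_derivative (a s / \<alpha>) / (b (T s) / \<beta>)) (at s)"
    using monotone_transport[OF pq pq', folded \<alpha>_def \<beta>_def] by blast
  have \<alpha>: "\<alpha> > 0" and \<beta>: "\<beta> > 0"
    using cdf_properties(5)[OF pq] cdf_properties(5)[OF pq'] by (auto simp: \<alpha>_def \<beta>_def)
  have Tin: "T s \<in> {p'<..<q'}" if "s \<in> {p<..<q}" for s using T(1) that by blast
  define \<rho> where "\<rho> s = (a s / \<alpha>) / (b (T s) / \<beta>)" for s
  have \<rho>: "\<rho> s > 0" if "s \<in> {p<..<q}" for s
    using pq(3)[OF that] pq'(3)[OF Tin[OF that]] \<alpha> \<beta> by (simp add: \<rho>_def)
  define S where "S s = (1 - t) * s + t * T s" for s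
  define m where "m s = a s powr (1 - t) * b (T s) powr t * (1 - t + t * \<rho> s)" for s
  define w where "w s = \<bar>1 - t + t * \<rho> s\<bar> * c (S s)" for s
  have dS: "(S has_real_derivative (1 - t + t * \<rho> s)) (at s)" if "s \<in> {p<..<q}" for s
    unfolding S_def \<rho>_def by (auto intro!: derivative_eq_intros dT that)
  have smS: "strict_mono_on {p<..<q} S"
    using T(2) t unfolding strict_mono_on_def S_def by (auto intro!: add_strict_mono)
  have key: "a s powr (1 - t) * b (T s) powr t * \<rho> s powr t = a s * (\<beta> / \<alpha>) powr t" if s: "s \<in> {p<..<q}" for s
  proof -
    have ab: "a s > 0" "b (T s) > 0" using pq(3)[OF s] pq'(3)[OF Tin[OF s]] by auto
    have "b (T s) powr t * \<rho> s powr t = (b (T s) * \<rho> s) powr t"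
      using ab \<rho>[OF s] by (simp add: powr_mult)
    also have "b (T s) * \<rho> s = a s * (\<beta> / \<alpha>)"
      using ab by (simp add: \<rho>_def)
    also have "(a s * (\<beta> / \<alpha>)) powr t = a s powr t * (\<beta> / \<alpha>) powr t"
      using ab \<alpha> \<beta> by (subst powr_mult) auto
    finally have "a s powr (1 - t) * b (T s) powr t * \<rho> s powr t = (a s powr (1 - t) * a s powr t) * (\<beta> / \<alpha>) powr t"
      by (simp add: mult.assoc)
    then show ?thesis using ab by (simp add: powr_add[symmetric])
  qed
  have le_m: "a s * (\<beta> / \<alpha>) powr t \<le> m s" if s: "s \<in> {p<..<q}" for s
    unfolding key[OF s, symmetric] m_def
    using weighted_am_gm(1)[OF \<rho>[OF s] t] by (intro mult_left_mono) auto
  have m_le: "m s \<le> w s" if s: "s \<in> {p<..<q}" for s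
  proof -
    have "1 - t + t * \<rho> s > 0" using t \<rho>[OF s] by (simp add: add_pos_pos)
    then show ?thesis
      using mult_left_mono[OF abc[OF s Tin[OF s]], of "1 - t + t * \<rho> s"]
      by (simp add: w_def m_def S_def mult.commute)
  qed
  have int_a: "a integrable_on {p<..<q}" "integral {p<..<q} a = \<alpha>"
    using pq(4) by (auto simp: integrable_on_open_interval_real integral_open_interval_real \<alpha>_def)
  have "is_interval (S ` {p<..<q})"
  proof -
    have "continuous_on {p<..<q} S"
      using dS by (intro continuous_at_imp_continuous_on ballI DERIV_isCont) auto
    then show ?thesis
      by (simp add: is_interval_connected_1 connected_continuous_image)
  qed
  then have Sm: "S ` {p<..<q} \<in> sets lebesgue"
    using real_interval_borel_measurable by auto
  have cS: "c absolutely_integrable_on S ` {p<..<q}"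
    using set_integrable_subset[OF c(2) Sm] by auto
  have wS: "w absolutely_integrable_on {p<..<q} \<and> integral {p<..<q} w = integral (S ` {p<..<q}) c"
    unfolding w_def
    by (subst has_absolute_integral_change_of_variables_1')
       (use dS smS cS in \<open>auto intro: has_field_derivative_at_within strict_mono_on_imp_inj_on\<close>)
  have int_w: "w integrable_on {p<..<q}"
    using wS set_lebesgue_integral_eq_integral(1) by blast
  have w_le: "integral {p<..<q} w \<le> integral UNIV c"
    using wS c(1) set_lebesgue_integral_eq_integral(1)[OF c(2)] set_lebesgue_integral_eq_integral(1)[OF cS]
    by (auto intro!: integral_subset_le)
  have "\<alpha> * (\<beta> / \<alpha>) powr t = integral {p<..<q} (\<lambda>s. a s * (\<beta> / \<alpha>) powr t)"
    using int_a by simp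
  also have "\<dots> \<le> integral {p<..<q} w"
    by (intro integral_le integrable_on_mult_left int_a int_w) (use le_m m_le in fastforce)
  finally have "\<alpha> * (\<beta> / \<alpha>) powr t \<le> integral UNIV c" using w_le by simp
  moreover have "\<alpha> * (\<beta> / \<alpha>) powr t = \<alpha> powr (1 - t) * \<beta> powr t"
    using \<alpha> \<beta> by (simp add: powr_divide powr_diff)
  ultimately show ?inequality by simp
  assume eq: "\<alpha> = \<beta>" "integral UNIV c \<le> \<alpha>"
  have am: "a s \<le> m s" if "s \<in> {p<..<q}" for s using le_m[OF that] eq(1) \<beta> by simp
  have cont_m: "continuous_on {p<..<q} m"
  proof -
    have "continuous_on {p<..<q} T"
      using dT by (intro continuous_at_imp_continuous_on ballI DERIV_isCont) auto
    then have "continuous_on {p<..<q} (\<lambda>s. b (T s))"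
      by (rule continuous_on_compose2[OF pq'(2)]) (use Tin in auto)
    moreover have "a s \<noteq> 0" "b (T s) \<noteq> 0" if "s \<in> {p<..<q}" for s
      using pq(3)[OF that] pq'(3)[OF Tin[OF that]] by auto
    ultimately show ?thesis
      unfolding m_def \<rho>_def using \<alpha> \<beta> by (intro continuous_intros pq(2)) auto
  qed
  have \<rho>1: "\<rho> s = 1" if s: "s \<in> {p<..<q}" for s
  proof (rule ccontr)
    assume "\<rho> s \<noteq> 1"
    define u v where "u = (p + s) / 2" and "v = (s + q) / 2"
    have uv: "u < v" "s \<in> {u..v}" "{u..v} \<subseteq> {p<..<q}" using s by (auto simp: u_def v_def)
    have cont: "continuous_on {u..v} (\<lambda>s. m s - a s)"
      using cont_m pq(2) uv(3) by (intro continuous_intros) (auto intro: continuous_on_subset)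
    have iwa: "(\<lambda>s. w s - a s) integrable_on {p<..<q}" using int_w int_a by (intro integrable_diff)
    have iwa': "(\<lambda>s. w s - a s) integrable_on {u..v}"
      using integrable_on_subinterval[of _ "{p<..<q}" u v] iwa uv(3) by auto
    have "integral {u..v} (\<lambda>s. m s - a s) \<le> integral {u..v} (\<lambda>s. w s - a s)"
      using m_le uv(3) by (intro integral_le integrable_continuous_real cont iwa') auto
    also have "\<dots> \<le> integral {p<..<q} (\<lambda>s. w s - a s)"
      by (intro integral_subset_le iwa iwa' uv) (use am m_le in fastforce)
    also have "\<dots> \<le> 0" using int_w int_a w_le eq by (simp add: integral_diff)
    finally have "integral {u..v} (\<lambda>s. m s - a s) = 0"
      using am uv(3) integral_nonneg[OF integrable_continuous_real[OF cont]] by force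
    then have "m s - a s = 0"
      using integral_eq_0_iff[OF cont uv(1)] am uv by force
    moreover have "a s < m s"
    proof -
      have "a s = a s powr (1 - t) * b (T s) powr t * \<rho> s powr t"
        unfolding key[OF s] using eq \<beta> by simp
      also have "\<dots> < m s"
        unfolding m_def using weighted_am_gm(2)[OF \<rho>[OF s] t \<open>\<rho> s \<noteq> 1\<close>] pq(3)[OF s] pq'(3)[OF Tin[OF s]]
        by (intro mult_strict_left_mono) auto
      finally show ?thesis .
    qed
    ultimately show False by simp
  qed
  define d where "d = T ((p + q) / 2) - (p + q) / 2"
  have Td: "T s = s + d" if s: "s \<in> {p<..<q}" for s
  proof -
    have "(\<lambda>s. T s - s) s = (\<lambda>s. T s - s) ((p + q) / 2)"
    proof (rule DERIV_isconst3[of p q _ _ "\<lambda>s. T s - s"])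
      show "((\<lambda>s. T s - s) has_real_derivative 0) (at x)" if "x \<in> {p<..<q}" for x
        using dT[OF that] \<rho>1[OF that] by (auto intro!: derivative_eq_intros simp: \<rho>_def)
    qed (use s pq(1) in auto)
    then show ?thesis by (simp add: d_def)
  qed
  have "{p'<..<q'} = (\<lambda>s. s + d) ` {p<..<q}"
    unfolding T(1)[symmetric] by (intro image_cong Td refl)
  also have "\<dots> = {p + d<..<q + d}"
    by (force intro: image_eqI[of _ _ "_ - d"])
  finally have "p' = p + d \<and> q' = q + d"
    using pq(1) pq'(1) by (metis cInf_greaterThanLessThan cSup_greaterThanLessThan add_less_cancel_right)
  moreover have "b (s + d) = a s" if s: "s \<in> {p<..<q}" for s
    using \<rho>1[OF s] Td[OF s] pq'(3)[OF Tin[OF s]] eq \<beta> by (simp add: \<rho>_def)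
  ultimately show ?equality by blast
qed

text \<open>The functions that occur as iterated line integrals of the indicator of a bounded open convex
  set. \<open>J\<close> collects the directions in which the support is bounded, that is, those that
  have not been integrated out.\<close>

definition log_concave_on :: "'a::euclidean_space set \<Rightarrow> ('a \<Rightarrow> real) \<Rightarrow> bool" where
  "log_concave_on J F \<longleftrightarrow> F \<in> borel_measurable borel \<and> (\<forall>x. 0 \<le> F x) \<and> (\<exists>B. \<forall>x. F x \<le> B) \<and>
    open {x. 0 < F x} \<and> (\<exists>R. \<forall>k\<in>J. \<forall>x. 0 < F x \<longrightarrow> \<bar>x \<bullet> k\<bar> \<le> R) \<and>
    (\<forall>t x y. 0 < t \<longrightarrow> t < 1 \<longrightarrow> 0 < F x \<longrightarrow> 0 < F y \<longrightarrow>
       F x powr (1 - t) * F y powr t \<le> F ((1 - t) *\<^sub>R x + t *\<^sub>R y))"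

lemma log_concave_onD:
  assumes "log_concave_on J F"
  shows "F \<in> borel_measurable borel" "0 \<le> F x" "\<exists>B. \<forall>x. F x \<le> B" "open {x. 0 < F x}"
    "\<exists>R. \<forall>k\<in>J. \<forall>x. 0 < F x \<longrightarrow> \<bar>x \<bullet> k\<bar> \<le> R"
  using assms by (simp_all add: log_concave_on_def)

definition line_integral :: "'a::euclidean_space \<Rightarrow> ('a \<Rightarrow> real) \<Rightarrow> 'a \<Rightarrow> real" where
  "line_integral k F x = (LINT s|lborel. F (x + s *\<^sub>R k))"

lemma bounded_open_interval:
  fixes S :: "real set"
  assumes "open S" "is_interval S" "bounded S" "S \<noteq> {}"
  obtains p q where "p < q" "S = {p<..<q}"
proof -
  have bdd: "bdd_above S" "bdd_below S" using assms(3) by (auto intro: bounded_imp_bdd_above bounded_imp_bdd_below)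
  have up: "\<exists>y\<in>S. y > x" and dn: "\<exists>y\<in>S. y < x" if x: "x \<in> S" for x
  proof -
    obtain e where e: "e > 0" "ball x e \<subseteq> S" using openE[OF assms(1) x] .
    have "x + e / 2 \<in> ball x e" "x - e / 2 \<in> ball x e" using e(1) by (auto simp: dist_real_def)
    then have "x + e / 2 \<in> S" "x - e / 2 \<in> S" using e(2) by auto
    then show "\<exists>y\<in>S. y > x" "\<exists>y\<in>S. y < x" using e(1) by (auto intro: bexI[of _ "x + e / 2"] bexI[of _ "x - e / 2"])
  qed
  have eq: "S = {Inf S<..<Sup S}"
  proof (intro equalityI subsetI)
    fix x assume x: "x \<in> S"
    obtain y z where "y \<in> S" "y > x" "z \<in> S" "z < x" using up[OF x] dn[OF x] by blast
    then show "x \<in> {Inf S<..<Sup S}"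
      using cSup_upper[OF _ bdd(1), of y] cInf_lower[OF _ bdd(2), of z] by auto
  next
    fix x assume x: "x \<in> {Inf S<..<Sup S}"
    obtain y where y: "y \<in> S" "x < y" using x assms(4) bdd by (auto simp: less_cSup_iff)
    obtain z where z: "z \<in> S" "z < x" using x assms(4) bdd by (auto simp: cInf_less_iff)
    show "x \<in> S" using mem_is_interval_1_I[OF assms(2) z(1) y(1)] y z by auto
  qed
  moreover have "Inf S < Sup S"
  proof -
    obtain x where "x \<in> S" using assms(4) by blast
    then show ?thesis using eq by (metis greaterThanLessThan_empty_iff empty_iff linorder_not_less)
  qed
  ultimately show ?thesis using that by blast
qed

lemma line_restriction:
  assumes F: "log_concave_on J F" and k: "k \<in> J" "k \<in> Basis"
  shows "integrable lborel (\<lambda>s. F (x + s *\<^sub>R k))"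
    and "line_integral k F x = integral UNIV (\<lambda>s. F (x + s *\<^sub>R k))"
    and "(\<lambda>s. F (x + s *\<^sub>R k)) absolutely_integrable_on UNIV"
proof -
  obtain B where B: "\<And>x. F x \<le> B" using log_concave_onD(3)[OF F] by blast
  obtain R where R: "\<And>x. 0 < F x \<Longrightarrow> \<bar>x \<bullet> k\<bar> \<le> R" using log_concave_onD(5)[OF F] k by blast
  have nn: "0 \<le> F x" for x using F by (simp add: log_concave_on_def)
  have meas: "F \<in> borel_measurable borel" using F by (simp add: log_concave_on_def)
  define I where "I = {- R - x \<bullet> k..R - x \<bullet> k}"
  have supp: "F (x + s *\<^sub>R k) = 0" if "s \<notin> I" for s
  proof (rule ccontr)
    assume "F (x + s *\<^sub>R k) \<noteq> 0"
    then have "\<bar>(x + s *\<^sub>R k) \<bullet> k\<bar> \<le> R" using nn R by (simp add: order_less_le)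
    then show False using that k by (auto simp: I_def inner_add_left)
  qed
  show int: "integrable lborel (\<lambda>s. F (x + s *\<^sub>R k))"
  proof (rule Bochner_Integration.integrable_bound[where f = "\<lambda>s. B * indicator I s"])
    show "integrable lborel (\<lambda>s. B * indicator I s)"
      by (intro integrable_mult_right integrable_real_indicator) (auto simp: I_def emeasure_lborel_Icc_eq)
    show "(\<lambda>s. F (x + s *\<^sub>R k)) \<in> borel_measurable lborel" using meas by measurable
    show "AE s in lborel. norm (F (x + s *\<^sub>R k)) \<le> norm (B * indicator I s)"
      using supp nn B order_trans[OF nn B] by (auto simp: indicator_def)
  qed
  then show "line_integral k F x = integral UNIV (\<lambda>s. F (x + s *\<^sub>R k))"
    by (simp add: line_integral_def integral_lborel)
  show "(\<lambda>s. F (x + s *\<^sub>R k)) absolutely_integrable_on UNIV"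
    using int by (simp add: set_integrable_def integrable_completion)
qed

lemma line_support:
  assumes F: "log_concave_on J F" and k: "k \<in> J" "k \<in> Basis" and s0: "F (x + s0 *\<^sub>R k) > 0"
  obtains p q where "p < q" "{s. F (x + s *\<^sub>R k) > 0} = {p<..<q}"
    "continuous_on {p<..<q} (\<lambda>s. F (x + s *\<^sub>R k))"
    "(\<lambda>s. F (x + s *\<^sub>R k)) integrable_on {p..q}"
    "line_integral k F x = integral {p..q} (\<lambda>s. F (x + s *\<^sub>R k))"
proof -
  let ?a = "\<lambda>s. F (x + s *\<^sub>R k)"
  let ?S = "{s. ?a s > 0}"
  obtain R where R: "\<And>x. 0 < F x \<Longrightarrow> \<bar>x \<bullet> k\<bar> \<le> R" using log_concave_onD(5)[OF F] k by blast
  have nn: "0 \<le> F x" for x using F by (simp add: log_concave_on_def)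
  have lc: "?a s powr (1 - t) * ?a s' powr t \<le> ?a ((1 - t) * s + t * s')"
    if "0 < t" "t < 1" "s \<in> ?S" "s' \<in> ?S" for s s' t
  proof -
    have "(1 - t) *\<^sub>R (x + s *\<^sub>R k) + t *\<^sub>R (x + s' *\<^sub>R k) = x + ((1 - t) * s + t * s') *\<^sub>R k"
      by (simp add: algebra_simps)
    then show ?thesis using F that unfolding log_concave_on_def by (metis mem_Collect_eq)
  qed
  have oS: "open ?S"
  proof -
    have eq: "?S = (\<lambda>s. x + s *\<^sub>R k) -` {y. 0 < F y}" by auto
    show ?thesis
      unfolding eq by (intro open_vimage log_concave_onD(4)[OF F] continuous_intros)
  qed
  have cS: "convex ?S"
  proof (subst convex_alt, intro ballI allI impI)
    fix s s' t assume s: "s \<in> ?S" "s' \<in> ?S" and t: "0 \<le> t \<and> t \<le> (1::real)"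
    show "(1 - t) *\<^sub>R s + t *\<^sub>R s' \<in> ?S"
    proof (cases "t = 0 \<or> t = 1")
      case False
      then have "0 < t" "t < 1" using t by auto
      with lc[OF this s] s show ?thesis by (auto intro: less_le_trans[rotated])
    qed (use s in auto)
  qed
  have bS: "bounded ?S"
  proof (rule boundedI[of _ "R + \<bar>x \<bullet> k\<bar>"])
    fix s assume "s \<in> ?S"
    then have "\<bar>(x + s *\<^sub>R k) \<bullet> k\<bar> \<le> R" using R by simp
    then show "norm s \<le> R + \<bar>x \<bullet> k\<bar>" using k by (simp add: inner_add_left)
  qed
  obtain p q where pq: "p < q" "?S = {p<..<q}"
    using bounded_open_interval[OF oS _ bS] cS s0 by (auto simp: is_interval_convex_1)
  have "convex_on ?S (\<lambda>s. - ln (?a s))"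
  proof (rule convex_onI)
    fix t s s' :: real assume t: "0 < t" "t < 1" and s: "s \<in> ?S" "s' \<in> ?S"
    have pos: "?a s powr (1 - t) * ?a s' powr t > 0" using s by simp
    have "(1 - t) * ln (?a s) + t * ln (?a s') = ln (?a s powr (1 - t) * ?a s' powr t)"
      using s by (simp add: ln_mult ln_powr)
    also have "\<dots> \<le> ln (?a ((1 - t) * s + t * s'))"
      using lc[OF t s] pos by (subst ln_le_cancel_iff) auto
    finally show "- ln (?a ((1 - t) *\<^sub>R s + t *\<^sub>R s')) \<le> (1 - t) * - ln (?a s) + t * - ln (?a s')"
      by simp
  qed (rule cS)
  then have "continuous_on ?S (\<lambda>s. exp (- (- ln (?a s))))"
    by (intro continuous_intros convex_on_continuous oS)
  then have cont: "continuous_on ?S ?a"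
    by (rule continuous_on_eq) auto
  have supp: "?a s = 0" if "s \<notin> {p..q}" for s
  proof -
    have "s \<notin> ?S" using that unfolding pq(2) by auto
    then show ?thesis using nn[of "x + s *\<^sub>R k"] by simp
  qed
  have eq: "(\<lambda>s. if s \<in> {p..q} then ?a s else 0) = ?a" using supp by auto
  have int: "?a integrable_on UNIV"
    using set_lebesgue_integral_eq_integral(1)[OF line_restriction(3)[OF F k]] .
  show ?thesis
  proof (rule that[OF pq])
    show "continuous_on {p<..<q} ?a" using cont pq(2) by simp
    show "?a integrable_on {p..q}"
      using int eq integrable_restrict_UNIV[of "{p..q}" ?a] by simp
    show "line_integral k F x = integral {p..q} ?a"
      unfolding line_restriction(2)[OF F k] using integral_restrict_UNIV[of "{p..q}" ?a] eq by simp
  qed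
qed

lemma line_integral_pos_iff:
  assumes F: "log_concave_on J F" and k: "k \<in> J" "k \<in> Basis"
  shows "line_integral k F x > 0 \<longleftrightarrow> (\<exists>s. F (x + s *\<^sub>R k) > 0)"
proof
  assume pos: "line_integral k F x > 0"
  show "\<exists>s. F (x + s *\<^sub>R k) > 0"
  proof (rule ccontr)
    assume "\<not> ?thesis"
    then have "F (x + s *\<^sub>R k) = 0" for s
      using log_concave_onD(2)[OF F, of "x + s *\<^sub>R k"] by (auto simp: not_less intro: antisym)
    with pos show False by (simp add: line_integral_def)
  qed
next
  assume "\<exists>s. F (x + s *\<^sub>R k) > 0"
  then obtain s0 where s0: "F (x + s0 *\<^sub>R k) > 0" by blast
  obtain p q where pq: "p < q" "{s. F (x + s *\<^sub>R k) > 0} = {p<..<q}"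
    "continuous_on {p<..<q} (\<lambda>s. F (x + s *\<^sub>R k))" "(\<lambda>s. F (x + s *\<^sub>R k)) integrable_on {p..q}"
    "line_integral k F x = integral {p..q} (\<lambda>s. F (x + s *\<^sub>R k))"
    using line_support[OF F k s0] .
  show "line_integral k F x > 0"
    unfolding pq(5) using cdf_properties(5)[OF pq(1,3) _ pq(4)] pq(2) by blast
qed

lemma prekopa_line:
  assumes F: "log_concave_on J F" and G: "log_concave_on J G" and H: "log_concave_on J H"
    and k: "k \<in> J" "k \<in> Basis" and t: "0 < t" "t < 1"
    and FGH: "\<And>x y. 0 < F x \<Longrightarrow> 0 < G y \<Longrightarrow> F x powr (1 - t) * G y powr t \<le> H ((1 - t) *\<^sub>R x + t *\<^sub>R y)"
    and x: "0 < line_integral k F x" and y: "0 < line_integral k G y"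
  shows "line_integral k F x powr (1 - t) * line_integral k G y powr t
      \<le> line_integral k H ((1 - t) *\<^sub>R x + t *\<^sub>R y)"
    and "line_integral k F x = line_integral k G y \<Longrightarrow>
      line_integral k H ((1 - t) *\<^sub>R x + t *\<^sub>R y) \<le> line_integral k F x \<Longrightarrow>
      \<exists>d. \<forall>s. G (y + (s + d) *\<^sub>R k) = F (x + s *\<^sub>R k)"
proof -
  obtain s0 where s0: "F (x + s0 *\<^sub>R k) > 0" using x line_integral_pos_iff[OF F k] by blast
  obtain s1 where s1: "G (y + s1 *\<^sub>R k) > 0" using y line_integral_pos_iff[OF G k] by blast
  obtain p q where pq: "p < q" "{s. F (x + s *\<^sub>R k) > 0} = {p<..<q}"
    "continuous_on {p<..<q} (\<lambda>s. F (x + s *\<^sub>R k))" "(\<lambda>s. F (x + s *\<^sub>R k)) integrable_on {p..q}"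
    "line_integral k F x = integral {p..q} (\<lambda>s. F (x + s *\<^sub>R k))"
    using line_support[OF F k s0] .
  obtain p' q' where pq': "p' < q'" "{s. G (y + s *\<^sub>R k) > 0} = {p'<..<q'}"
    "continuous_on {p'<..<q'} (\<lambda>s. G (y + s *\<^sub>R k))" "(\<lambda>s. G (y + s *\<^sub>R k)) integrable_on {p'..q'}"
    "line_integral k G y = integral {p'..q'} (\<lambda>s. G (y + s *\<^sub>R k))"
    using line_support[OF G k s1] .
  let ?z = "(1 - t) *\<^sub>R x + t *\<^sub>R y"
  have posF: "F (x + s *\<^sub>R k) > 0" if "s \<in> {p<..<q}" for s using pq(2) that by blast
  have posG: "G (y + s *\<^sub>R k) > 0" if "s \<in> {p'<..<q'}" for s using pq'(2) that by blast
  have H0: "H (?z + s *\<^sub>R k) \<ge> 0" for s using H by (simp add: log_concave_on_def)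
  have cond: "F (x + s *\<^sub>R k) powr (1 - t) * G (y + s' *\<^sub>R k) powr t \<le> H (?z + ((1 - t) * s + t * s') *\<^sub>R k)"
    if "s \<in> {p<..<q}" "s' \<in> {p'<..<q'}" for s s'
  proof -
    have "(1 - t) *\<^sub>R (x + s *\<^sub>R k) + t *\<^sub>R (y + s' *\<^sub>R k) = ?z + ((1 - t) * s + t * s') *\<^sub>R k"
      by (simp add: algebra_simps)
    then show ?thesis using FGH[OF posF[OF that(1)] posG[OF that(2)]] by simp
  qed
  note P = prekopa_1d[OF t pq(1,3) posF pq(4) pq'(1,3) posG pq'(4) H0 line_restriction(3)[OF H k] cond,
      folded pq(5) pq'(5) line_restriction(2)[OF H k]]
  show "line_integral k F x powr (1 - t) * line_integral k G y powr t \<le> line_integral k H ?z"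
    by (rule P(1))
  assume "line_integral k F x = line_integral k G y" "line_integral k H ?z \<le> line_integral k F x"
  from P(2)[OF _ _ _ _ this] obtain d where d: "p' = p + d" "q' = q + d"
    "\<And>s. s \<in> {p<..<q} \<Longrightarrow> G (y + (s + d) *\<^sub>R k) = F (x + s *\<^sub>R k)"
    by blast
  have "G (y + (s + d) *\<^sub>R k) = F (x + s *\<^sub>R k)" for s
  proof (cases "s \<in> {p<..<q}")
    case False
    then have "s \<notin> {s. F (x + s *\<^sub>R k) > 0}" "s + d \<notin> {s. G (y + s *\<^sub>R k) > 0}"
      unfolding pq(2) pq'(2) using d by auto
    then show ?thesis
      using log_concave_onD(2)[OF F, of "x + s *\<^sub>R k"] log_concave_onD(2)[OF G, of "y + (s + d) *\<^sub>R k"] by auto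
  qed (use d in auto)
  then show "\<exists>d. \<forall>s. G (y + (s + d) *\<^sub>R k) = F (x + s *\<^sub>R k)" by blast
qed

lemma log_concave_on_line_integral:
  assumes F: "log_concave_on J F" and k: "k \<in> J" and J: "J \<subseteq> Basis"
  shows "log_concave_on (J - {k}) (line_integral k F)"
proof -
  have kB: "k \<in> Basis" using k J by auto
  obtain B where B: "\<And>x. F x \<le> B" using log_concave_onD(3)[OF F] by blast
  obtain R where R: "\<And>x k. k \<in> J \<Longrightarrow> 0 < F x \<Longrightarrow> \<bar>x \<bullet> k\<bar> \<le> R"
    using log_concave_onD(5)[OF F] by blast
  have nn: "0 \<le> F x" for x using F by (simp add: log_concave_on_def)
  have [measurable]: "F \<in> borel_measurable borel" using F by (simp add: log_concave_on_def)
  note pos = line_integral_pos_iff[OF F k kB]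
  show ?thesis
    unfolding log_concave_on_def
  proof (intro conjI allI impI)
    show "line_integral k F \<in> borel_measurable borel"
      unfolding line_integral_def[abs_def]
      by (rule lborel.borel_measurable_lebesgue_integral) measurable
    show "0 \<le> line_integral k F x" for x
      unfolding line_integral_def by (intro integral_nonneg_AE AE_I2 nn)
    show "\<exists>B. \<forall>x. line_integral k F x \<le> B"
    proof (intro exI allI)
      fix x
      define I where "I = {- R - x \<bullet> k..R - x \<bullet> k}"
      have "F (x + s *\<^sub>R k) \<le> B * indicator I s" for s
      proof (cases "F (x + s *\<^sub>R k) > 0")
        case True
        then have "\<bar>(x + s *\<^sub>R k) \<bullet> k\<bar> \<le> R" using R k by blast
        then have "s \<in> I" using kB by (auto simp: I_def inner_add_left)
        then show ?thesis using B by simp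
      next
        case False
        then show ?thesis using order_trans[OF nn B] by (simp add: indicator_def)
      qed
      then have "line_integral k F x \<le> (LINT s|lborel. B * indicator I s)"
        unfolding line_integral_def using line_restriction(1)[OF F k kB]
        by (intro integral_mono integrable_mult_right integrable_real_indicator) (auto simp: I_def emeasure_lborel_Icc_eq)
      also have "\<dots> \<le> B * (2 * \<bar>R\<bar>)"
        using order_trans[OF nn B] by (auto simp: I_def intro!: mult_left_mono mult_nonneg_nonpos)
      finally show "line_integral k F x \<le> B * (2 * \<bar>R\<bar>)" .
    qed
    have eq: "{x. 0 < line_integral k F x} = (\<Union>s. (\<lambda>x. x + s *\<^sub>R k) -` {y. 0 < F y})"
      using pos by auto
    show "open {x. 0 < line_integral k F x}"
      unfolding eq by (intro open_UN ballI open_vimage log_concave_onD(4)[OF F] continuous_intros)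
    show "\<exists>R. \<forall>k'\<in>J - {k}. \<forall>x. 0 < line_integral k F x \<longrightarrow> \<bar>x \<bullet> k'\<bar> \<le> R"
    proof (intro exI[of _ R] ballI allI impI)
      fix k' x assume k': "k' \<in> J - {k}" and "0 < line_integral k F x"
      then obtain s where s: "F (x + s *\<^sub>R k) > 0" using pos by auto
      have "k \<bullet> k' = 0" using k' J kB by (intro inner_not_same_Basis) auto
      then show "\<bar>x \<bullet> k'\<bar> \<le> R" using R[OF _ s, of k'] k' by (simp add: inner_add_left)
    qed
    fix t :: real and x y assume "0 < t" "t < 1" "0 < line_integral k F x" "0 < line_integral k F y"
    then show "line_integral k F x powr (1 - t) * line_integral k F y powr t
        \<le> line_integral k F ((1 - t) *\<^sub>R x + t *\<^sub>R y)"
      using F by (intro prekopa_line(1)[OF F F F k kB]) (auto simp: log_concave_on_def)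
  qed
qed

fun iterated_integral :: "'a::euclidean_space list \<Rightarrow> ('a \<Rightarrow> real) \<Rightarrow> 'a \<Rightarrow> real" where
  "iterated_integral [] F = F"
| "iterated_integral (k # ks) F = line_integral k (iterated_integral ks F)"

lemma log_concave_on_iterated_integral:
  assumes "log_concave_on J F" "J \<subseteq> Basis" "set ks \<subseteq> J" "distinct ks"
  shows "log_concave_on (J - set ks) (iterated_integral ks F)"
  using assms(3,4)
proof (induction ks)
  case (Cons k ks)
  then have "log_concave_on (J - set ks) (iterated_integral ks F)" by simp
  then have "log_concave_on (J - set ks - {k}) (line_integral k (iterated_integral ks F))"
    by (rule log_concave_on_line_integral) (use Cons.prems assms(2) in auto)
  moreover have "J - set (k # ks) = J - set ks - {k}" by auto
  ultimately show ?case by (simp only: iterated_integral.simps)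
qed (use assms(1) in simp)

lemma prekopa_iterated_integral:
  assumes F: "log_concave_on J F" and G: "log_concave_on J G" and H: "log_concave_on J H"
    and J: "J \<subseteq> Basis" and t: "0 < t" "t < 1"
    and FGH: "\<And>x y. 0 < F x \<Longrightarrow> 0 < G y \<Longrightarrow> F x powr (1 - t) * G y powr t \<le> H ((1 - t) *\<^sub>R x + t *\<^sub>R y)"
    and ks: "set ks \<subseteq> J" "distinct ks"
    and pos: "0 < iterated_integral ks F x" "0 < iterated_integral ks G y"
  shows "iterated_integral ks F x powr (1 - t) * iterated_integral ks G y powr t
     \<le> iterated_integral ks H ((1 - t) *\<^sub>R x + t *\<^sub>R y)"
  using ks pos
proof (induction ks arbitrary: x y)
  case (Cons k ks)
  have lc: "log_concave_on (J - set ks) (iterated_integral ks f)" if "log_concave_on J f" for f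
    using Cons.prems by (intro log_concave_on_iterated_integral that J) auto
  show ?case
    unfolding iterated_integral.simps
    by (rule prekopa_line(1)[OF lc[OF F] lc[OF G] lc[OF H] _ _ t Cons.IH]) (use Cons.prems J in auto)
qed (use FGH in auto)

lemma iterated_integral_pos_iff:
  assumes F: "log_concave_on J F" and J: "J \<subseteq> Basis" and ks: "set ks \<subseteq> J" "distinct ks"
  shows "0 < iterated_integral ks F x \<longleftrightarrow> (\<exists>y. 0 < F y \<and> (\<forall>k\<in>Basis - set ks. y \<bullet> k = x \<bullet> k))"
  using ks
proof (induction ks arbitrary: x)
  case Nil
  have "(\<forall>k\<in>Basis. y \<bullet> k = x \<bullet> k) \<longleftrightarrow> y = x" for y
    using euclidean_eq_iff[of y x] by simp
  then show ?case by simp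
next
  case (Cons k ks)
  have k: "k \<in> Basis" using Cons.prems J by auto
  have "0 < iterated_integral (k # ks) F x \<longleftrightarrow> (\<exists>s. 0 < iterated_integral ks F (x + s *\<^sub>R k))"
    unfolding iterated_integral.simps
    by (rule line_integral_pos_iff[OF log_concave_on_iterated_integral[OF F J]]) (use Cons.prems J in auto)
  also have "\<dots> \<longleftrightarrow> (\<exists>s y. 0 < F y \<and> (\<forall>k'\<in>Basis - set ks. y \<bullet> k' = (x + s *\<^sub>R k) \<bullet> k'))"
    using Cons by simp
  also have "\<dots> \<longleftrightarrow> (\<exists>y. 0 < F y \<and> (\<forall>k'\<in>Basis - set (k # ks). y \<bullet> k' = x \<bullet> k'))"
  proof safe
    fix s y assume y: "0 < F y" "\<forall>k'\<in>Basis - set ks. y \<bullet> k' = (x + s *\<^sub>R k) \<bullet> k'"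
    have "y \<bullet> k' = x \<bullet> k'" if "k' \<in> Basis - set (k # ks)" for k'
      using that y(2) inner_not_same_Basis[OF k, of k'] by (auto simp: inner_add_left)
    with y(1) show "\<exists>y. 0 < F y \<and> (\<forall>k'\<in>Basis - set (k # ks). y \<bullet> k' = x \<bullet> k')" by blast
  next
    fix y assume y: "0 < F y" "\<forall>k'\<in>Basis - set (k # ks). y \<bullet> k' = x \<bullet> k'"
    have "y \<bullet> k' = (x + (y \<bullet> k - x \<bullet> k) *\<^sub>R k) \<bullet> k'" if "k' \<in> Basis - set ks" for k'
      using that y(2) k by (cases "k' = k") (auto simp: inner_add_left inner_not_same_Basis)
    with y(1) show "\<exists>s y. 0 < F y \<and> (\<forall>k'\<in>Basis - set ks. y \<bullet> k' = (x + s *\<^sub>R k) \<bullet> k')" by blast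
  qed
  finally show ?case .
qed

lemma log_concave_on_indicator:
  fixes A :: "'a::euclidean_space set"
  assumes "open A" "convex A" "bounded A"
  shows "log_concave_on Basis (indicator A)"
  unfolding log_concave_on_def
proof (intro conjI allI impI)
  show "indicator A \<in> borel_measurable borel" using assms(1) by simp
  show "\<exists>B. \<forall>x. indicat_real A x \<le> B" by (auto intro!: exI[of _ 1] simp: indicator_def)
  have "{x. 0 < indicat_real A x} = A" by (auto simp: indicator_def)
  then show "open {x. 0 < indicat_real A x}" using assms(1) by simp
  obtain R where R: "\<And>x. x \<in> A \<Longrightarrow> norm x \<le> R" using assms(3) by (auto simp: bounded_iff)
  show "\<exists>R. \<forall>k\<in>Basis. \<forall>x. 0 < indicat_real A x \<longrightarrow> \<bar>x \<bullet> k\<bar> \<le> R"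
  proof (intro exI ballI allI impI)
    fix k x :: 'a assume "k \<in> Basis" "0 < indicat_real A x"
    then have "x \<in> A" "\<bar>x \<bullet> k\<bar> \<le> norm x" by (auto simp: indicator_def Basis_le_norm split: if_splits)
    then show "\<bar>x \<bullet> k\<bar> \<le> R" using R order_trans by blast
  qed
  fix t :: real and x y assume "0 < t" "t < 1" "0 < indicat_real A x" "0 < indicat_real A y"
  then show "indicat_real A x powr (1 - t) * indicat_real A y powr t \<le> indicator A ((1 - t) *\<^sub>R x + t *\<^sub>R y)"
    using assms(2) by (auto simp: indicator_def convex_alt split: if_splits)
qed simp

fun iterated_nn_integral :: "'a::euclidean_space list \<Rightarrow> ('a \<Rightarrow> ennreal) \<Rightarrow> 'a \<Rightarrow> ennreal" where
  "iterated_nn_integral [] f x = f x"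
| "iterated_nn_integral (k # ks) f x = (\<integral>\<^sup>+ s. iterated_nn_integral ks f (x + s *\<^sub>R k) \<partial>lborel)"

lemma borel_measurable_iterated_nn_integral:
  assumes [measurable]: "f \<in> borel_measurable borel"
  shows "iterated_nn_integral ks f \<in> borel_measurable borel"
proof (induction ks)
  case (Cons k ks)
  note [measurable] = Cons
  show ?case
    unfolding iterated_nn_integral.simps[abs_def]
    by (rule lborel.borel_measurable_nn_integral) measurable
qed simp

lemma iterated_nn_integral_PiM:
  fixes f :: "'a::euclidean_space \<Rightarrow> ennreal"
  assumes f[measurable]: "f \<in> borel_measurable borel" and "distinct ks"
  shows "iterated_nn_integral ks f x = (\<integral>\<^sup>+ g. f (x + (\<Sum>b\<in>set ks. g b *\<^sub>R b)) \<partial>(\<Pi>\<^sub>M b\<in>set ks. lborel))"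
  using assms(2)
proof (induction ks arbitrary: x)
  interpret product_sigma_finite "\<lambda>_::'a. lborel :: real measure"
    by standard
  case Nil
  then show ?case by (simp add: PiM_empty nn_integral_count_space_finite)
next
  interpret product_sigma_finite "\<lambda>_::'a. lborel :: real measure"
    by standard
  case (Cons k ks)
  have sum: "(\<Sum>b\<in>insert k (set ks). (g(k := s)) b *\<^sub>R b) = s *\<^sub>R k + (\<Sum>b\<in>set ks. g b *\<^sub>R b)" for g :: "'a \<Rightarrow> real" and s
    using Cons.prems by (auto intro!: sum.cong)
  have "(\<integral>\<^sup>+ g. f (x + (\<Sum>b\<in>set (k # ks). g b *\<^sub>R b)) \<partial>(\<Pi>\<^sub>M b\<in>set (k # ks). lborel))
     = (\<integral>\<^sup>+ s. (\<integral>\<^sup>+ g. f (x + (\<Sum>b\<in>insert k (set ks). (g(k := s)) b *\<^sub>R b)) \<partial>(\<Pi>\<^sub>M b\<in>set ks. lborel)) \<partial>lborel)"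
    using Cons.prems by (simp add: product_nn_integral_insert_rev)
  also have "\<dots> = (\<integral>\<^sup>+ s. iterated_nn_integral ks f (x + s *\<^sub>R k) \<partial>lborel)"
    unfolding sum using Cons by (simp add: add.assoc)
  finally show ?case by simp
qed

lemma nn_integral_lborel_iterated:
  fixes f :: "'a::euclidean_space \<Rightarrow> ennreal"
  assumes [measurable]: "f \<in> borel_measurable borel" and "distinct ks" "set ks = Basis"
  shows "(\<integral>\<^sup>+ x. f x \<partial>lborel) = iterated_nn_integral ks f 0"
  by (subst lborel_eq) (simp add: iterated_nn_integral_PiM assms nn_integral_distr)

lemma iterated_nn_integral_ennreal:
  assumes F: "log_concave_on J F" and J: "J \<subseteq> Basis" and ks: "set ks \<subseteq> J" "distinct ks"
  shows "iterated_nn_integral ks (\<lambda>x. ennreal (F x)) x = ennreal (iterated_integral ks F x)"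
  using ks
proof (induction ks arbitrary: x)
  case (Cons k ks)
  have lc: "log_concave_on (J - set ks) (iterated_integral ks F)"
    using Cons.prems by (intro log_concave_on_iterated_integral F J) auto
  show ?case
    using Cons J line_restriction(1)[OF lc, of k x] log_concave_onD(2)[OF lc]
    by (simp add: line_integral_def nn_integral_eq_integral subset_iff)
qed simp

lemma iterated_nn_integral_cmult:
  assumes [measurable]: "f \<in> borel_measurable borel"
    and w: "\<And>k x s. k \<in> set ks \<Longrightarrow> w (x + s *\<^sub>R k) = w x"
  shows "iterated_nn_integral ks (\<lambda>x. w x * f x) x = w x * iterated_nn_integral ks f x"
  using w
proof (induction ks arbitrary: x)
  case (Cons k ks)
  note [measurable] = borel_measurable_iterated_nn_integral[OF assms(1), of ks]
  have "iterated_nn_integral (k # ks) (\<lambda>x. w x * f x) x = (\<integral>\<^sup>+ s. w x * iterated_nn_integral ks f (x + s *\<^sub>R k) \<partial>lborel)"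
    using Cons by simp
  also have "\<dots> = w x * iterated_nn_integral (k # ks) f x"
    by (simp add: nn_integral_cmult)
  finally show ?case .
qed simp

lemma measure_eq_iterated_integral:
  fixes A :: "'a::euclidean_space set"
  assumes A: "open A" "convex A" "bounded A" and ks: "distinct ks" "set ks = Basis"
  shows "measure lborel A = iterated_integral ks (indicator A) 0"
proof -
  note lc = log_concave_on_indicator[OF A]
  have "emeasure lborel A = (\<integral>\<^sup>+ x. ennreal (indicator A x) \<partial>lborel)"
    using A(1) by (simp add: ennreal_indicator)
  also have "\<dots> = ennreal (iterated_integral ks (indicator A) 0)"
    using A(1) ks by (subst nn_integral_lborel_iterated[of _ ks]) (auto intro!: iterated_nn_integral_ennreal[OF lc])
  finally show ?thesis
    using log_concave_onD(2)[OF log_concave_on_iterated_integral[OF lc]] ks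
    by (simp add: measure_def)
qed

lemma brunn_minkowski_open:
  fixes A B C :: "'a::euclidean_space set"
  assumes A: "open A" "convex A" "bounded A" "A \<noteq> {}"
    and B: "open B" "convex B" "bounded B" "B \<noteq> {}"
    and C: "open C" "convex C" "bounded C"
    and t: "0 < t" "t < 1" and ABC: "\<And>x y. x \<in> A \<Longrightarrow> y \<in> B \<Longrightarrow> (1 - t) *\<^sub>R x + t *\<^sub>R y \<in> C"
  shows "measure lborel A powr (1 - t) * measure lborel B powr t \<le> measure lborel C"
proof -
  obtain ks :: "'a list" where ks: "distinct ks" "set ks = Basis"
    using finite_distinct_list[OF finite_Basis] by blast
  have pos: "0 < iterated_integral ks (indicator X) (0::'a)" if "open X" "convex X" "bounded X" "X \<noteq> {}" for X
    using that ks by (subst iterated_integral_pos_iff[OF log_concave_on_indicator]) (auto simp: indicator_def)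
  have "iterated_integral ks (indicator A) 0 powr (1 - t) * iterated_integral ks (indicator B) 0 powr t
     \<le> iterated_integral ks (indicator C) ((1 - t) *\<^sub>R (0::'a) + t *\<^sub>R 0)"
    by (rule prekopa_iterated_integral[OF log_concave_on_indicator[OF A(1-3)]
          log_concave_on_indicator[OF B(1-3)] log_concave_on_indicator[OF C] order_refl t])
       (use ks ABC pos[OF A] pos[OF B] in \<open>auto simp: indicator_def split: if_splits\<close>)
  then show ?thesis
    using A B C ks by (simp add: measure_eq_iterated_integral)
qed

lemma nn_moment_eq_iterated:
  fixes A :: "'a::euclidean_space set"
  assumes A: "open A" "convex A" "bounded A" and k: "k \<in> Basis" and ks: "distinct ks" "set ks = Basis - {k}"
  shows "(\<integral>\<^sup>+ x. ennreal (x \<bullet> k + R) * indicator A x \<partial>lborel)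
    = (\<integral>\<^sup>+ s. ennreal (s + R) * ennreal (iterated_integral ks (indicator A) (s *\<^sub>R k)) \<partial>lborel)"
proof -
  note lc = log_concave_on_indicator[OF A]
  have [measurable]: "A \<in> sets borel" using A(1) by simp
  have "(\<integral>\<^sup>+ x. ennreal (x \<bullet> k + R) * indicator A x \<partial>lborel)
    = iterated_nn_integral (k # ks) (\<lambda>x. ennreal (x \<bullet> k + R) * indicator A x) 0"
    using k ks by (intro nn_integral_lborel_iterated) auto
  also have "\<dots> = (\<integral>\<^sup>+ s. ennreal (s + R) * iterated_nn_integral ks (indicator A) (s *\<^sub>R k) \<partial>lborel)"
    using k ks
    by (simp, subst iterated_nn_integral_cmult) (auto simp: inner_add_left inner_not_same_Basis)
  also have "\<dots> = (\<integral>\<^sup>+ s. ennreal (s + R) * ennreal (iterated_integral ks (indicator A) (s *\<^sub>R k)) \<partial>lborel)"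
    using iterated_nn_integral_ennreal[OF lc, of ks] ks by (simp add: ennreal_indicator)
  finally show ?thesis .
qed

text \<open>In the equality case the marginals in each coordinate direction are translates of each other.\<close>

lemma brunn_minkowski_open_equality:
  fixes A B C :: "'a::euclidean_space set"
  assumes A: "open A" "convex A" "bounded A" "A \<noteq> {}"
    and B: "open B" "convex B" "bounded B" "B \<noteq> {}"
    and C: "open C" "convex C" "bounded C"
    and t: "0 < t" "t < 1" and ABC: "\<And>x y. x \<in> A \<Longrightarrow> y \<in> B \<Longrightarrow> (1 - t) *\<^sub>R x + t *\<^sub>R y \<in> C"
    and eq: "measure lborel A = measure lborel B" "measure lborel C \<le> measure lborel A"
    and k: "k \<in> Basis"
  shows "\<exists>d. (\<lambda>x. x \<bullet> k) ` B = (\<lambda>x. x \<bullet> k + d) ` A \<and>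
    (LINT x|lborel. indicator B x * (x \<bullet> k)) = (LINT x|lborel. indicator A x * (x \<bullet> k)) + d * measure lborel A"
proof -
  obtain ks :: "'a list" where ks: "distinct ks" "set ks = Basis - {k}"
    using finite_distinct_list[of "Basis - {k}"] by auto
  have kks: "distinct (k # ks)" "set (k # ks) = Basis" using ks k by auto
  note lA = log_concave_on_indicator[OF A(1-3)] and lB = log_concave_on_indicator[OF B(1-3)]
    and lC = log_concave_on_indicator[OF C]
  have J: "Basis - set ks = {k}" using ks k by auto
  have lc: "log_concave_on {k} (iterated_integral ks f)" if "log_concave_on Basis f" for f :: "'a \<Rightarrow> real"
    using log_concave_on_iterated_integral[OF that, of ks] ks J by auto
  have pos: "0 < iterated_integral ks (indicator X) (s *\<^sub>R k) \<longleftrightarrow> s \<in> (\<lambda>x. x \<bullet> k) ` X"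
    if "log_concave_on Basis (indicat_real X)" for X s
    using iterated_integral_pos_iff[OF that order_refl, of ks "s *\<^sub>R k"] ks J k by (auto simp: indicator_def)
  have m: "measure lborel X = line_integral k (iterated_integral ks (indicator X)) 0"
    if "open X" "convex X" "bounded X" for X
    using measure_eq_iterated_integral[OF that kks] by simp
  have mpos: "measure lborel X > 0" if X: "open X" "convex X" "bounded X" "X \<noteq> {}" for X :: "'a set"
    unfolding m[OF X(1-3)] using X(4) pos[OF log_concave_on_indicator[OF X(1-3)]]
    by (subst line_integral_pos_iff[OF lc[OF log_concave_on_indicator[OF X(1-3)]]]) (use k in auto)
  have "\<exists>d. \<forall>s. iterated_integral ks (indicator B) (0 + (s + d) *\<^sub>R k) = iterated_integral ks (indicator A) (0 + s *\<^sub>R k)"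
  proof (rule prekopa_line(2)[OF lc[OF lA] lc[OF lB] lc[OF lC] _ k t])
    fix x y assume "0 < iterated_integral ks (indicat_real A) x" "0 < iterated_integral ks (indicat_real B) y"
    then show "iterated_integral ks (indicator A) x powr (1 - t) * iterated_integral ks (indicator B) y powr t
       \<le> iterated_integral ks (indicator C) ((1 - t) *\<^sub>R x + t *\<^sub>R y)"
      by (intro prekopa_iterated_integral[OF lA lB lC order_refl t])
         (use ks ABC in \<open>auto simp: indicator_def split: if_splits\<close>)
  qed (use eq mpos[OF A] mpos[OF B] in \<open>simp_all add: m[OF A(1-3)] m[OF B(1-3)] m[OF C]\<close>)
  then obtain d where d: "\<And>s. iterated_integral ks (indicator B) ((s + d) *\<^sub>R k) = iterated_integral ks (indicator A) (s *\<^sub>R k)"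
    by auto
  have img: "(\<lambda>x. x \<bullet> k) ` B = (\<lambda>x. x \<bullet> k + d) ` A"
  proof -
    have "s + d \<in> (\<lambda>x. x \<bullet> k) ` B \<longleftrightarrow> s \<in> (\<lambda>x. x \<bullet> k) ` A" for s
      using pos[OF lA, of s] pos[OF lB, of "s + d"] d by simp
    from this[of "_ - d"] have "s \<in> (\<lambda>x. x \<bullet> k) ` B \<longleftrightarrow> s - d \<in> (\<lambda>x. x \<bullet> k) ` A" for s by simp
    then show ?thesis by (auto simp: image_iff set_eq_iff algebra_simps)
  qed
  obtain RA where RA: "\<And>x. x \<in> A \<Longrightarrow> norm x \<le> RA" using A(3) by (auto simp: bounded_iff)
  obtain RB where RB: "\<And>x. x \<in> B \<Longrightarrow> norm x \<le> RB" using B(3) by (auto simp: bounded_iff)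
  define R where "R = \<bar>RA\<bar> + \<bar>RB\<bar> + \<bar>d\<bar>"
  have [measurable]: "A \<in> sets borel" "B \<in> sets borel" using A(1) B(1) by simp_all
  have int: "integrable lborel (\<lambda>x. indicator X x * (x \<bullet> k + r))" if X: "open X" "bounded X" for X r
  proof -
    obtain b where b: "\<And>x. x \<in> X \<Longrightarrow> norm x \<le> b" using X(2) by (auto simp: bounded_iff)
    have le: "\<bar>x \<bullet> k + r\<bar> \<le> \<bar>b\<bar> + \<bar>r\<bar>" if "x \<in> X" for x
      using b[OF that] Basis_le_norm[OF k, of x] by linarith
    show ?thesis
    proof (rule Bochner_Integration.integrable_bound)
      show "integrable lborel (\<lambda>x. (\<bar>b\<bar> + \<bar>r\<bar>) * indicator X x)"
        using X emeasure_bounded_finite by (intro integrable_mult_right integrable_real_indicator) auto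
      show "(\<lambda>x. indicator X x * (x \<bullet> k + r)) \<in> borel_measurable lborel" using X(1) by simp
      show "AE x in lborel. norm (indicator X x * (x \<bullet> k + r)) \<le> norm ((\<bar>b\<bar> + \<bar>r\<bar>) * indicator X x)"
        using le by (auto simp: indicator_def)
    qed
  qed
  have nn: "(\<integral>\<^sup>+ x. ennreal (x \<bullet> k + r) * indicator X x \<partial>lborel) = ennreal (LINT x|lborel. indicator X x * (x \<bullet> k + r))"
    if X: "open X" "bounded X" and "\<And>x. x \<in> X \<Longrightarrow> 0 \<le> x \<bullet> k + r" for X r
    using that by (subst nn_integral_eq_integral[OF int[OF X], symmetric])
      (auto intro!: nn_integral_cong simp: indicator_def)
  have posB: "0 \<le> x \<bullet> k + R" if "x \<in> B" for x
    using RB[OF that] Basis_le_norm[OF k, of x] by (simp add: R_def)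
  have posA: "0 \<le> x \<bullet> k + (R + d)" if "x \<in> A" for x
    using RA[OF that] Basis_le_norm[OF k, of x] by (simp add: R_def)
  have "(\<integral>\<^sup>+ x. ennreal (x \<bullet> k + R) * indicator B x \<partial>lborel)
    = (\<integral>\<^sup>+ s. ennreal (s + R) * ennreal (iterated_integral ks (indicator B) (s *\<^sub>R k)) \<partial>lborel)"
    by (rule nn_moment_eq_iterated[OF B(1-3) k ks])
  also have "\<dots> = (\<integral>\<^sup>+ s. ennreal (d + s + R) * ennreal (iterated_integral ks (indicator B) ((d + s) *\<^sub>R k)) \<partial>lborel)"
    using nn_integral_real_affine[of "\<lambda>s. ennreal (s + R) * ennreal (iterated_integral ks (indicator B) (s *\<^sub>R k))" 1 d]
      log_concave_onD(1)[OF lc[OF lB]] by simp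
  also have "\<dots> = (\<integral>\<^sup>+ s. ennreal (s + (R + d)) * ennreal (iterated_integral ks (indicator A) (s *\<^sub>R k)) \<partial>lborel)"
    using d by (simp add: add_ac)
  also have "\<dots> = (\<integral>\<^sup>+ x. ennreal (x \<bullet> k + (R + d)) * indicator A x \<partial>lborel)"
    by (rule nn_moment_eq_iterated[OF A(1-3) k ks, symmetric])
  finally have "ennreal (LINT x|lborel. indicator B x * (x \<bullet> k + R)) = ennreal (LINT x|lborel. indicator A x * (x \<bullet> k + (R + d)))"
    by (simp add: nn[OF B(1,3) posB] nn[OF A(1,3) posA])
  then have *: "(LINT x|lborel. indicator B x * (x \<bullet> k + R)) = (LINT x|lborel. indicator A x * (x \<bullet> k + (R + d)))"
    using posA posB by (subst (asm) ennreal_inj) (auto intro!: integral_nonneg_AE simp: indicator_def)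
  have split: "(LINT x|lborel. indicator X x * (x \<bullet> k + r)) = (LINT x|lborel. indicator X x * (x \<bullet> k)) + r * measure lborel X"
    if X: "open X" "bounded X" for X r
  proof -
    have "(LINT x|lborel. indicator X x * (x \<bullet> k + r)) = (LINT x|lborel. indicator X x * (x \<bullet> k + 0) + r * indicator X x)"
      by (simp add: algebra_simps)
    also have "\<dots> = (LINT x|lborel. indicator X x * (x \<bullet> k)) + r * measure lborel X"
      using X emeasure_bounded_finite[of X] int[OF X, of 0]
      by (subst Bochner_Integration.integral_add) auto
    finally show ?thesis .
  qed
  show ?thesis
    using * img eq(1) unfolding split[OF A(1,3)] split[OF B(1,3)] by (intro exI[of _ d]) (simp add: algebra_simps)
qed

lemma lborel_orthogonal_transformation:
  fixes f :: "real ^ 'n::{finite,wellorder} \<Rightarrow> real ^ 'n::_"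
  assumes f: "orthogonal_transformation f"
  shows "lborel = distr lborel borel f"
proof (rule lborel_eqI)
  fix l u :: "real ^ 'n::_" assume lu: "\<And>b. b \<in> Basis \<Longrightarrow> l \<bullet> b \<le> u \<bullet> b"
  have inv: "orthogonal_transformation (inv f)" by (rule orthogonal_transformation_inv[OF f])
  have bij: "bij f" by (rule orthogonal_transformation_bij[OF f])
  have meas: "f \<in> borel_measurable borel"
    by (intro borel_measurable_continuous_onI linear_continuous_on)
       (simp add: linear_conv_bounded_linear[symmetric] orthogonal_transformation_linear f)
  have vim: "f -` box l u = inv f ` box l u"
    by (rule bij_vimage_eq_inv_image[OF bij])
  have sets: "inv f ` box l u \<in> sets borel"
    using measurable_sets[OF meas, of "box l u"] vim by simp
  have bdd: "bounded (inv f ` box l u)"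
    using inv by (intro bounded_linear_image bounded_box)
      (simp add: linear_conv_bounded_linear[symmetric] orthogonal_transformation_linear)
  have "emeasure (distr lborel borel f) (box l u) = emeasure lborel (inv f ` box l u)"
    using meas by (simp add: emeasure_distr vim)
  also have "\<dots> = ennreal (measure lborel (inv f ` box l u))"
    using emeasure_bounded_finite[OF bdd] by (simp add: emeasure_eq_ennreal_measure)
  also have "measure lborel (inv f ` box l u) = measure lebesgue (inv f ` box l u)"
    using sets by simp
  also have "\<dots> = measure lebesgue (box l u)"
    by (rule measure_orthogonal_image[OF inv]) simp
  also have "\<dots> = (\<Prod>b\<in>Basis. (u - l) \<bullet> b)"
    using lu by (simp add: measure_lborel_box_eq inner_diff_left)
  finally show "emeasure (distr lborel borel f) (box l u) = ennreal (\<Prod>b\<in>Basis. (u - l) \<bullet> b)" .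
qed simp

text \<open>An arbitrary direction is rotated to a coordinate direction.\<close>

lemma brunn_minkowski_open_equality_direction:
  fixes A B C :: "(real ^ 'n::{finite,wellorder}) set"
  assumes A: "open A" "convex A" "bounded A" "A \<noteq> {}"
    and B: "open B" "convex B" "bounded B" "B \<noteq> {}"
    and C: "open C" "convex C" "bounded C"
    and t: "0 < t" "t < 1" and ABC: "\<And>x y. x \<in> A \<Longrightarrow> y \<in> B \<Longrightarrow> (1 - t) *\<^sub>R x + t *\<^sub>R y \<in> C"
    and eq: "measure lborel A = measure lborel B" "measure lborel C \<le> measure lborel A"
    and u: "norm u = 1"
  shows "\<exists>d. (\<lambda>x. x \<bullet> u) ` B = (\<lambda>x. x \<bullet> u + d) ` A \<and>
    (LINT x|lborel. indicator B x * (x \<bullet> u)) = (LINT x|lborel. indicator A x * (x \<bullet> u)) + d * measure lborel A"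
proof -
  define k :: "real ^ 'n::_" where "k = axis undefined 1"
  have k: "k \<in> Basis" "norm k = 1" by (simp_all add: k_def axis_in_Basis_iff norm_axis_1)
  obtain f where f: "orthogonal_transformation f" "f u = k"
    using orthogonal_transformation_exists_1[OF u k(2)] by blast
  have lin: "linear f" by (rule orthogonal_transformation_linear[OF f(1)])
  have blin: "bounded_linear f" using lin by (simp add: linear_conv_bounded_linear)
  have bij: "bij f" by (rule orthogonal_transformation_bij[OF f(1)])
  have fk: "f x \<bullet> k = x \<bullet> u" for x
    using f by (metis orthogonal_transformation_def)
  have meas: "f \<in> borel_measurable borel"
    by (intro borel_measurable_continuous_onI linear_continuous_on blin)
  have op: "open (f ` X)" if "open X" for X
    using open_surjective_linear_image[OF that lin] bij by (simp add: bij_def)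
  have mf: "measure lborel (f ` X) = measure lborel X" if X: "open X" "bounded X" for X
    using measure_orthogonal_image[OF f(1), of X] X op[OF X(1)] by (simp add: lmeasurable_open)
  have intf: "(LINT x|lborel. indicator (f ` X) x * (x \<bullet> k)) = (LINT x|lborel. indicator X x * (x \<bullet> u))" if X: "open X" for X
  proof -
    have [measurable]: "f ` X \<in> sets borel" using op[OF X] by simp
    have "(LINT x|lborel. indicator (f ` X) x * (x \<bullet> k)) = (LINT x|distr lborel borel f. indicator (f ` X) x * (x \<bullet> k))"
      using lborel_orthogonal_transformation[OF f(1)] by simp
    also have "\<dots> = (LINT x|lborel. indicator (f ` X) (f x) * (f x \<bullet> k))"
      using meas by (subst integral_distr) auto
    also have "\<dots> = (LINT x|lborel. indicator X x * (x \<bullet> u))"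
      using bij by (simp add: fk indicator_def bij_def inj_image_mem_iff)
    finally show ?thesis .
  qed
  have "\<exists>d. (\<lambda>x. x \<bullet> k) ` (f ` B) = (\<lambda>x. x \<bullet> k + d) ` (f ` A) \<and>
    (LINT x|lborel. indicator (f ` B) x * (x \<bullet> k)) = (LINT x|lborel. indicator (f ` A) x * (x \<bullet> k)) + d * measure lborel (f ` A)"
  proof (rule brunn_minkowski_open_equality[where C = "f ` C", OF _ _ _ _ _ _ _ _ _ _ _ t _ _ _ k(1)])
    fix x y assume "x \<in> f ` A" "y \<in> f ` B"
    then obtain a b where "x = f a" "a \<in> A" "y = f b" "b \<in> B" by blast
    then show "(1 - t) *\<^sub>R x + t *\<^sub>R y \<in> f ` C"
      using ABC lin by (auto simp: linear_add[symmetric] linear_cmul[symmetric])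
  qed (use A B C eq in \<open>auto simp: op mf convex_linear_image lin bounded_linear_image blin\<close>)
  then show ?thesis
    using A B by (simp add: image_image fk intf mf)
qed

lemma mem_compact_convex_of_projections:
  fixes K :: "'a::euclidean_space set"
  assumes K: "compact K" "convex K" and proj: "\<And>a. \<exists>x\<in>K. a \<bullet> y = a \<bullet> x"
  shows "y \<in> K"
proof (rule ccontr)
  assume "y \<notin> K"
  then obtain a b where ab: "a \<bullet> y < b" "\<And>x. x \<in> K \<Longrightarrow> a \<bullet> x > b"
    using separating_hyperplane_closed_point[OF K(2) compact_imp_closed[OF K(1)]] by blast
  obtain x where "x \<in> K" "a \<bullet> y = a \<bullet> x" using proj by blast
  then show False using ab by force
qed

lemma measure_interior_convex:
  fixes K :: "'a::euclidean_space set"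
  assumes "compact K" "convex K"
  shows "measure lborel (interior K) = measure lebesgue K"
  using assms measure_interior[OF compact_imp_bounded negligible_convex_frontier] by simp

lemma compact_convex_combination:
  fixes K L :: "'a::euclidean_space set"
  assumes "compact K" "compact L" "convex K" "convex L"
  shows "compact ((*\<^sub>R) a ` K + (*\<^sub>R) b ` L)" "convex ((*\<^sub>R) a ` K + (*\<^sub>R) b ` L)"
  using assms by (auto intro!: compact_set_plus convex_set_plus compact_scaling convex_scaling)

lemma interior_combination:
  fixes K L :: "'a::euclidean_space set"
  assumes "a > 0" "x \<in> interior K" "y \<in> L"
  shows "a *\<^sub>R x + b *\<^sub>R y \<in> interior ((*\<^sub>R) a ` K + (*\<^sub>R) b ` L)"
proof -
  have "open ((\<lambda>x. a *\<^sub>R x + b *\<^sub>R y) ` interior K)"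
  proof -
    have "(\<lambda>x. a *\<^sub>R x + b *\<^sub>R y) ` interior K = (+) (b *\<^sub>R y) ` ((*\<^sub>R) a ` interior K)"
      by (auto simp: image_image add.commute)
    then show ?thesis using assms(1) by (simp add: open_translation open_scaling)
  qed
  moreover have "(\<lambda>x. a *\<^sub>R x + b *\<^sub>R y) ` interior K \<subseteq> (*\<^sub>R) a ` K + (*\<^sub>R) b ` L"
    using assms(3) interior_subset by (auto intro!: set_plus_intro)
  ultimately show ?thesis using assms(2) by (meson image_eqI interiorI subsetD interior_maximal)
qed

lemma brunn_minkowski_normalized:
  fixes K L :: "(real ^ 'n::{finite,wellorder}) set"
  assumes K: "compact K" "convex K" "measure lebesgue K = 1"
    and L: "compact L" "convex L" "measure lebesgue L = 1"
    and t: "0 < t" "t < 1"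
  defines "M \<equiv> (*\<^sub>R) (1 - t) ` K + (*\<^sub>R) t ` L"
  shows "1 \<le> measure lebesgue M"
    and "measure lebesgue M \<le> 1 \<Longrightarrow> \<exists>v. L = (\<lambda>x. x + v) ` K"
proof -
  have M: "compact M" "convex M" unfolding M_def using compact_convex_combination K L by blast+
  define A B C where "A = interior K" and "B = interior L" and "C = interior M"
  have A: "open A" "convex A" "bounded A" "A \<noteq> {}" "measure lborel A = 1"
    using K measure_interior_convex[OF K(1,2)]
    by (auto simp: A_def bounded_interior compact_imp_bounded)
  have B: "open B" "convex B" "bounded B" "B \<noteq> {}" "measure lborel B = 1"
    using L measure_interior_convex[OF L(1,2)]
    by (auto simp: B_def bounded_interior compact_imp_bounded)
  have C: "open C" "convex C" "bounded C" "measure lborel C = measure lebesgue M"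
    using M measure_interior_convex[OF M] by (auto simp: C_def bounded_interior compact_imp_bounded)
  have ABC: "(1 - t) *\<^sub>R x + t *\<^sub>R y \<in> C" if "x \<in> A" "y \<in> B" for x y
    unfolding C_def M_def using that t interior_subset
    by (intro interior_combination) (auto simp: A_def B_def)
  show "1 \<le> measure lebesgue M"
    using brunn_minkowski_open[OF A(1-4) B(1-4) C(1-3) t ABC] A(5) B(5) C(4) by simp
  assume le: "measure lebesgue M \<le> 1"
  let ?c = "\<lambda>X. LINT x|lborel. indicator X x *\<^sub>R x"
  have cint: "(LINT x|lborel. indicator X x * (x \<bullet> u)) = ?c X \<bullet> u" if X: "open X" "bounded X" for X and u :: "real ^ 'n::_"
  proof -
    obtain b where b: "\<And>x. x \<in> X \<Longrightarrow> norm x \<le> b" using X(2) by (auto simp: bounded_iff)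
    have "integrable lborel (\<lambda>x. indicator X x *\<^sub>R x)"
    proof (rule Bochner_Integration.integrable_bound)
      show "integrable lborel (\<lambda>x. b * indicator X x)"
        using X emeasure_bounded_finite[of X] by (intro integrable_mult_right integrable_real_indicator) auto
      show "(\<lambda>x. indicator X x *\<^sub>R x) \<in> borel_measurable lborel" using X(1) by simp
    qed (use b in \<open>auto simp: indicator_def intro: order_trans[OF _ abs_ge_self]\<close>)
    from integral_inner_left[OF this, of u] show ?thesis by simp
  qed
  define v where "v = ?c B - ?c A"
  have dir: "(\<lambda>x. a \<bullet> x) ` B = (\<lambda>x. a \<bullet> (x + v)) ` A" for a
  proof (cases "a = 0")
    case False
    define u where "u = a /\<^sub>R norm a"
    have u: "norm u = 1" "a = norm a *\<^sub>R u" using False by (auto simp: u_def)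
    obtain d where d: "(\<lambda>x. x \<bullet> u) ` B = (\<lambda>x. x \<bullet> u + d) ` A" "?c B \<bullet> u = ?c A \<bullet> u + d * measure lborel A"
      using brunn_minkowski_open_equality_direction[OF A(1-4) B(1-4) C(1-3) t ABC _ _ u(1)] le A B C
      by (auto simp: cint)
    have "d = u \<bullet> v" using d(2) A(5) by (simp add: v_def inner_diff_right inner_commute)
    then have "(*) (norm a) ` (\<lambda>x. x \<bullet> u) ` B = (*) (norm a) ` (\<lambda>x. u \<bullet> (x + v)) ` A"
      unfolding d(1) by (simp add: inner_add_right inner_commute[of u])
    then show ?thesis by (subst (1 2) u(2)) (simp add: image_image inner_commute[of u])
  qed (use A B in auto)
  have KL: "closure A = K" "closure B = L"
    using A(4) B(4) K L by (simp_all add: A_def B_def convex_closure_interior compact_imp_closed)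
  have tr: "compact ((\<lambda>x. x + w) ` X)" "convex ((\<lambda>x. x + w) ` X)"
    if "compact X" "convex X" for X and w :: "real ^ 'n::_"
  proof -
    have "(\<lambda>x. x + w) ` X = (+) w ` X" by (rule image_cong) (simp_all add: add.commute)
    then show "compact ((\<lambda>x. x + w) ` X)" "convex ((\<lambda>x. x + w) ` X)"
      using compact_translation[OF that(1), of w] convex_translation[OF that(2), of w] by simp_all
  qed
  have "B \<subseteq> (\<lambda>x. x + v) ` K"
  proof (intro subsetI mem_compact_convex_of_projections tr K)
    fix y a assume "y \<in> B"
    then have "a \<bullet> y \<in> (\<lambda>x. a \<bullet> (x + v)) ` A" using dir[of a] by blast
    then show "\<exists>x\<in>(\<lambda>x. x + v) ` K. a \<bullet> y = a \<bullet> x" using interior_subset[of K] by (auto simp: A_def)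
  qed
  then have 1: "L \<subseteq> (\<lambda>x. x + v) ` K"
    unfolding KL(2)[symmetric] by (intro closure_minimal compact_imp_closed tr K)
  have "A \<subseteq> (\<lambda>x. x + - v) ` L"
  proof (intro subsetI mem_compact_convex_of_projections tr L)
    fix y a assume "y \<in> A"
    then have "a \<bullet> (y + v) \<in> (\<lambda>x. a \<bullet> x) ` B" using dir[of a] by blast
    then obtain x where "x \<in> B" "a \<bullet> (y + v) = a \<bullet> x" by auto
    then show "\<exists>x\<in>(\<lambda>x. x + - v) ` L. a \<bullet> y = a \<bullet> x"
      using interior_subset[of L] by (auto simp: B_def inner_add_right inner_diff_right algebra_simps intro!: bexI[of _ x])
  qed
  then have 2: "K \<subseteq> (\<lambda>x. x + - v) ` L"
    unfolding KL(1)[symmetric] by (intro closure_minimal compact_imp_closed tr L)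
  have "L = (\<lambda>x. x + v) ` K"
    using 1 2 by (auto simp: image_iff subset_iff)
  then show "\<exists>v. L = (\<lambda>x. x + v) ` K" by blast
qed

lemma linear_image_set_plus:
  assumes "linear f"
  shows "f ` (K + L) = f ` K + f ` L"
  by (force simp: set_plus_def linear_add[OF assms])

lemma measure_scaleR:
  fixes S :: "'a::euclidean_space set"
  shows "measure lebesgue ((*\<^sub>R) c ` S) = \<bar>c\<bar> ^ DIM('a) * measure lebesgue S"
  using measure_lebesgue_affine[of c 0 S] by simp

lemma brunn_minkowski_ordered:
  fixes K L :: "(real ^ 'n::{finite,wellorder}) set"
  assumes K: "compact K" "convex K" "measure lebesgue K > 0"
    and L: "compact L" "convex L" "measure lebesgue L > 0"
  defines "g \<equiv> \<lambda>X :: (real ^ 'n::_) set. root CARD('n) (measure lebesgue X)"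
  shows "g K + g L \<le> g (K + L)"
    and "g (K + L) \<le> g K + g L \<Longrightarrow> \<exists>a>0. \<exists>v. L = (\<lambda>x. a *\<^sub>R x + v) ` K"
proof -
  let ?n = "CARD('n)"
  have n: "?n > 0" by simp
  have g: "g K > 0" "g L > 0" using K L by (simp_all add: g_def)
  have gn: "g X ^ ?n = measure lebesgue X" for X by (simp add: g_def)
  define K' L' where "K' = (*\<^sub>R) (1 / g K) ` K" and "L' = (*\<^sub>R) (1 / g L) ` L"
  define t where "t = g L / (g K + g L)"
  have t: "0 < t" "t < 1" using g by (simp_all add: t_def)
  have t': "1 - t = g K / (g K + g L)" using g by (simp add: t_def field_simps)
  have K': "compact K'" "convex K'" "measure lebesgue K' = 1"
    using K g gn[of K] by (auto simp: K'_def compact_scaling convex_scaling measure_scaleR power_divide)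
  have L': "compact L'" "convex L'" "measure lebesgue L' = 1"
    using L g gn[of L] by (auto simp: L'_def compact_scaling convex_scaling measure_scaleR power_divide)
  have "(*\<^sub>R) (1 - t) ` K' = (*\<^sub>R) (1 / (g K + g L)) ` K" "(*\<^sub>R) t ` L' = (*\<^sub>R) (1 / (g K + g L)) ` L"
    using g unfolding t' by (auto simp: K'_def L'_def t_def image_image)
  then have M: "(*\<^sub>R) (1 - t) ` K' + (*\<^sub>R) t ` L' = (*\<^sub>R) (1 / (g K + g L)) ` (K + L)"
    by (simp add: linear_image_set_plus linear_scaleR)
  have eq: "measure lebesgue ((*\<^sub>R) (1 - t) ` K' + (*\<^sub>R) t ` L') = (g (K + L) / (g K + g L)) ^ ?n"
    unfolding M measure_scaleR using g gn[of "K + L"] by (simp add: power_divide)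
  have gKL: "g (K + L) \<ge> 0" by (simp add: g_def)
  have "1 \<le> (g (K + L) / (g K + g L)) ^ ?n"
    using brunn_minkowski_normalized(1)[OF K' L' t] eq by simp
  then have "1 \<le> g (K + L) / (g K + g L)"
    using n gKL g by (metis add_pos_pos divide_nonneg_pos linorder_not_less power_less_one_iff)
  then show "g K + g L \<le> g (K + L)" using g by (simp add: field_simps)
  assume "g (K + L) \<le> g K + g L"
  then have "(g (K + L) / (g K + g L)) ^ ?n \<le> 1"
    using g gKL by (intro power_le_one) auto
  then obtain v where v: "L' = (\<lambda>x. x + v) ` K'"
    using brunn_minkowski_normalized(2)[OF K' L' t] eq by auto
  have "L = (*\<^sub>R) (g L) ` L'" using g by (simp add: L'_def image_image)
  also have "\<dots> = (\<lambda>x. (g L / g K) *\<^sub>R x + g L *\<^sub>R v) ` K"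
    by (simp add: v K'_def image_image scaleR_add_right)
  finally show "\<exists>a>0. \<exists>v. L = (\<lambda>x. a *\<^sub>R x + v) ` K"
    using g by (intro exI[of _ "g L / g K"]) auto
qed

lemma reindex_body:
  fixes K :: "(real ^ 'n::finite) set"
  assumes "compact K" "convex K"
  shows "compact (reindex ` K)" "convex (reindex ` K)"
    "interior K \<noteq> {} \<Longrightarrow> interior (reindex ` K) \<noteq> {}"
proof -
  show "compact (reindex ` K)" by (rule compact_continuous_image[OF continuous_on_reindex assms(1)])
  show "convex (reindex ` K)" by (rule convex_linear_image[OF linear_reindex assms(2)])
  show "interior (reindex ` K) \<noteq> {}" if "interior K \<noteq> {}"
    unfolding interior_bijective_linear_image[OF linear_reindex bij_reindex] using that by simp
qed

lemma brunn_minkowski: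
  fixes K L :: "(real ^ 'n::finite) set"
  assumes K: "compact K" "convex K" "measure lebesgue K > 0"
    and L: "compact L" "convex L" "measure lebesgue L > 0"
  defines "g \<equiv> \<lambda>X :: (real ^ 'n) set. root CARD('n) (measure lebesgue X)"
  shows "g K + g L \<le> g (K + L)"
    and "g (K + L) \<le> g K + g L \<Longrightarrow> \<exists>a>0. \<exists>v. L = (\<lambda>x. a *\<^sub>R x + v) ` K"
proof -
  have sum: "reindex ` K + reindex ` L = reindex ` (K + L)"
    by (rule linear_image_set_plus[OF linear_reindex, symmetric])
  have cKL: "compact (K + L)" by (rule compact_set_plus[OF K(1) L(1)])
  note BM = brunn_minkowski_ordered[of "reindex ` K" "reindex ` L",
      OF reindex_body(1,2)[OF K(1,2)] _ reindex_body(1,2)[OF L(1,2)],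
      unfolded sum card_ordered measure_reindex[OF K(1)] measure_reindex[OF L(1)] measure_reindex[OF cKL]]
  show "g K + g L \<le> g (K + L)" unfolding g_def by (rule BM(1)[OF K(3) L(3)])
  assume "g (K + L) \<le> g K + g L"
  then obtain a v where av: "a > 0" "reindex ` L = (\<lambda>x. a *\<^sub>R x + v) ` reindex ` K"
    using BM(2)[OF K(3) L(3)] unfolding g_def by blast
  obtain w where w: "v = reindex w" using bij_reindex by (metis bij_pointE)
  have "reindex ` L = reindex ` (\<lambda>x. a *\<^sub>R x + w) ` K"
    unfolding av(2) w by (simp add: image_image linear_add[OF linear_reindex] linear_cmul[OF linear_reindex])
  then have "L = (\<lambda>x. a *\<^sub>R x + w) ` K"
    by (simp only: inj_image_eq_iff[OF bij_is_inj[OF bij_reindex]])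
  with av(1) show "\<exists>a>0. \<exists>v. L = (\<lambda>x. a *\<^sub>R x + v) ` K" by blast
qed

lemma steiner_polynomial:
  fixes K E :: "(real ^ 'n::finite) set"
  assumes K: "compact K" "convex K" "interior K \<noteq> {}"
    and E: "compact E" "convex E" "interior E \<noteq> {}"
  shows "\<exists>p. degree p \<le> CARD('n) \<and> (\<forall>l\<ge>0. measure lebesgue (K + (*\<^sub>R) l ` E) = poly p l)"
proof -
  have sum: "reindex ` K + (*\<^sub>R) l ` reindex ` E = reindex ` (K + (*\<^sub>R) l ` E)" for l
    by (simp add: linear_image_set_plus[OF linear_reindex] image_image linear_cmul[OF linear_reindex])
  have "measure lebesgue (reindex ` (K + (*\<^sub>R) l ` E)) = measure lebesgue (K + (*\<^sub>R) l ` E)" for l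
    by (intro measure_reindex compact_set_plus compact_scaling K E)
  then show ?thesis
    using steiner_polynomial_ordered[OF reindex_body[OF K(1,2)] reindex_body[OF E(1,2)], OF K(3) E(3)]
    unfolding sum card_ordered by simp
qed

section \<open>Erosions\<close>

definition erosion :: "'a::real_vector set \<Rightarrow> real \<Rightarrow> 'a set \<Rightarrow> 'a set" where
  "erosion L \<delta> E = {x. (\<lambda>y. x + \<delta> *\<^sub>R y) ` E \<subseteq> L}"

lemma mem_erosion: "x \<in> erosion L \<delta> E \<longleftrightarrow> (\<forall>e\<in>E. x + \<delta> *\<^sub>R e \<in> L)"
  by (auto simp: erosion_def)

lemma erosion_eq_INT: "erosion L \<delta> E = (\<Inter>e\<in>E. (+) (- (\<delta> *\<^sub>R e)) ` L)"
proof -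
  have "x + \<delta> *\<^sub>R e \<in> L \<longleftrightarrow> x \<in> (+) (- (\<delta> *\<^sub>R e)) ` L" for x e
    by (auto simp: image_iff intro: bexI[of _ "x + \<delta> *\<^sub>R e"])
  then show ?thesis by (auto simp: mem_erosion)
qed

lemma compact_erosion:
  fixes L :: "'a::real_normed_vector set"
  assumes "compact L" "E \<noteq> {}"
  shows "compact (erosion L \<delta> E)"
proof -
  obtain e where e: "e \<in> E" using assms(2) by blast
  have "erosion L \<delta> E = (+) (- (\<delta> *\<^sub>R e)) ` L \<inter> erosion L \<delta> E"
    using e by (auto simp: erosion_eq_INT)
  moreover have "closed (erosion L \<delta> E)"
    unfolding erosion_eq_INT using assms(1) by (intro closed_INT ballI compact_imp_closed compact_translation)
  ultimately show ?thesis
    using compact_Int_closed[OF compact_translation[OF assms(1)]] by metis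
qed

lemma convex_erosion:
  assumes "convex L"
  shows "convex (erosion L \<delta> E)"
  unfolding erosion_eq_INT using assms by (intro convex_INT convex_translation) auto

lemma erosion_sum_subset: "erosion L \<delta> E + (*\<^sub>R) \<delta> ` E \<subseteq> L"
  by (auto simp: mem_erosion elim!: set_plus_elim)

lemma set_plus_scaleR_add:
  fixes E :: "'a::real_vector set"
  assumes "convex E" "0 \<le> a" "0 \<le> b"
  shows "(*\<^sub>R) a ` E + (*\<^sub>R) b ` E = (*\<^sub>R) (a + b) ` E"
proof (cases "a + b = 0")
  case True
  then have "a = 0" "b = 0" using assms by linarith+
  then show ?thesis by (auto simp: set_plus_def)
next
  case False
  then have ab: "a + b > 0" using assms by linarith
  show ?thesis
  proof safe
    fix z assume "z \<in> (*\<^sub>R) a ` E + (*\<^sub>R) b ` E"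
    then obtain e f where ef: "e \<in> E" "f \<in> E" "z = a *\<^sub>R e + b *\<^sub>R f" by (auto elim!: set_plus_elim)
    have "z = (a + b) *\<^sub>R ((a / (a + b)) *\<^sub>R e + (b / (a + b)) *\<^sub>R f)"
      using ab by (simp add: ef(3) scaleR_add_right)
    moreover have "(a / (a + b)) *\<^sub>R e + (b / (a + b)) *\<^sub>R f \<in> E"
      using assms ab ef(1,2) by (intro convexD) (auto simp: add_divide_distrib[symmetric])
    ultimately show "z \<in> (*\<^sub>R) (a + b) ` E" by (rule image_eqI)
  next
    fix e assume "e \<in> E"
    then show "(a + b) *\<^sub>R e \<in> (*\<^sub>R) a ` E + (*\<^sub>R) b ` E"
      unfolding scaleR_add_left by (intro set_plus_intro imageI)
  qed
qed

lemma erosion_erosion: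
  assumes "convex E" "0 \<le> a" "0 \<le> b"
  shows "erosion (erosion L a E) b E = erosion L (a + b) E"
proof (rule set_eqI)
  fix x
  have "x \<in> erosion (erosion L a E) b E \<longleftrightarrow> (\<forall>z\<in>(*\<^sub>R) a ` E + (*\<^sub>R) b ` E. x + z \<in> L)"
    by (fastforce simp: mem_erosion add_ac elim!: set_plus_elim intro: set_plus_intro)
  also have "\<dots> \<longleftrightarrow> x \<in> erosion L (a + b) E"
    unfolding set_plus_scaleR_add[OF assms] by (auto simp: mem_erosion)
  finally show "x \<in> erosion (erosion L a E) b E \<longleftrightarrow> x \<in> erosion L (a + b) E" .
qed

lemma set_plus_cancel_subset:
  fixes A B C :: "'a::euclidean_space set"
  assumes B: "compact B" "convex B" and C: "compact C" "C \<noteq> {}" and sub: "A + C \<subseteq> B + C"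
  shows "A \<subseteq> B"
proof
  fix a assume a: "a \<in> A"
  show "a \<in> B"
  proof (rule ccontr)
    assume "a \<notin> B"
    then obtain u k where u: "u \<bullet> a < k" "\<And>b. b \<in> B \<Longrightarrow> u \<bullet> b > k"
      using separating_hyperplane_closed_point[OF B(2) compact_imp_closed[OF B(1)]] by blast
    have "continuous_on C (\<lambda>c. u \<bullet> c)" by (intro continuous_intros)
    then obtain c where c: "c \<in> C" "\<And>c'. c' \<in> C \<Longrightarrow> u \<bullet> c \<le> u \<bullet> c'"
      using continuous_attains_inf[OF C, of "\<lambda>c. u \<bullet> c"] by blast
    have "a + c \<in> B + C" using sub a c(1) by (intro subsetD[OF sub] set_plus_intro)
    then obtain b c' where bc: "b \<in> B" "c' \<in> C" "a + c = b + c'" by (auto elim: set_plus_elim)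
    have "u \<bullet> a + u \<bullet> c = u \<bullet> b + u \<bullet> c'" using bc(3) by (metis inner_add_right)
    then show False using u(1) u(2)[OF bc(1)] c(2)[OF bc(2)] by linarith
  qed
qed

lemma erosion_set_plus:
  fixes A E :: "'a::euclidean_space set"
  assumes A: "compact A" "convex A" and E: "compact E" "E \<noteq> {}"
  shows "erosion (A + (*\<^sub>R) \<delta> ` E) \<delta> E = A"
proof
  have "erosion (A + (*\<^sub>R) \<delta> ` E) \<delta> E + (*\<^sub>R) \<delta> ` E \<subseteq> A + (*\<^sub>R) \<delta> ` E"
    by (rule erosion_sum_subset)
  then show "erosion (A + (*\<^sub>R) \<delta> ` E) \<delta> E \<subseteq> A"
    using E by (intro set_plus_cancel_subset[OF A compact_scaling]) auto
  show "A \<subseteq> erosion (A + (*\<^sub>R) \<delta> ` E) \<delta> E"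
    by (auto simp: mem_erosion intro!: set_plus_intro)
qed

lemma interior_scaleR:
  fixes S :: "'a::euclidean_space set"
  assumes "c \<noteq> 0"
  shows "interior ((*\<^sub>R) c ` S) = (*\<^sub>R) c ` interior S"
  using assms by (intro interior_injective_linear_image linear_scaleR inj_onI) auto

lemma interior_erosion:
  fixes L E :: "'a::euclidean_space set"
  assumes E: "compact E" and sub: "\<And>e. e \<in> E \<Longrightarrow> x + \<delta> *\<^sub>R e \<in> interior L"
  shows "x \<in> interior (erosion L \<delta> E)"
proof -
  have "compact ((\<lambda>e. x + \<delta> *\<^sub>R e) ` E)"
    by (intro compact_continuous_image continuous_intros E)
  moreover have "(\<lambda>e. x + \<delta> *\<^sub>R e) ` E \<subseteq> interior L" using sub by auto
  ultimately obtain r where r: "r > 0" "(\<Union>y\<in>(\<lambda>e. x + \<delta> *\<^sub>R e) ` E. ball y r) \<subseteq> interior L"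
    using compact_subset_open_imp_ball_epsilon_subset[OF _ open_interior] by blast
  have "ball x r \<subseteq> erosion L \<delta> E"
  proof
    fix y assume y: "y \<in> ball x r"
    have "y + \<delta> *\<^sub>R e \<in> L" if "e \<in> E" for e
    proof -
      have "y + \<delta> *\<^sub>R e \<in> ball (x + \<delta> *\<^sub>R e) r" using y by (simp add: dist_norm)
      then show ?thesis using r(2) that interior_subset by blast
    qed
    then show "y \<in> erosion L \<delta> E" by (simp add: mem_erosion)
  qed
  then show ?thesis using r(1) by (auto simp: mem_interior)
qed

lemma supporting_functional:
  fixes L :: "'a::euclidean_space set"
  assumes L: "convex L" "interior L \<noteq> {}" and y: "y \<in> L" "y \<notin> interior L"
  obtains u where "u \<noteq> 0" "\<And>z. z \<in> L \<Longrightarrow> u \<bullet> z \<le> u \<bullet> y"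
proof -
  have "y \<notin> rel_interior L" using y L by (simp add: rel_interior_nonempty_interior)
  then obtain a where a: "a \<noteq> 0" "\<And>z. z \<in> L \<Longrightarrow> a \<bullet> y \<le> a \<bullet> z"
    using supporting_hyperplane_rel_boundary[OF L(1) y(1)] by metis
  show ?thesis by (rule that[of "- a"]) (use a in auto)
qed

section \<open>Minkowski gauge and first variation of volume\<close>

definition minkowski_gauge :: "'a::real_vector set \<Rightarrow> 'a \<Rightarrow> real" where
  "minkowski_gauge M x = Inf {r. 0 < r \<and> x \<in> (*\<^sub>R) r ` M}"

lemma mem_scaleR_image_iff:
  fixes M :: "'a::real_vector set"
  shows "r \<noteq> 0 \<Longrightarrow> x \<in> (*\<^sub>R) r ` M \<longleftrightarrow> (1 / r) *\<^sub>R x \<in> M"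
  by (auto simp: image_iff intro: bexI[of _ "(1 / r) *\<^sub>R x"])

lemma scaleR_image_mono_star:
  fixes M :: "'a::real_vector set"
  assumes M: "convex M" "0 \<in> M" and r: "0 < r" "r \<le> s" "x \<in> (*\<^sub>R) r ` M"
  shows "x \<in> (*\<^sub>R) s ` M"
proof -
  have "(r / s) *\<^sub>R ((1 / r) *\<^sub>R x) + (1 - r / s) *\<^sub>R 0 \<in> M"
    using r by (intro convexD[OF M(1) _ M(2)]) (auto simp: mem_scaleR_image_iff)
  then show ?thesis using r by (simp add: mem_scaleR_image_iff)
qed

lemma minkowski_gauge_le_iff:
  fixes M :: "'a::euclidean_space set"
  assumes M: "compact M" "convex M" "0 \<in> interior M" and r: "0 < r"
  shows "minkowski_gauge M x \<le> r \<longleftrightarrow> x \<in> (*\<^sub>R) r ` M"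
proof
  let ?S = "{r. 0 < r \<and> x \<in> (*\<^sub>R) r ` M}"
  have M0: "0 \<in> M" using M(3) interior_subset by blast
  have bdd: "bdd_below ?S" by (auto intro!: bdd_belowI[of _ 0])
  obtain e where e: "e > 0" "cball 0 e \<subseteq> M" using M(3) by (auto simp: mem_interior_cball)
  have "(norm x + 1) / e \<in> ?S"
  proof -
    have np: "norm x + 1 > 0" by (simp add: add_nonneg_pos)
    moreover have "(1 / ((norm x + 1) / e)) *\<^sub>R x \<in> cball 0 e"
      using e np by (simp add: divide_simps mult_left_mono)
    ultimately show ?thesis using e by (auto simp: mem_scaleR_image_iff)
  qed
  then have ne: "?S \<noteq> {}" by blast
  {
    assume "x \<in> (*\<^sub>R) r ` M"
    then show "minkowski_gauge M x \<le> r"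
      unfolding minkowski_gauge_def using r by (intro cInf_lower bdd) auto
  next
    assume le: "minkowski_gauge M x \<le> r"
    have mem: "(1 / s) *\<^sub>R x \<in> M" if s: "s > r" for s
    proof -
      obtain s' where "s' \<in> ?S" "s' < s"
        using cInf_lessD[OF ne, of s] le s by (auto simp: minkowski_gauge_def)
      then have "x \<in> (*\<^sub>R) s ` M" using scaleR_image_mono_star[OF M(2) M0, of s' s x] by auto
      then show ?thesis using s r by (simp add: mem_scaleR_image_iff)
    qed
    have lim: "(\<lambda>n. (1 / (r + 1 / Suc n)) *\<^sub>R x) \<longlonglongrightarrow> (1 / (r + 0)) *\<^sub>R x"
      using r by (intro tendsto_intros LIMSEQ_Suc[OF lim_1_over_n]) auto
    have "(1 / (r + 0)) *\<^sub>R x \<in> M"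
      by (rule closed_sequentially[OF compact_imp_closed[OF M(1)] _ lim]) (rule mem, simp)
    then show "x \<in> (*\<^sub>R) r ` M" using r by (simp add: mem_scaleR_image_iff)
  }
qed

locale gauge_body =
  fixes M :: "'a::euclidean_space set"
  assumes compact: "compact M" and convex: "convex M" and interior: "0 \<in> interior M"
begin

abbreviation p :: "'a \<Rightarrow> real" where "p \<equiv> minkowski_gauge M"

lemma gauge_le_iff: "0 < r \<Longrightarrow> p x \<le> r \<longleftrightarrow> x \<in> (*\<^sub>R) r ` M"
  by (rule minkowski_gauge_le_iff[OF compact convex interior])

lemma gauge_nonneg: "p x \<ge> 0"
proof -
  have "\<exists>r>0. x \<in> (*\<^sub>R) r ` M"
    using gauge_le_iff[of "max 1 (p x)" x] by (intro exI[of _ "max 1 (p x)"]) auto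
  then show ?thesis
    unfolding minkowski_gauge_def by (intro cInf_greatest) auto
qed

lemma gauge_scale: "c \<ge> 0 \<Longrightarrow> p (c *\<^sub>R x) = c * p x"
proof -
  have le: "p (c *\<^sub>R x) \<le> c * p x" if c: "c > 0" for c x
  proof (rule field_le_epsilon)
    fix e :: real assume e: "e > 0"
    define r where "r = p x + e / c"
    have pos: "r > 0" using gauge_nonneg[of x] e c by (simp add: r_def add_nonneg_pos)
    have "x \<in> (*\<^sub>R) r ` M" using gauge_le_iff[OF pos, of x] e c by (simp add: r_def)
    then have "c *\<^sub>R x \<in> (*\<^sub>R) (c * r) ` M" by (auto simp: image_iff)
    then have "p (c *\<^sub>R x) \<le> c * r" using c pos by (subst gauge_le_iff) auto
    then show "p (c *\<^sub>R x) \<le> c * p x + e" using c by (simp add: r_def algebra_simps)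
  qed
  have "p 0 = 0"
  proof (rule antisym[OF field_le_epsilon gauge_nonneg])
    fix e :: real assume "e > 0"
    moreover have "0 \<in> (*\<^sub>R) e ` M" using interior interior_subset by (auto simp: image_iff intro: bexI[of _ 0])
    ultimately show "p 0 \<le> 0 + e" by (simp add: gauge_le_iff)
  qed
  moreover have "c * p x \<le> p (c *\<^sub>R x)" if c: "c > 0"
    using le[of "1 / c" "c *\<^sub>R x"] c by (simp add: field_simps)
  ultimately show "c \<ge> 0 \<Longrightarrow> p (c *\<^sub>R x) = c * p x"
    using le[of c x] by (cases "c = 0") (auto intro: antisym)
qed

lemma gauge_triangle: "p (x + y) \<le> p x + p y"
proof (rule field_le_epsilon)
  fix e :: real assume e: "e > 0"
  define r s where "r = p x + e / 2" and "s = p y + e / 2"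
  have rs: "r > 0" "s > 0" using gauge_nonneg[of x] gauge_nonneg[of y] e by (auto simp: r_def s_def)
  have "x \<in> (*\<^sub>R) r ` M" "y \<in> (*\<^sub>R) s ` M"
    using e rs by (auto simp: gauge_le_iff[symmetric]) (auto simp: r_def s_def)
  then obtain a b where ab: "a \<in> M" "b \<in> M" "x = r *\<^sub>R a" "y = s *\<^sub>R b" by blast
  have "(r / (r + s)) *\<^sub>R a + (s / (r + s)) *\<^sub>R b \<in> M"
    using rs ab by (intro convexD[OF convex]) (auto simp: add_divide_distrib[symmetric])
  moreover have "x + y = (r + s) *\<^sub>R ((r / (r + s)) *\<^sub>R a + (s / (r + s)) *\<^sub>R b)"
    using rs by (simp add: ab scaleR_add_right)
  ultimately have "p (x + y) \<le> r + s" using rs by (subst gauge_le_iff) auto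
  then show "p (x + y) \<le> p x + p y + e" by (simp add: r_def s_def)
qed

lemma gauge_bounds:
  obtains a b where "a > 0" "b > 0" "\<And>x. p x \<le> a * norm x" "\<And>x. norm x \<le> b * p x"
proof -
  obtain e where e: "e > 0" "cball 0 e \<subseteq> M" using interior by (auto simp: mem_interior_cball)
  obtain R where R: "R > 0" "\<And>x. x \<in> M \<Longrightarrow> norm x \<le> R"
    using compact_imp_bounded[OF compact] by (auto simp: bounded_pos)
  show ?thesis
  proof (rule that[of "1 / e" R])
    show "p x \<le> 1 / e * norm x" for x
    proof (cases "x = 0")
      case False
      have "(1 / (norm x / e)) *\<^sub>R x \<in> cball 0 e" using False e by simp
      then have "x \<in> (*\<^sub>R) (norm x / e) ` M" using e False by (auto simp: mem_scaleR_image_iff)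
      then show ?thesis using False e by (simp add: gauge_le_iff)
    qed (use gauge_scale[of 0 0] in simp)
    show "norm x \<le> R * p x" for x
    proof (rule field_le_epsilon)
      fix d :: real assume d: "d > 0"
      have pos: "p x + d / R > 0" using gauge_nonneg[of x] d R by (simp add: add_nonneg_pos)
      then have "x \<in> (*\<^sub>R) (p x + d / R) ` M" using d R by (simp add: gauge_le_iff[symmetric])
      then obtain y where "y \<in> M" "x = (p x + d / R) *\<^sub>R y" by blast
      then have "norm x \<le> (p x + d / R) * R"
        using pos R(2)[of y] by (metis abs_of_pos mult_left_mono norm_scaleR order_less_imp_le)
      then show "norm x \<le> R * p x + d" using R by (simp add: algebra_simps)
    qed
  qed (use e R in auto)
qed

lemma gauge_lipschitz: obtains a where "a > 0" "\<And>x y. \<bar>p x - p y\<bar> \<le> a * norm (x - y)"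
proof -
  obtain a b where ab: "a > 0" "\<And>x. p x \<le> a * norm x" using gauge_bounds by metis
  have le: "p x - p y \<le> a * norm (x - y)" for x y
    using gauge_triangle[of "x - y" y] ab(2)[of "x - y"] by simp
  have "\<bar>p x - p y\<bar> \<le> a * norm (x - y)" for x y
    using le[of x y] le[of y x] by (simp add: abs_le_iff norm_minus_commute)
  then show ?thesis using ab(1) that by blast
qed

lemma gauge_continuous: "continuous_on S p"
proof -
  obtain a where a: "a > 0" "\<And>x y. \<bar>p x - p y\<bar> \<le> a * norm (x - y)" using gauge_lipschitz by metis
  have "a-lipschitz_on S p"
    using a by (intro lipschitz_onI) (auto simp: dist_real_def dist_norm)
  then show ?thesis by (rule lipschitz_on_continuous_on)
qed

lemma gauge_measurable [measurable]: "p \<in> borel_measurable borel"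
  by (rule borel_measurable_continuous_onI[OF gauge_continuous])

definition directional :: "'a \<Rightarrow> 'a \<Rightarrow> real" where
  "directional x w = Inf ((\<lambda>t. (p (x + t *\<^sub>R w) - p x) / t) ` {0<..})"

lemma quotient_mono:
  assumes "0 < s" "s \<le> t"
  shows "(p (x + s *\<^sub>R w) - p x) / s \<le> (p (x + t *\<^sub>R w) - p x) / t"
proof -
  have "x + s *\<^sub>R w = (1 - s / t) *\<^sub>R x + (s / t) *\<^sub>R (x + t *\<^sub>R w)"
    using assms by (simp add: algebra_simps)
  then have "p (x + s *\<^sub>R w) \<le> p ((1 - s / t) *\<^sub>R x) + p ((s / t) *\<^sub>R (x + t *\<^sub>R w))"
    using gauge_triangle by metis
  also have "\<dots> = (1 - s / t) * p x + (s / t) * p (x + t *\<^sub>R w)"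
    using assms by (simp add: gauge_scale)
  finally have "p (x + s *\<^sub>R w) - p x \<le> s * ((p (x + t *\<^sub>R w) - p x) / t)"
    by (simp add: algebra_simps diff_divide_distrib)
  then show ?thesis using assms by (simp add: pos_divide_le_eq mult.commute)
qed

lemma quotient_lower:
  assumes "t > 0"
  shows "- p (- w) \<le> (p (x + t *\<^sub>R w) - p x) / t"
proof -
  have "p x \<le> p (x + t *\<^sub>R w) + p (t *\<^sub>R (- w))"
    using gauge_triangle[of "x + t *\<^sub>R w" "t *\<^sub>R (- w)"] by simp
  then have "p x \<le> p (x + t *\<^sub>R w) + t * p (- w)"
    using gauge_scale[of t "- w"] assms by simp
  then show ?thesis using assms by (simp add: pos_le_divide_eq algebra_simps)
qed

lemma bdd_below_quotients: "bdd_below ((\<lambda>t. (p (x + t *\<^sub>R w) - p x) / t) ` {0<..})"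
  using quotient_lower by (intro bdd_belowI2[of _ "- p (- w)"]) auto

lemma directional_le: "t > 0 \<Longrightarrow> directional x w \<le> (p (x + t *\<^sub>R w) - p x) / t"
  unfolding directional_def by (intro cINF_lower bdd_below_quotients) auto

lemma directional_limit: "((\<lambda>t. (p (x + t *\<^sub>R w) - p x) / t) \<longlongrightarrow> directional x w) (at_right 0)"
proof (rule tendstoI)
  fix e :: real assume e: "e > 0"
  obtain t0 where t0: "t0 > 0" "(p (x + t0 *\<^sub>R w) - p x) / t0 < directional x w + e"
    using cInf_lessD[of "(\<lambda>t. (p (x + t *\<^sub>R w) - p x) / t) ` {0<..}" "directional x w + e"] e
    by (auto simp: directional_def)
  have "dist ((p (x + t *\<^sub>R w) - p x) / t) (directional x w) < e" if "0 < t" "t < t0" for t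
    using directional_le[OF that(1), of x w] quotient_mono[of t t0 x w] that t0 by (simp add: dist_real_def)
  then show "\<forall>\<^sub>F t in at_right 0. dist ((p (x + t *\<^sub>R w) - p x) / t) (directional x w) < e"
    using t0(1) by (auto simp: eventually_at_right[of 0 1] intro!: exI[of _ t0])
qed

lemma directional_add: "directional x (v + w) \<le> directional x v + directional x w"
proof (rule tendsto_le[OF trivial_limit_at_right_real _ directional_limit])
  have lim2: "((\<lambda>t. (p (x + (2 * t) *\<^sub>R u) - p x) / (2 * t)) \<longlongrightarrow> directional x u) (at_right 0)" for u
  proof (rule filterlim_compose[OF directional_limit])
    show "LIM t at_right 0. 2 * t :> at_right (0::real)"
      by (rule filterlim_times_pos[of _ _ _ 2]) (auto simp: filterlim_ident)
  qed
  show "((\<lambda>t. (p (x + (2 * t) *\<^sub>R v) - p x) / (2 * t) + (p (x + (2 * t) *\<^sub>R w) - p x) / (2 * t))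
    \<longlongrightarrow> directional x v + directional x w) (at_right 0)"
    by (intro tendsto_add lim2)
  have "(p (x + t *\<^sub>R (v + w)) - p x) / t \<le> (p (x + (2 * t) *\<^sub>R v) - p x) / (2 * t) + (p (x + (2 * t) *\<^sub>R w) - p x) / (2 * t)"
    if t: "t > 0" for t
  proof -
    have "x + t *\<^sub>R (v + w) = (1 / 2) *\<^sub>R (x + (2 * t) *\<^sub>R v) + (1 / 2) *\<^sub>R (x + (2 * t) *\<^sub>R w)"
    proof -
      have "(1 / 2) *\<^sub>R x + (1 / 2) *\<^sub>R x = x" by (metis scaleR_half_double scaleR_add_right)
      then show ?thesis
        by (simp add: scaleR_add_right add_ac)
    qed
    then have le: "p (x + t *\<^sub>R (v + w)) \<le> (1 / 2) * p (x + (2 * t) *\<^sub>R v) + (1 / 2) * p (x + (2 * t) *\<^sub>R w)"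
      using gauge_triangle[of "(1 / 2) *\<^sub>R (x + (2 * t) *\<^sub>R v)" "(1 / 2) *\<^sub>R (x + (2 * t) *\<^sub>R w)"]
      by (simp only: gauge_scale zero_le_divide_1_iff zero_le_numeral)
    have "(p (x + (2 * t) *\<^sub>R v) - p x) / (2 * t) + (p (x + (2 * t) *\<^sub>R w) - p x) / (2 * t)
       = ((1 / 2) * p (x + (2 * t) *\<^sub>R v) + (1 / 2) * p (x + (2 * t) *\<^sub>R w) - p x) / t"
      using t by (simp add: field_simps)
    moreover have "(p (x + t *\<^sub>R (v + w)) - p x) / t \<le> \<dots>"
      using t le by (intro divide_right_mono diff_right_mono) auto
    ultimately show ?thesis by simp
  qed
  then show "\<forall>\<^sub>F t in at_right 0. (p (x + t *\<^sub>R (v + w)) - p x) / t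
    \<le> (p (x + (2 * t) *\<^sub>R v) - p x) / (2 * t) + (p (x + (2 * t) *\<^sub>R w) - p x) / (2 * t)"
    by (intro eventually_mono[OF eventually_at_right_less]) auto
qed

lemma directional_scale:
  assumes "c \<ge> 0"
  shows "directional x (c *\<^sub>R w) = c * directional x w"
proof (cases "c = 0")
  case True
  have "((\<lambda>t. (p (x + t *\<^sub>R 0) - p x) / t) \<longlongrightarrow> 0) (at_right 0)" by simp
  then have "directional x 0 = 0"
    using directional_limit[of x 0] tendsto_unique trivial_limit_at_right_real by blast
  then show ?thesis using True by simp
next
  case False
  then have c: "c > 0" using assms by simp
  have "LIM t at_right 0. c * t :> at_right (0::real)"
    using c by (intro filterlim_times_pos[of _ _ _ c]) (auto simp: filterlim_ident)
  from filterlim_compose[OF directional_limit[of x w] this]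
  have "((\<lambda>t. c * ((p (x + (c * t) *\<^sub>R w) - p x) / (c * t))) \<longlongrightarrow> c * directional x w) (at_right 0)"
    by (intro tendsto_mult_left)
  moreover have "(\<lambda>t. c * ((p (x + (c * t) *\<^sub>R w) - p x) / (c * t))) = (\<lambda>t. (p (x + t *\<^sub>R (c *\<^sub>R w)) - p x) / t)"
    using c by (auto simp: mult.commute)
  ultimately show ?thesis
    by (intro tendsto_unique[OF trivial_limit_at_right_real directional_limit]) simp
qed

lemma directional_linear:
  assumes two_sided: "\<And>k. k \<in> Basis \<Longrightarrow> directional x k + directional x (- k) = 0"
  shows "\<exists>u. \<forall>w. directional x w = u \<bullet> w"
proof -
  define u where "u = (\<Sum>k\<in>Basis. directional x k *\<^sub>R k)"
  have u: "u \<bullet> k = directional x k" if "k \<in> Basis" for k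
    using that by (simp add: u_def)
  have sum_le: "directional x (\<Sum>k\<in>S. f k) \<le> (\<Sum>k\<in>S. directional x (f k))" if "finite S" for S :: "'a set" and f
    using that
  proof (induction S)
    case empty
    then show ?case using directional_scale[of 0 x 0] by simp
  next
    case (insert k S)
    then show ?case using directional_add[of x "f k" "\<Sum>k\<in>S. f k"] by simp
  qed
  have le: "directional x w \<le> u \<bullet> w" for w
  proof -
    have coord: "directional x (c *\<^sub>R k) = c * directional x k" if k: "k \<in> Basis" for c k
    proof (cases "c \<ge> 0")
      case False
      have "directional x (c *\<^sub>R k) = directional x ((- c) *\<^sub>R (- k))" by simp
      also have "\<dots> = (- c) * directional x (- k)"
        using False by (intro directional_scale) auto
      also have "directional x (- k) = - directional x k" using two_sided[OF k] by simp
      finally show ?thesis by simp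
    qed (simp add: directional_scale)
    have "directional x w = directional x (\<Sum>k\<in>Basis. (w \<bullet> k) *\<^sub>R k)"
      by (simp add: euclidean_representation)
    also have "\<dots> \<le> (\<Sum>k\<in>Basis. directional x ((w \<bullet> k) *\<^sub>R k))"
      by (rule sum_le) simp
    also have "\<dots> = (\<Sum>k\<in>Basis. (w \<bullet> k) * (u \<bullet> k))"
      by (intro sum.cong refl) (simp add: coord u)
    also have "\<dots> = u \<bullet> w" by (subst euclidean_inner[of u w]) (simp add: mult.commute)
    finally show ?thesis .
  qed
  have "directional x w \<ge> u \<bullet> w" for w
    using le[of "- w"] directional_add[of x w "- w"] directional_scale[of 0 x 0] by simp
  then show ?thesis using le by (intro exI[of _ u]) (auto intro: antisym)
qed

end

lemma integrable_of_bounded_support: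
  fixes f :: "'a::euclidean_space \<Rightarrow> real"
  assumes "f \<in> borel_measurable borel" "\<And>x. \<bar>f x\<bar> \<le> B * indicator (cball 0 r) x"
  shows "integrable lborel f"
proof (rule Bochner_Integration.integrable_bound)
  show "integrable lborel (\<lambda>x. B * indicator (cball (0::'a) r) x)"
    using emeasure_bounded_finite[of "cball (0::'a) r"]
    by (intro integrable_mult_right integrable_real_indicator) auto
  show "AE x in lborel. norm (f x) \<le> norm (B * indicator (cball 0 r) x)"
    using assms(2) by (auto intro: order_trans[OF _ abs_ge_self])
qed (use assms(1) in simp)

lemma integral_lborel_translation:
  fixes f :: "'a::euclidean_space \<Rightarrow> real"
  assumes "f \<in> borel_measurable borel"
  shows "(LINT x|lborel. f (x + c)) = (LINT x|lborel. f x)"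
proof -
  have "(LINT x|lborel. f x) = (LINT x|distr lborel borel ((+) c). f x)"
    by (simp add: lborel_distr_plus)
  also have "\<dots> = (LINT x|lborel. f (c + x))"
    using assms by (subst integral_distr) auto
  finally show ?thesis by (simp add: add.commute)
qed

context gauge_body
begin

text \<open>Discrete integration by parts: the integral of the second difference of \<open>p\<close> against a
  Lipschitz cut-off is of second order, so the nonnegative limit of the second difference
  quotients vanishes almost everywhere.\<close>

lemma AE_directional_two_sided: "AE x in lborel. directional x k + directional x (- k) = 0"
proof -
  obtain a where a: "a > 0" "\<And>x y. \<bar>p x - p y\<bar> \<le> a * norm (x - y)" using gauge_lipschitz by metis
  obtain b where b: "b > 0" "\<And>x. norm x \<le> b * p x" using gauge_bounds by metis
  define C where "C = a * norm k"
  define t where "t m = 1 / real (Suc m)" for m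
  have t: "t m > 0" "t m \<le> 1" for m by (auto simp: t_def)
  have t0: "t \<longlonglongrightarrow> 0" unfolding t_def by (rule LIMSEQ_Suc[OF lim_1_over_n])
  have tr: "filterlim t (at_right 0) sequentially"
    using t0 t by (intro tendsto_imp_filterlim_at_right) auto
  have C: "C \<ge> 0" using a by (simp add: C_def)
  have lip: "\<bar>p (x + t m *\<^sub>R k) - p x\<bar> \<le> C * t m" "\<bar>p (x - t m *\<^sub>R k) - p x\<bar> \<le> C * t m" for x m
    using a(2)[of "x + t m *\<^sub>R k" x] a(2)[of "x - t m *\<^sub>R k" x] t[of m] by (simp_all add: C_def mult_ac)
  have zero: "AE x in lborel. (directional x k + directional x (- k)) * max 0 (R - p x) = 0" if R: "R > 0" for R
  proof -
    define \<phi> where "\<phi> x = max 0 (R - p x)" for x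
    have \<phi>: "0 \<le> \<phi> x" "\<phi> x \<le> R" for x using gauge_nonneg[of x] R by (auto simp: \<phi>_def)
    have \<phi>0: "\<phi> x = 0" if "norm x > b * R" for x
    proof -
      have "b * R < b * p x" using b(2)[of x] that by simp
      then show ?thesis using b(1) by (simp add: \<phi>_def)
    qed
    have \<phi>lip: "\<bar>\<phi> x - \<phi> y\<bar> \<le> \<bar>p x - p y\<bar>" for x y by (auto simp: \<phi>_def)
    have [measurable]: "\<phi> \<in> borel_measurable borel" unfolding \<phi>_def by measurable
    define g where "g m x = (p (x + t m *\<^sub>R k) - p x) / t m * \<phi> x + (p (x + t m *\<^sub>R (- k)) - p x) / t m * \<phi> x" for m x
    have part: "\<bar>(p (x + s *\<^sub>R t m *\<^sub>R k) - p x) / t m * \<phi> x\<bar> \<le> C * R * indicator (cball 0 (b * R)) x"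
      if "s = 1 \<or> s = -1" for s m x
    proof (cases "norm x > b * R")
      case False
      have "\<bar>(p (x + s *\<^sub>R t m *\<^sub>R k) - p x) / t m\<bar> \<le> C"
        using lip[of x m] t[of m] that by (auto simp: abs_divide pos_divide_le_eq)
      then have "\<bar>(p (x + s *\<^sub>R t m *\<^sub>R k) - p x) / t m * \<phi> x\<bar> \<le> C * R"
        using \<phi>[of x] C unfolding abs_mult by (intro mult_mono) auto
      then show ?thesis using False by simp
    qed (simp add: \<phi>0)
    have part1: "\<bar>(p (x + t m *\<^sub>R k) - p x) / t m * \<phi> x\<bar> \<le> C * R * indicator (cball 0 (b * R)) x" for m x
      using part[of 1 x m] by simp
    have part2: "\<bar>(p (x - t m *\<^sub>R k) - p x) / t m * \<phi> x\<bar> \<le> C * R * indicator (cball 0 (b * R)) x" for m x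
      using part[of "-1" x m] by simp
    have int1: "integrable lborel (\<lambda>x. (p (x + t m *\<^sub>R k) - p x) / t m * \<phi> x)" for m
      by (rule integrable_of_bounded_support[OF _ part1]) measurable
    have int2: "integrable lborel (\<lambda>x. (p (x - t m *\<^sub>R k) - p x) / t m * \<phi> x)" for m
      by (rule integrable_of_bounded_support[OF _ part2]) measurable
    let ?G = "\<lambda>x. (directional x k + directional x (- k)) * \<phi> x"
    have lim: "(\<lambda>m. g m x) \<longlonglongrightarrow> ?G x" for x
    proof -
      have "(\<lambda>m. (p (x + t m *\<^sub>R w) - p x) / t m) \<longlonglongrightarrow> directional x w" for w
        by (rule filterlim_compose[OF directional_limit tr])
      then have "(\<lambda>m. g m x) \<longlonglongrightarrow> directional x k * \<phi> x + directional x (- k) * \<phi> x"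
        unfolding g_def by (intro tendsto_intros)
      then show ?thesis by (simp add: algebra_simps)
    qed
    have gm: "g m \<in> borel_measurable lborel" for m unfolding g_def by measurable
    have Gm: "?G \<in> borel_measurable lborel"
      by (rule borel_measurable_LIMSEQ_metric[of g]) (use gm lim in auto)
    have gb: "norm (g m x) \<le> 2 * (C * R * indicator (cball 0 (b * R)) x)" for m x
    proof -
      have "norm (g m x) \<le> \<bar>(p (x + t m *\<^sub>R k) - p x) / t m * \<phi> x\<bar> + \<bar>(p (x - t m *\<^sub>R k) - p x) / t m * \<phi> x\<bar>"
        unfolding g_def real_norm_def scaleR_minus_right add_uminus_conv_diff by (rule abs_triangle_ineq)
      also have "\<dots> \<le> C * R * indicator (cball 0 (b * R)) x + C * R * indicator (cball 0 (b * R)) x"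
        by (intro add_mono part1 part2)
      finally show ?thesis by simp
    qed
    have ib: "integrable lborel (\<lambda>x. 2 * (C * R * indicat_real (cball (0::'a) (b * R)) x))"
      by (intro integrable_mult_right integrable_real_indicator)
         (use emeasure_bounded_finite[of "cball (0::'a) (b * R)"] in auto)
    have intG: "integrable lborel ?G"
      by (rule integrable_dominated_convergence[where s = g, OF Gm gm ib]) (use lim gb in auto)
    have conv: "(\<lambda>m. LINT x|lborel. g m x) \<longlonglongrightarrow> (LINT x|lborel. ?G x)"
      by (rule integral_dominated_convergence[where s = g, OF Gm gm ib]) (use lim gb in auto)
    define V where "V = measure lborel (cball (0::'a) (b * R + norm k))"
    have small: "\<bar>LINT x|lborel. g m x\<bar> \<le> C * C * V * t m" for m
    proof -
      let ?h = "\<lambda>x. (p (x + t m *\<^sub>R k) - p x) / t m"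
      have eq2: "(LINT x|lborel. (p (x - t m *\<^sub>R k) - p x) / t m * \<phi> x) = (LINT x|lborel. - (?h x * \<phi> (x + t m *\<^sub>R k)))"
        by (subst integral_lborel_translation[of _ "t m *\<^sub>R k", symmetric])
           (auto intro!: Bochner_Integration.integral_cong simp: minus_divide_left algebra_simps)
      have int3: "integrable lborel (\<lambda>x. ?h x * \<phi> (x + t m *\<^sub>R k))"
      proof (rule integrable_of_bounded_support[where B = "C * R" and r = "b * R + norm k"])
        fix x
        show "\<bar>?h x * \<phi> (x + t m *\<^sub>R k)\<bar> \<le> C * R * indicator (cball 0 (b * R + norm k)) x"
        proof (cases "norm x > b * R + norm k")
          case True
          have "norm (t m *\<^sub>R k) \<le> norm k" using t[of m] by (simp add: mult_left_le_one_le)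
          then have "norm (x + t m *\<^sub>R k) > b * R" using True norm_diff_ineq[of x "t m *\<^sub>R k"] by linarith
          then show ?thesis using C R by (simp add: \<phi>0)
        next
          case False
          have "\<bar>?h x\<bar> \<le> C" using lip[of x m] t[of m] by (auto simp: abs_divide pos_divide_le_eq)
          then have "\<bar>?h x * \<phi> (x + t m *\<^sub>R k)\<bar> \<le> C * R"
            using \<phi>[of "x + t m *\<^sub>R k"] C unfolding abs_mult by (intro mult_mono) auto
          then show ?thesis using False by simp
        qed
      qed measurable
      have "(LINT x|lborel. g m x) = (LINT x|lborel. ?h x * \<phi> x) - (LINT x|lborel. ?h x * \<phi> (x + t m *\<^sub>R k))"
        using int1[of m] int2[of m] eq2 by (simp add: g_def)
      also have "\<dots> = (LINT x|lborel. ?h x * (\<phi> x - \<phi> (x + t m *\<^sub>R k)))"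
        unfolding right_diff_distrib by (rule Bochner_Integration.integral_diff[OF int1[of m] int3, symmetric])
      finally have eq: "(LINT x|lborel. g m x) = (LINT x|lborel. ?h x * (\<phi> x - \<phi> (x + t m *\<^sub>R k)))" .
      have pt: "norm (?h x * (\<phi> x - \<phi> (x + t m *\<^sub>R k))) \<le> C * (C * t m) * indicator (cball 0 (b * R + norm k)) x" for x
      proof (cases "norm x > b * R + norm k")
        case True
        have "norm (t m *\<^sub>R k) \<le> norm k" using t[of m] by (simp add: mult_left_le_one_le)
        then have "norm (x + t m *\<^sub>R k) > b * R" using True norm_diff_ineq[of x "t m *\<^sub>R k"] by linarith
        moreover have "norm x > b * R" using True norm_ge_zero[of k] by linarith
        ultimately show ?thesis using C t[of m] by (simp add: \<phi>0)
      next
        case False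
        have "\<bar>?h x\<bar> \<le> C" using lip[of x m] t[of m] by (auto simp: abs_divide pos_divide_le_eq)
        moreover have "\<bar>\<phi> x - \<phi> (x + t m *\<^sub>R k)\<bar> \<le> C * t m"
          using \<phi>lip[of x "x + t m *\<^sub>R k"] lip(1)[of x m] by linarith
        ultimately have "norm (?h x * (\<phi> x - \<phi> (x + t m *\<^sub>R k))) \<le> C * (C * t m)"
          using C unfolding real_norm_def abs_mult by (intro mult_mono) auto
        then show ?thesis using False by simp
      qed
      have "norm (LINT x|lborel. ?h x * (\<phi> x - \<phi> (x + t m *\<^sub>R k)))
        \<le> (LINT x|lborel. norm (?h x * (\<phi> x - \<phi> (x + t m *\<^sub>R k))))"
        by (rule integral_norm_bound)
      also have "\<dots> \<le> (LINT x|lborel. C * (C * t m) * indicator (cball (0::'a) (b * R + norm k)) x)"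
      proof (rule Bochner_Integration.integral_mono)
        show "integrable lborel (\<lambda>x. norm (?h x * (\<phi> x - \<phi> (x + t m *\<^sub>R k))))"
          unfolding right_diff_distrib
          by (intro integrable_norm Bochner_Integration.integrable_diff[OF int1[of m] int3])
        show "integrable lborel (\<lambda>x. C * (C * t m) * indicat_real (cball (0::'a) (b * R + norm k)) x)"
          by (intro integrable_mult_right integrable_real_indicator)
             (use emeasure_bounded_finite[of "cball (0::'a) (b * R + norm k)"] in auto)
        show "norm (?h x * (\<phi> x - \<phi> (x + t m *\<^sub>R k))) \<le> C * (C * t m) * indicator (cball 0 (b * R + norm k)) x" for x
          by (rule pt)
      qed
      also have "\<dots> = C * C * V * t m" by (simp add: V_def)
      finally show ?thesis using eq by simp
    qed
    have "(\<lambda>m. LINT x|lborel. g m x) \<longlonglongrightarrow> 0"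
    proof (rule Lim_null_comparison)
      show "\<forall>\<^sub>F m in sequentially. norm (LINT x|lborel. g m x) \<le> C * C * V * t m" using small by simp
      show "(\<lambda>m. C * C * V * t m) \<longlonglongrightarrow> 0" using tendsto_mult_right_zero[OF t0] by simp
    qed
    then have "(LINT x|lborel. ?G x) = 0" using conv LIMSEQ_unique by blast
    moreover have "?G x \<ge> 0" for x
      using directional_add[of x k "- k"] directional_scale[of 0 x 0] \<phi>[of x] by simp
    ultimately have "AE x in lborel. ?G x = 0"
      using integral_nonneg_eq_0_iff_AE[OF intG] by simp
    then show ?thesis by (simp add: \<phi>_def)
  qed
  have "AE x in lborel. \<forall>N. (directional x k + directional x (- k)) * max 0 (real (Suc N) - p x) = 0"
    unfolding AE_all_countable using zero by simp
  then show ?thesis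
  proof (rule AE_mp, intro AE_I2 impI)
    fix x assume all: "\<forall>N. (directional x k + directional x (- k)) * max 0 (real (Suc N) - p x) = 0"
    obtain N where "p x < real N" using reals_Archimedean2 by blast
    then have "max 0 (real (Suc N) - p x) > 0" by simp
    then show "directional x k + directional x (- k) = 0"
      using all by (metis less_irrefl mult_eq_0_iff)
  qed
qed

lemma gauge_integral: "(LINT x|lborel. max 0 (1 - p x)) = measure lebesgue M / real (Suc DIM('a))"
proof -
  obtain b where b: "b > 0" "\<And>x. norm x \<le> b * p x" using gauge_bounds by metis
  have slice: "emeasure lborel {x. p x \<le> s} = ennreal (s ^ DIM('a) * measure lebesgue M)" if s: "0 \<le> s" for s
  proof (cases "s = 0")
    case True
    have "{x. p x \<le> 0} \<subseteq> {0}"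
      using b by (auto simp: order_trans[OF b(2)] mult_nonneg_nonpos) (metis b(2) gauge_nonneg antisym mult_zero_right norm_le_zero_iff)
    then have "emeasure lborel {x. p x \<le> 0} \<le> emeasure lborel {0::'a}" by (rule emeasure_mono) simp
    then show ?thesis using True by simp
  next
    case False
    then have "s > 0" using s by simp
    then have "{x. p x \<le> s} = (*\<^sub>R) s ` M" using gauge_le_iff by blast
    moreover have "compact ((*\<^sub>R) s ` M)" by (rule compact_scaling[OF compact])
    ultimately show ?thesis
      using measure_scaleR[of s M] s emeasure_compact_finite[of "(*\<^sub>R) s ` M"]
      by (simp add: emeasure_eq_ennreal_measure borel_compact)
  qed
  have "(\<integral>\<^sup>+ x. ennreal (max 0 (1 - p x)) \<partial>lborel) = (\<integral>\<^sup>+ x. (\<integral>\<^sup>+ s. indicator {s. p x \<le> s \<and> s \<le> 1} s \<partial>lborel) \<partial>lborel)"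
  proof (intro nn_integral_cong)
    fix x
    have "{s. p x \<le> s \<and> s \<le> 1} = {p x..1}" by auto
    then show "ennreal (max 0 (1 - p x)) = (\<integral>\<^sup>+ s. indicator {s. p x \<le> s \<and> s \<le> 1} s \<partial>lborel)"
      by (simp add: emeasure_lborel_Icc_eq max_def)
  qed
  also have "\<dots> = (\<integral>\<^sup>+ s. (\<integral>\<^sup>+ x. indicator {s. p x \<le> s \<and> s \<le> 1} s \<partial>lborel) \<partial>lborel)"
    by (rule lborel_pair.Fubini'[symmetric]) measurable
  also have "\<dots> = (\<integral>\<^sup>+ s. ennreal (s ^ DIM('a) * indicator {0..1} s * measure lebesgue M) \<partial>lborel)"
  proof (intro nn_integral_cong)
    fix s :: real
    have "(\<integral>\<^sup>+ x. indicator {s. p x \<le> s \<and> s \<le> 1} s \<partial>lborel) = (\<integral>\<^sup>+ x. indicator {x. p x \<le> s \<and> s \<le> 1} x \<partial>lborel)"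
      by (intro nn_integral_cong) (auto simp: indicator_def)
    also have "\<dots> = emeasure lborel {x. p x \<le> s \<and> s \<le> 1}"
      by (rule nn_integral_indicator) measurable
    also have "\<dots> = ennreal (s ^ DIM('a) * indicator {0..1} s * measure lebesgue M)"
    proof (cases "s \<in> {0..1}")
      case False
      then have empty: "{x. p x \<le> s \<and> s \<le> 1} = {}" using gauge_nonneg by (auto intro: order_trans)
      show ?thesis unfolding empty using False by simp
    qed (use slice in auto)
    finally show "(\<integral>\<^sup>+ x. indicator {s. p x \<le> s \<and> s \<le> 1} s \<partial>lborel) = ennreal (s ^ DIM('a) * indicator {0..1} s * measure lebesgue M)" .
  qed
  also have "\<dots> = ennreal (LINT s|lborel. s ^ DIM('a) * indicator {0..1} s * measure lebesgue M)"
  proof (intro nn_integral_eq_integral integrable_mult_left integrable_of_bounded_support)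
    show "\<bar>s ^ DIM('a) * indicator {0..1} s\<bar> \<le> 1 * indicator (cball 0 1) s" for s :: real
      by (auto simp: indicator_def abs_mult power_le_one)
  qed (auto simp: indicator_def)
  also have "(LINT s|lborel. s ^ DIM('a) * indicator {0..1} s * measure lebesgue M) = measure lebesgue M / real (Suc DIM('a))"
    using integral_power[of 0 1 "DIM('a)"] by simp
  finally have "(\<integral>\<^sup>+ x. ennreal (max 0 (1 - p x)) \<partial>lborel) = ennreal (measure lebesgue M / real (Suc DIM('a)))" .
  then show ?thesis
    by (subst integral_eq_nn_integral) auto
qed

end

lemma (in gauge_body) gauge_antimono:
  assumes "M \<subseteq> N" "compact N" "convex N"
  shows "minkowski_gauge N x \<le> p x"
proof -
  have "0 \<in> interior N" using interior interior_mono[OF assms(1)] by blast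
  then interpret N: gauge_body N
    using assms(2,3) by unfold_locales
  show ?thesis
  proof (rule field_le_epsilon)
    fix e :: real assume e: "e > 0"
    have pos: "p x + e > 0" using gauge_nonneg[of x] e by simp
    then have "x \<in> (*\<^sub>R) (p x + e) ` M" using e by (simp add: gauge_le_iff[symmetric])
    then have "x \<in> (*\<^sub>R) (p x + e) ` N" using assms(1) by blast
    then show "minkowski_gauge N x \<le> p x + e" using pos by (simp add: N.gauge_le_iff)
  qed
qed

lemma (in gauge_body) gauge_pos: "x \<noteq> 0 \<Longrightarrow> p x > 0"
proof -
  obtain b where b: "b > 0" "\<And>x. norm x \<le> b * p x" using gauge_bounds by metis
  assume "x \<noteq> 0"
  then have "0 < b * p x" using b(2)[of x] by (metis less_le_trans zero_less_norm_iff)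
  then show ?thesis using b(1) by (simp add: zero_less_mult_iff)
qed

text \<open>A translate \<open>x + \<delta> E\<close> with \<open>x\<close> on the boundary of the erosion \<open>M\<close> touches the boundary of
  \<open>L\<close>; a supporting functional \<open>v\<close> of \<open>L\<close> at the contact point supports \<open>M\<close> at \<open>x\<close>.\<close>

lemma (in gauge_body) contact:
  fixes L E :: "'a set"
  assumes L: "convex L" and E: "compact E" "0 \<in> E"
    and M: "M = erosion L \<delta> E" and x: "x \<noteq> 0"
  shows "\<exists>v. \<exists>c\<in>M + (*\<^sub>R) \<delta> ` E. (\<forall>y. v \<bullet> y \<le> p y) \<and> v \<bullet> x = p x \<and> (\<forall>z\<in>L. v \<bullet> z \<le> v \<bullet> c)"
proof -
  have memM: "y \<in> M \<longleftrightarrow> (\<forall>e\<in>E. y + \<delta> *\<^sub>R e \<in> L)" for y by (subst M) (rule mem_erosion)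
  have px: "p x > 0" by (rule gauge_pos[OF x])
  define x0 where "x0 = (1 / p x) *\<^sub>R x"
  have px0: "p x0 = 1" using px by (simp add: x0_def gauge_scale)
  have x0: "x0 \<noteq> 0" using px x by (simp add: x0_def)
  have x0M: "x0 \<in> M"
    using gauge_le_iff[of 1 x0] px0 by simp
  have sub_L: "M \<subseteq> L" using memM E(2) by force
  have "x0 \<notin> interior M"
  proof
    assume "x0 \<in> interior M"
    then obtain r where r: "r > 0" "cball x0 r \<subseteq> M" by (auto simp: mem_interior_cball)
    define s where "s = 1 + r / norm x0"
    have "dist x0 (s *\<^sub>R x0) = r"
      using r(1) x0 by (simp add: s_def dist_norm scaleR_add_left)
    then have "s *\<^sub>R x0 \<in> M" using r by (intro subsetD[OF r(2)]) simp
    then have "p (s *\<^sub>R x0) \<le> 1" using gauge_le_iff[of 1] by simp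
    moreover have "s > 1" using r(1) x0 by (simp add: s_def)
    ultimately show False using px0 by (simp add: gauge_scale)
  qed
  then obtain e where e: "e \<in> E" "x0 + \<delta> *\<^sub>R e \<notin> interior L"
    using interior_erosion[OF E(1), of x0 \<delta> L, folded M] by blast
  let ?y = "x0 + \<delta> *\<^sub>R e"
  have yL: "?y \<in> L" using x0M memM e(1) by blast
  have iL: "interior L \<noteq> {}" using interior interior_mono[OF sub_L] by blast
  obtain w where w: "w \<noteq> 0" "\<And>z. z \<in> L \<Longrightarrow> w \<bullet> z \<le> w \<bullet> ?y"
    using supporting_functional[OF L iL yL e(2)] by blast
  have wM: "w \<bullet> m \<le> w \<bullet> x0" if "m \<in> M" for m
    using w(2)[of "m + \<delta> *\<^sub>R e"] memM that e(1) by (simp add: inner_add_right)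
  obtain r where r: "r > 0" "cball 0 r \<subseteq> M" using interior by (auto simp: mem_interior_cball)
  have "(r / norm w) *\<^sub>R w \<in> M" using r w(1) by (intro subsetD[OF r(2)]) simp
  then have "w \<bullet> ((r / norm w) *\<^sub>R w) \<le> w \<bullet> x0" by (rule wM)
  moreover have "w \<bullet> ((r / norm w) *\<^sub>R w) > 0" using r w(1) by simp
  ultimately have k: "w \<bullet> x0 > 0" by linarith
  define v where "v = (1 / (w \<bullet> x0)) *\<^sub>R w"
  have vM: "v \<bullet> m \<le> 1" if "m \<in> M" for m using wM[OF that] k by (simp add: v_def)
  have vx0: "v \<bullet> x0 = 1" using k by (simp add: v_def)
  have vL: "v \<bullet> z \<le> v \<bullet> ?y" if "z \<in> L" for z
    using w(2)[OF that] k by (simp add: v_def divide_right_mono)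
  have vp: "v \<bullet> y \<le> p y" for y
  proof (rule field_le_epsilon)
    fix d :: real assume d: "d > 0"
    have pos: "p y + d > 0" using gauge_nonneg[of y] d by simp
    then have "y \<in> (*\<^sub>R) (p y + d) ` M" using d by (simp add: gauge_le_iff[symmetric])
    then obtain m where m: "m \<in> M" "y = (p y + d) *\<^sub>R m" by blast
    have "v \<bullet> y = (p y + d) * (v \<bullet> m)" by (subst m(2)) simp
    also have "\<dots> \<le> (p y + d) * 1" using pos vM[OF m(1)] by (intro mult_left_mono) auto
    finally show "v \<bullet> y \<le> p y + d" by simp
  qed
  have "v \<bullet> x = p x" using vx0 px by (simp add: x0_def field_simps)
  moreover have "?y \<in> M + (*\<^sub>R) \<delta> ` E" using x0M e(1) by (intro set_plus_intro) auto
  ultimately show ?thesis using vp vL by (intro exI[of _ v] bexI[of _ ?y]) auto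
qed

text \<open>By the integral formula for the gauge it suffices to compare the gauges of \<open>M + t L\<close> and
  \<open>M + t C\<close>. Where the gauge of \<open>M\<close> is differentiable, its gradient is the supporting functional
  at the contact point, which lies in \<open>C\<close>; hence the two gauges differ by \<open>o(t)\<close> there.\<close>

lemma (in gauge_body) first_variation:
  fixes L E :: "'a set" and t :: "nat \<Rightarrow> real"
  assumes L: "compact L" "convex L" and E: "compact E" "convex E" "0 \<in> E"
    and M: "M = erosion L \<delta> E"
    and t: "\<And>m. 0 < t m" "\<And>m. t m \<le> 1" "t \<longlonglongrightarrow> 0"
  defines "C \<equiv> M + (*\<^sub>R) \<delta> ` E"
  shows "(\<lambda>m. (measure lebesgue (M + (*\<^sub>R) (t m) ` L) - measure lebesgue (M + (*\<^sub>R) (t m) ` C)) / t m) \<longlonglongrightarrow> 0"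
proof -
  have M0: "0 \<in> M" using interior interior_subset by blast
  have CL: "C \<subseteq> L" using erosion_sum_subset[of L \<delta> E, folded M] by (simp add: C_def)
  have C: "compact C" "convex C"
    unfolding C_def using compact convex E by (auto intro!: compact_set_plus convex_set_plus compact_scaling convex_scaling)
  have "0 + \<delta> *\<^sub>R 0 \<in> C" unfolding C_def by (intro set_plus_intro imageI M0 E(3))
  then have C0: "0 \<in> C" by simp
  have L0: "0 \<in> L" using C0 CL by blast
  have tr: "filterlim t (at_right 0) sequentially"
    using t by (intro tendsto_imp_filterlim_at_right) auto
  define A where "A m = M + (*\<^sub>R) (t m) ` L" for m
  define B where "B m = M + (*\<^sub>R) (t m) ` C" for m
  have cc: "compact (A m)" "convex (A m)" "compact (B m)" "convex (B m)" for m
    unfolding A_def B_def using compact convex L C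
    by (auto intro!: compact_set_plus convex_set_plus compact_scaling convex_scaling)
  have MB: "M \<subseteq> B m" for m
  proof
    fix x assume "x \<in> M"
    then have "x + t m *\<^sub>R 0 \<in> B m" unfolding B_def using C0 by (intro set_plus_intro) auto
    then show "x \<in> B m" by simp
  qed
  have BA: "B m \<subseteq> A m" for m
    unfolding A_def B_def by (intro set_plus_mono2 image_mono CL order_refl)
  have gA: "gauge_body (A m)" and gB: "gauge_body (B m)" for m
    using cc interior interior_mono[OF MB] interior_mono[OF BA] by (unfold_locales; blast)+
  let ?a = "\<lambda>m. minkowski_gauge (A m)" and ?b = "\<lambda>m. minkowski_gauge (B m)"
  have ab: "?a m x \<le> ?b m x" for m x
    by (rule gauge_body.gauge_antimono[OF gB BA cc(1,2)])
  have bp: "?b m x \<le> p x" for m x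
    by (rule gauge_antimono[OF MB cc(3,4)])
  obtain b where b: "b > 0" "\<And>x. norm x \<le> b * p x" using gauge_bounds by metis
  obtain b' where b': "b' > 0" "\<And>x. p x \<le> b' * norm x" using gauge_bounds by metis
  obtain RL where RL: "RL > 0" "\<And>x. x \<in> L \<Longrightarrow> norm x \<le> RL"
    using compact_imp_bounded[OF L(1)] by (auto simp: bounded_pos)
  define \<kappa> where "\<kappa> = b' * RL"
  have \<kappa>: "\<kappa> > 0" using b' RL by (simp add: \<kappa>_def)
  have pL: "p z \<le> \<kappa>" if "z \<in> L" for z
    using b'(2)[of z] RL(2)[OF that] b'(1) by (auto simp: \<kappa>_def intro: order_trans mult_left_mono)
  have pa: "p x \<le> (1 + t m * \<kappa>) * ?a m x" for m x
  proof (rule field_le_epsilon)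
    interpret A: gauge_body "A m" by (rule gA)
    fix d :: real assume d: "d > 0"
    have tk: "1 + t m * \<kappa> > 0" using t(1)[of m] \<kappa> by (simp add: add_pos_pos)
    define s where "s = ?a m x + d / (1 + t m * \<kappa>)"
    have s: "s > 0" using A.gauge_nonneg[of x] d tk by (simp add: s_def add_nonneg_pos)
    have "x \<in> (*\<^sub>R) s ` A m" using A.gauge_le_iff[OF s, of x] d tk by (simp add: s_def)
    then obtain y z where yz: "y \<in> M" "z \<in> L" "x = s *\<^sub>R (y + t m *\<^sub>R z)"
      unfolding A_def by (auto elim!: set_plus_elim)
    have "p (y + t m *\<^sub>R z) \<le> p y + p (t m *\<^sub>R z)" by (rule gauge_triangle)
    also have "p (t m *\<^sub>R z) = t m * p z" using t(1)[of m] by (simp add: gauge_scale)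
    also have "p y + t m * p z \<le> 1 + t m * \<kappa>"
      using yz pL gauge_le_iff[of 1 y] t(1)[of m] by (intro add_mono mult_left_mono) auto
    finally have "p x \<le> s * (1 + t m * \<kappa>)" using s by (simp add: yz(3) gauge_scale mult_left_mono)
    also have "\<dots> = (1 + t m * \<kappa>) * ?a m x + d" using tk by (simp add: s_def field_simps)
    finally show "p x \<le> (1 + t m * \<kappa>) * ?a m x + d" .
  qed
  define D where "D m x = (max 0 (1 - ?a m x) - max 0 (1 - ?b m x)) / t m" for m x
  have D0: "0 \<le> D m x" for m x using ab[of m x] t(1)[of m] by (auto simp: D_def)
  have Dle: "D m x \<le> (?b m x - ?a m x) / t m" for m x
    unfolding D_def using ab[of m x] t(1)[of m] by (intro divide_right_mono) auto
  define R where "R = b * (1 + \<kappa>)"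
  have Db: "D m x \<le> \<kappa> * indicator (cball 0 R) x" for m x
  proof (cases "?a m x < 1")
    case False
    then have "D m x = 0" using ab[of m x] by (simp add: D_def)
    then show ?thesis using \<kappa> by simp
  next
    case True
    interpret A: gauge_body "A m" by (rule gA)
    have "t m * \<kappa> \<le> \<kappa>" using t(1)[of m] t(2)[of m] \<kappa> by (simp add: mult_left_le_one_le)
    then have "p x \<le> (1 + \<kappa>) * ?a m x"
      using pa[of x m] A.gauge_nonneg[of x] by (smt (verit) mult_right_mono)
    also have "\<dots> \<le> (1 + \<kappa>) * 1" using True \<kappa> by (intro mult_left_mono) auto
    finally have "b * p x \<le> R" using b(1) by (simp add: R_def)
    then have "norm x \<le> R" using b(2)[of x] by simp
    moreover have "D m x \<le> \<kappa>"
    proof -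
      have "?b m x - ?a m x \<le> t m * \<kappa> * ?a m x" using bp[of m x] pa[of x m] by (simp add: algebra_simps)
      also have "\<dots> \<le> t m * \<kappa> * 1" using True t(1)[of m] \<kappa> by (intro mult_left_mono) auto
      finally have "(?b m x - ?a m x) / t m \<le> \<kappa>" using t(1)[of m] by (simp add: pos_divide_le_eq mult.commute)
      then show ?thesis using Dle[of m x] by simp
    qed
    ultimately show ?thesis by simp
  qed
  have lim: "(\<lambda>m. D m x) \<longlonglongrightarrow> 0" if x: "x \<noteq> 0" and two: "\<forall>k\<in>Basis. directional x k + directional x (- k) = 0" for x
  proof -
    obtain u where u: "\<And>w. directional x w = u \<bullet> w" using directional_linear two by metis
    obtain v c where vc: "c \<in> C" "\<And>y. v \<bullet> y \<le> p y" "v \<bullet> x = p x" "\<And>z. z \<in> L \<Longrightarrow> v \<bullet> z \<le> v \<bullet> c"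
      using contact[OF L(2) E(1,3) M x] unfolding C_def by metis
    have "v \<bullet> w \<le> u \<bullet> w" for w
    proof (rule tendsto_le[OF trivial_limit_at_right_real directional_limit[of x w, unfolded u] tendsto_const])
      show "\<forall>\<^sub>F s in at_right 0. v \<bullet> w \<le> (p (x + s *\<^sub>R w) - p x) / s"
      proof (rule eventually_mono[OF eventually_at_right_less])
        fix s :: real assume s: "0 < s"
        have "v \<bullet> (x + s *\<^sub>R w) \<le> p (x + s *\<^sub>R w)" by (rule vc(2))
        then show "v \<bullet> w \<le> (p (x + s *\<^sub>R w) - p x) / s"
          using s vc(3) by (simp add: inner_add_right pos_le_divide_eq mult.commute)
      qed
    qed
    from this[of "v - u"] have "(v - u) \<bullet> (v - u) \<le> 0" by (simp add: inner_diff_left)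
    then have "(v - u) \<bullet> (v - u) = 0" using inner_ge_zero[of "v - u"] by linarith
    then have uv: "u = v" unfolding inner_eq_zero_iff by simp
    define h where "h = v \<bullet> c"
    have h: "h \<ge> 0" using vc(4)[OF L0] by (simp add: h_def)
    define w where "w = h *\<^sub>R x - p x *\<^sub>R c"
    have w0: "v \<bullet> w = 0" by (simp add: w_def h_def inner_diff_right vc(3))
    define q where "q m = p (x + t m *\<^sub>R w)" for m
    have px: "p x > 0" by (rule gauge_pos[OF x])
    have pq: "p x \<le> q m" for m using vc(2)[of "x + t m *\<^sub>R w"] w0 by (simp add: q_def inner_add_right vc(3))
    have th: "1 + t m * h > 0" for m using t(1)[of m] h by (simp add: add_pos_nonneg)
    have low: "p x \<le> (1 + t m * h) * ?a m x" for m
    proof (rule field_le_epsilon)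
      interpret A: gauge_body "A m" by (rule gA)
      fix d :: real assume d: "d > 0"
      define s where "s = ?a m x + d / (1 + t m * h)"
      have s: "s > 0" using A.gauge_nonneg[of x] d th[of m] by (simp add: s_def add_nonneg_pos)
      have "x \<in> (*\<^sub>R) s ` A m" using A.gauge_le_iff[OF s, of x] d th[of m] by (simp add: s_def)
      then obtain y z where yz: "y \<in> M" "z \<in> L" "x = s *\<^sub>R (y + t m *\<^sub>R z)"
        unfolding A_def by (auto elim!: set_plus_elim)
      have "v \<bullet> (y + t m *\<^sub>R z) = v \<bullet> y + t m * (v \<bullet> z)" by (simp add: inner_add_right)
      also have "\<dots> \<le> 1 + t m * h"
        using vc(2)[of y] gauge_le_iff[of 1 y] yz vc(4)[OF yz(2)] t(1)[of m]
        by (intro add_mono mult_left_mono) (auto simp: h_def)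
      finally have "v \<bullet> x \<le> s * (1 + t m * h)" using s by (simp add: yz(3) mult_left_mono)
      also have "\<dots> = (1 + t m * h) * ?a m x + d" using th[of m] by (simp add: s_def field_simps)
      finally show "p x \<le> (1 + t m * h) * ?a m x + d" by (simp add: vc(3))
    qed
    have up: "(1 + t m * h) * ?b m x \<le> q m" for m
    proof -
      interpret B: gauge_body "B m" by (rule gB)
      have qpos: "q m > 0" using px pq[of m] by simp
      obtain y where y: "y \<in> M" "x + t m *\<^sub>R w = q m *\<^sub>R y"
        using gauge_le_iff[OF qpos, of "x + t m *\<^sub>R w"] by (auto simp: q_def)
      have cC: "(p x / q m) *\<^sub>R c \<in> C"
      proof -
        have "(p x / q m) *\<^sub>R c + (1 - p x / q m) *\<^sub>R 0 \<in> C"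
          using px pq[of m] qpos by (intro convexD[OF C(2) vc(1) C0]) auto
        then show ?thesis by simp
      qed
      have "(1 + t m * h) *\<^sub>R x = (x + t m *\<^sub>R w) + (t m * p x) *\<^sub>R c"
        by (simp add: w_def algebra_simps)
      also have "\<dots> = q m *\<^sub>R (y + t m *\<^sub>R ((p x / q m) *\<^sub>R c))"
        using qpos by (simp add: y(2) scaleR_add_right)
      finally have eq: "(1 + t m * h) *\<^sub>R x = q m *\<^sub>R (y + t m *\<^sub>R ((p x / q m) *\<^sub>R c))" .
      have "(1 + t m * h) *\<^sub>R x \<in> (*\<^sub>R) (q m) ` B m"
        unfolding eq B_def by (intro imageI set_plus_intro y(1) cC)
      then have "?b m ((1 + t m * h) *\<^sub>R x) \<le> q m" using B.gauge_le_iff[OF qpos] by simp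
      then show ?thesis using th[of m] by (simp add: B.gauge_scale)
    qed
    have Dq: "D m x \<le> (q m - p x) / t m" for m
    proof -
      have "?b m x - ?a m x \<le> (1 + t m * h) * (?b m x - ?a m x)"
        using ab[of m x] t(1)[of m] h mult_right_mono[of 1 "1 + t m * h" "?b m x - ?a m x"] by simp
      also have "\<dots> \<le> q m - p x" using up[of m] low[of m] by (simp add: right_diff_distrib)
      finally show ?thesis using Dle[of m x] t(1)[of m] by (meson divide_right_mono order_less_imp_le order_trans)
    qed
    have lim0: "(\<lambda>m. (q m - p x) / t m) \<longlonglongrightarrow> 0"
      using filterlim_compose[OF directional_limit[of x w] tr] u[of w] w0 uv by (simp add: q_def)
    show ?thesis
      by (rule tendsto_sandwich[OF _ _ tendsto_const lim0]) (simp_all add: D0 Dq)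
  qed
  have AEl: "AE x in lborel. (\<lambda>m. D m x) \<longlonglongrightarrow> 0"
  proof -
    have "AE x in lborel. \<forall>k\<in>Basis. directional x k + directional x (- k) = 0"
      using AE_directional_two_sided by (intro AE_finite_allI) auto
    moreover have "AE x in lborel. x \<noteq> (0::'a)" by (rule AE_lborel_singleton)
    ultimately show ?thesis by eventually_elim (use lim in auto)
  qed
  have [measurable]: "?a m \<in> borel_measurable borel" "?b m \<in> borel_measurable borel" for m
    using gauge_body.gauge_measurable gA gB by auto
  have Dm: "D m \<in> borel_measurable lborel" for m unfolding D_def by measurable
  have conv: "(\<lambda>m. LINT x|lborel. D m x) \<longlonglongrightarrow> (LINT x|(lborel :: 'a measure). (0::real))"
  proof (rule integral_dominated_convergence[where s = D and w = "\<lambda>x. \<kappa> * indicat_real (cball (0::'a) R) x"])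
    show "integrable lborel (\<lambda>x. \<kappa> * indicat_real (cball (0::'a) R) x)"
      by (intro integrable_mult_right integrable_real_indicator)
         (use emeasure_bounded_finite[of "cball (0::'a) R"] in auto)
  qed (use Dm AEl D0 Db in auto)
  have intmax: "integrable lborel (\<lambda>x. max 0 (1 - minkowski_gauge N x))" if N: "gauge_body N" for N :: "'a set"
  proof -
    interpret N: gauge_body N by (rule N)
    obtain b where b: "b > 0" "\<And>x. norm x \<le> b * minkowski_gauge N x" using N.gauge_bounds by metis
    show ?thesis
    proof (rule integrable_of_bounded_support[where B = 1 and r = b])
      fix x
      show "\<bar>max 0 (1 - minkowski_gauge N x)\<bar> \<le> 1 * indicator (cball 0 b) x"
      proof (cases "norm x \<le> b")
        case False
        then have "b * 1 < b * minkowski_gauge N x" using b(2)[of x] by simp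
        then have "1 < minkowski_gauge N x" using b(1) by simp
        then show ?thesis by simp
      qed (use N.gauge_nonneg[of x] in auto)
    qed measurable
  qed
  have "(LINT x|lborel. D m x) * real (Suc DIM('a)) = (measure lebesgue (A m) - measure lebesgue (B m)) / t m" for m
  proof -
    have "(LINT x|lborel. D m x) = ((LINT x|lborel. max 0 (1 - ?a m x)) - (LINT x|lborel. max 0 (1 - ?b m x))) / t m"
      unfolding D_def using intmax[OF gA] intmax[OF gB] by simp
    also have "\<dots> = (measure lebesgue (A m) / real (Suc DIM('a)) - measure lebesgue (B m) / real (Suc DIM('a))) / t m"
      unfolding gauge_body.gauge_integral[OF gA] gauge_body.gauge_integral[OF gB] ..
    finally show ?thesis by (simp add: diff_divide_distrib[symmetric])
  qed
  moreover have "(\<lambda>m. (LINT x|lborel. D m x) * real (Suc DIM('a))) \<longlonglongrightarrow> 0 * real (Suc DIM('a))"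
    using conv by (intro tendsto_mult_right) simp
  ultimately show ?thesis by (simp add: A_def B_def)
qed

section \<open>Homothetic erosions and tangential bodies\<close>

definition full_body :: "'n::finite body \<Rightarrow> bool" where
  "full_body K \<longleftrightarrow> convex_body K \<and> interior K \<noteq> {}"

lemma full_bodyD:
  assumes "full_body K"
  shows "compact K" "convex K" "interior K \<noteq> {}" "K \<noteq> {}"
  using assms by (auto simp: full_body_def convex_body_def)

lemma full_bodyI:
  assumes "compact K" "convex K" "interior K \<noteq> {}"
  shows "full_body K"
  using assms interior_subset by (auto simp: full_body_def convex_body_def)

lemma vol_pos:
  assumes "full_body K"
  shows "vol K > 0"
proof -
  have "negligible K" if "vol K = 0"
    using that lmeasurable_compact[OF full_bodyD(1)[OF assms]] by (simp add: negligible_iff_measure0)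
  then have "vol K \<noteq> 0"
    using full_bodyD(3)[OF assms] interior_subset negligible_subset open_interior open_not_negligible by metis
  then show ?thesis by (simp add: order_less_le)
qed

lemma full_body_affine:
  fixes K :: "'n::finite body"
  assumes "full_body K" "a > 0"
  shows "full_body ((\<lambda>y. a *\<^sub>R y + x) ` K)"
proof (rule full_bodyI)
  have eq: "(\<lambda>y. a *\<^sub>R y + x) ` X = (+) x ` (*\<^sub>R) a ` X" for X :: "'n body"
    by (auto simp: image_image add.commute)
  show "compact ((\<lambda>y. a *\<^sub>R y + x) ` K)" "convex ((\<lambda>y. a *\<^sub>R y + x) ` K)"
    unfolding eq using full_bodyD[OF assms(1)]
    by (auto intro!: compact_translation convex_translation compact_scaling convex_scaling)
  have "open ((\<lambda>y. a *\<^sub>R y + x) ` interior K)"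
    unfolding eq using assms(2) by (intro open_translation open_scaling) auto
  then have "(\<lambda>y. a *\<^sub>R y + x) ` interior K \<subseteq> interior ((\<lambda>y. a *\<^sub>R y + x) ` K)"
    by (intro interior_maximal image_mono interior_subset)
  then show "interior ((\<lambda>y. a *\<^sub>R y + x) ` K) \<noteq> {}" using full_bodyD(3)[OF assms(1)] by blast
qed

lemma full_body_set_plus:
  assumes "full_body K" "compact L" "convex L" "L \<noteq> {}"
  shows "full_body (K + L)"
proof (rule full_bodyI)
  obtain l where l: "l \<in> L" using assms(4) by blast
  have "(+) l ` K \<subseteq> K + L"
  proof
    fix z assume "z \<in> (+) l ` K"
    then obtain k where "k \<in> K" "z = k + l" by (auto simp: add.commute)
    then show "z \<in> K + L" using l by (auto intro: set_plus_intro)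
  qed
  then have "interior ((+) l ` K) \<subseteq> interior (K + L)" by (rule interior_mono)
  then show "interior (K + L) \<noteq> {}" using full_bodyD(3)[OF assms(1)] by (auto simp: interior_translation)
qed (use assms full_bodyD[OF assms(1)] in \<open>auto intro!: compact_set_plus convex_set_plus\<close>)

lemma full_body_add_scaled:
  assumes "full_body K" "full_body E"
  shows "full_body (K + (*\<^sub>R) l ` E)"
  using full_bodyD[OF assms(2)]
  by (intro full_body_set_plus assms(1)) (auto intro: compact_scaling convex_scaling)

lemma homothetic_sym:
  assumes "homothetic K L"
  shows "homothetic L K"
proof -
  obtain a x where a: "a > 0" "L = (\<lambda>y. a *\<^sub>R y + x) ` K" using assms by (auto simp: homothetic_def)
  have "K = (\<lambda>y. (1 / a) *\<^sub>R y + - ((1 / a) *\<^sub>R x)) ` L"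
    using a(1) by (simp add: a(2) image_image scaleR_add_right)
  then show ?thesis unfolding homothetic_def using a(1) by (metis zero_less_divide_1_iff)
qed

lemma homothetic_trans:
  assumes "homothetic K L" "homothetic L M"
  shows "homothetic K M"
proof -
  obtain a x where a: "a > 0" "L = (\<lambda>y. a *\<^sub>R y + x) ` K" using assms by (auto simp: homothetic_def)
  obtain b z where b: "b > 0" "M = (\<lambda>y. b *\<^sub>R y + z) ` L" using assms by (auto simp: homothetic_def)
  have "M = (\<lambda>y. (b * a) *\<^sub>R y + (b *\<^sub>R x + z)) ` K"
    by (simp add: a(2) b(2) image_image scaleR_add_right add.assoc)
  then show ?thesis unfolding homothetic_def using a(1) b(1) by (metis mult_pos_pos)
qed

text \<open>If the erosion of \<open>L\<close> by \<open>\<delta> E\<close> is \<open>b L\<close> with \<open>b < 1\<close>, iterating \<open>b L + \<delta> E \<subseteq> L\<close> shows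
  \<open>c E \<subseteq> L\<close> for \<open>c = \<delta> / (1 - b)\<close>.\<close>

lemma tangential_of_self_similar_erosion:
  fixes L E :: "'n::finite body"
  assumes L: "full_body L" and E: "full_body E" and \<delta>: "\<delta> > 0" and b: "0 < b" "b < 1"
    and er: "erosion L \<delta> E = (*\<^sub>R) b ` L"
  shows "tangential_body ((*\<^sub>R) ((1 - b) / \<delta>) ` L) E"
proof -
  define c where "c = \<delta> / (1 - b)"
  have c: "c > 0" "\<delta> = c * (1 - b)" "(1 - b) / \<delta> = 1 / c" using b \<delta> by (auto simp: c_def)
  have step: "b *\<^sub>R y + \<delta> *\<^sub>R e \<in> L" if "y \<in> L" "e \<in> E" for y e
  proof -
    have "b *\<^sub>R y \<in> erosion L \<delta> E" using er that by blast
    then show ?thesis using that by (simp add: mem_erosion)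
  qed
  have iter: "(b ^ k) *\<^sub>R y + (c * (1 - b ^ k)) *\<^sub>R e \<in> L" if "y \<in> L" "e \<in> E" for y e k
  proof (induction k)
    case (Suc k)
    have "b *\<^sub>R ((b ^ k) *\<^sub>R y + (c * (1 - b ^ k)) *\<^sub>R e) + \<delta> *\<^sub>R e \<in> L"
      by (rule step[OF Suc that(2)])
    moreover have "b *\<^sub>R ((b ^ k) *\<^sub>R y + (c * (1 - b ^ k)) *\<^sub>R e) + \<delta> *\<^sub>R e
      = (b ^ Suc k) *\<^sub>R y + (c * (1 - b ^ Suc k)) *\<^sub>R e"
      by (simp add: c(2) algebra_simps)
    ultimately show ?case by simp
  qed (use that in simp)
  have cE: "c *\<^sub>R e \<in> L" if e: "e \<in> E" for e
  proof -
    obtain y where y: "y \<in> L" using full_bodyD(4)[OF L] by blast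
    have "(\<lambda>k. (b ^ k) *\<^sub>R y + (c * (1 - b ^ k)) *\<^sub>R e) \<longlonglongrightarrow> 0 *\<^sub>R y + (c * (1 - 0)) *\<^sub>R e"
      using b by (intro tendsto_intros LIMSEQ_power_zero) auto
    then have "0 *\<^sub>R y + (c * (1 - 0)) *\<^sub>R e \<in> L"
      by (rule closed_sequentially[OF compact_imp_closed[OF full_bodyD(1)[OF L]] iter[OF y e]])
    then show ?thesis by simp
  qed
  define T where "T = (*\<^sub>R) (1 / c) ` L"
  have memT: "x \<in> T \<longleftrightarrow> c *\<^sub>R x \<in> L" for x
    using c(1) by (auto simp: T_def image_iff intro!: bexI[of _ "c *\<^sub>R x"])
  have T: "full_body T" using full_body_affine[OF L, of "1 / c" 0] c(1) by (simp add: T_def)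
  have ET: "E \<subseteq> T" using cE memT by blast
  have "\<exists>H. x \<in> H \<and> supporting_hyperplane H T \<and> supporting_hyperplane H E" if x: "x \<in> frontier T" for x
  proof -
    have xT: "x \<in> T" using x full_bodyD(1)[OF T] by (simp add: frontier_def compact_imp_closed)
    have xi: "x \<notin> interior T" using x by (simp add: frontier_def)
    define y where "y = c *\<^sub>R x"
    have yL: "y \<in> L" using xT memT by (simp add: y_def)
    have "y \<notin> interior L"
    proof
      assume "y \<in> interior L"
      then have "(1 / c) *\<^sub>R y \<in> interior T"
        using interior_scaleR[of "1 / c" L] c(1) by (auto simp: T_def)
      then show False using xi c(1) by (simp add: y_def)
    qed
    have "\<exists>e\<in>E. b *\<^sub>R y + \<delta> *\<^sub>R e \<notin> interior L"
    proof (rule ccontr)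
      assume "\<not> ?thesis"
      then have "b *\<^sub>R y \<in> interior ((*\<^sub>R) b ` L)"
        unfolding er[symmetric] by (intro interior_erosion full_bodyD[OF E]) auto
      then have "b *\<^sub>R y \<in> (*\<^sub>R) b ` interior L" using interior_scaleR[of b L] b(1) by simp
      then show False using \<open>y \<notin> interior L\<close> b(1) by auto
    qed
    then obtain e where e: "e \<in> E" "b *\<^sub>R y + \<delta> *\<^sub>R e \<notin> interior L" by blast
    obtain u where u: "u \<noteq> 0" "\<And>z. z \<in> L \<Longrightarrow> u \<bullet> z \<le> u \<bullet> (b *\<^sub>R y + \<delta> *\<^sub>R e)"
      using supporting_functional[OF full_bodyD(2,3)[OF L] step[OF yL e(1)] e(2)] by blast
    define m where "m = u \<bullet> (b *\<^sub>R y + \<delta> *\<^sub>R e)"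
    have m: "m = b * (u \<bullet> y) + (1 - b) * (u \<bullet> (c *\<^sub>R e))"
      by (simp add: m_def c(2) inner_add_right)
    have le: "u \<bullet> y \<le> m" "u \<bullet> (c *\<^sub>R e) \<le> m"
      using u(2)[OF yL] u(2)[OF cE[OF e(1)]] by (simp_all add: m_def)
    have eqs: "u \<bullet> y = m" "u \<bullet> (c *\<^sub>R e) = m"
    proof -
      have "b * (m - u \<bullet> y) + (1 - b) * (m - u \<bullet> (c *\<^sub>R e)) = 0" using m by (simp add: algebra_simps)
      moreover have "b * (m - u \<bullet> y) \<ge> 0" "(1 - b) * (m - u \<bullet> (c *\<^sub>R e)) \<ge> 0" using le b by simp_all
      ultimately have "b * (m - u \<bullet> y) = 0" "(1 - b) * (m - u \<bullet> (c *\<^sub>R e)) = 0" by linarith+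
      then show "u \<bullet> y = m" "u \<bullet> (c *\<^sub>R e) = m" using b by auto
    qed
    define H where "H = {z. u \<bullet> z = m / c}"
    have xH: "x \<in> H" using eqs(1) c(1) by (simp add: H_def y_def field_simps)
    have eH: "e \<in> H" using eqs(2) c(1) by (simp add: H_def field_simps)
    have TH: "T \<subseteq> {z. u \<bullet> z \<le> m / c}"
    proof
      fix z assume "z \<in> T"
      then have "u \<bullet> (c *\<^sub>R z) \<le> m" using memT unfolding m_def by (intro u(2)) blast
      then show "z \<in> {z. u \<bullet> z \<le> m / c}" using c(1) by (simp add: pos_le_divide_eq mult.commute)
    qed
    have "supporting_hyperplane H T"
      unfolding supporting_hyperplane_def using u(1) TH xH xT by (intro exI[of _ u] exI[of _ "m / c"]) (auto simp: H_def)
    moreover have "supporting_hyperplane H E"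
      unfolding supporting_hyperplane_def using u(1) TH ET eH e(1) by (intro exI[of _ u] exI[of _ "m / c"]) (auto simp: H_def)
    ultimately show ?thesis using xH by blast
  qed
  then show ?thesis
    using T E ET unfolding tangential_body_def c(3) T_def[symmetric] full_body_def by blast
qed

lemma erosion_tangential:
  fixes T E :: "'n::finite body"
  assumes tan: "tangential_body T E" and d: "0 \<le> d" "d < 1"
  shows "erosion T d E = (*\<^sub>R) (1 - d) ` T"
proof
  have T: "full_body T" and E: "full_body E" and ET: "E \<subseteq> T"
    and supp: "\<And>x. x \<in> frontier T \<Longrightarrow> \<exists>H. x \<in> H \<and> supporting_hyperplane H T \<and> supporting_hyperplane H E"
    using tan by (auto simp: tangential_body_def full_body_def)
  show "(*\<^sub>R) (1 - d) ` T \<subseteq> erosion T d E"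
    using d ET full_bodyD(2)[OF T] by (auto simp: mem_erosion intro!: convexD)
  show "erosion T d E \<subseteq> (*\<^sub>R) (1 - d) ` T"
  proof
    fix x assume x: "x \<in> erosion T d E"
    define x' where "x' = (1 / (1 - d)) *\<^sub>R x"
    have xx: "x = (1 - d) *\<^sub>R x'" using d by (simp add: x'_def)
    have "x' \<in> T"
    proof (rule ccontr)
      assume nx: "x' \<notin> T"
      obtain e0 where e0: "e0 \<in> interior E" using full_bodyD(3)[OF E] by blast
      have e0T: "e0 \<in> interior T" using e0 interior_mono[OF ET] by blast
      have "closed_segment e0 x' \<inter> frontier T \<noteq> {}"
      proof (rule connected_Int_frontier)
        show "closed_segment e0 x' \<inter> T \<noteq> {}" using e0T interior_subset by force
        show "closed_segment e0 x' - T \<noteq> {}" using nx by force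
      qed simp
      then obtain z where z: "z \<in> closed_segment e0 x'" "z \<in> frontier T" by blast
      then obtain s where s: "0 \<le> s" "s \<le> 1" "z = (1 - s) *\<^sub>R e0 + s *\<^sub>R x'" by (auto simp: in_segment)
      have zT: "z \<in> T" using z(2) full_bodyD(1)[OF T] by (simp add: frontier_def compact_imp_closed)
      have "s \<noteq> 1" using zT nx s(3) by auto
      obtain H where H: "z \<in> H" "supporting_hyperplane H T" "supporting_hyperplane H E" using supp[OF z(2)] by blast
      obtain u c where u: "u \<noteq> 0" "H = {y. u \<bullet> y = c}" "T \<subseteq> {y. u \<bullet> y \<le> c}"
        using H(2) by (auto simp: supporting_hyperplane_def)
      obtain e where e: "e \<in> E" "u \<bullet> e = c" using H(3) u(2) by (auto simp: supporting_hyperplane_def)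
      have "u \<bullet> e0 < c"
      proof -
        obtain r where r: "r > 0" "cball e0 r \<subseteq> T" using e0T by (auto simp: mem_interior_cball)
        have "e0 + (r / norm u) *\<^sub>R u \<in> T" using r u(1) by (intro subsetD[OF r(2)]) (simp add: dist_norm)
        then have "u \<bullet> (e0 + (r / norm u) *\<^sub>R u) \<le> c" using u(3) by blast
        moreover have "u \<bullet> ((r / norm u) *\<^sub>R u) > 0" using r u(1) by simp
        ultimately show ?thesis by (simp add: inner_add_right)
      qed
      have "u \<bullet> z = c" using H(1) u(2) by simp
      then have eq: "(1 - s) * (c - u \<bullet> e0) = s * (u \<bullet> x' - c)"
        by (simp add: s(3) inner_add_right algebra_simps)
      have "(1 - s) * (c - u \<bullet> e0) > 0" using \<open>u \<bullet> e0 < c\<close> \<open>s \<noteq> 1\<close> s(2) by simp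
      then have "u \<bullet> x' > c" unfolding eq using s(1) by (simp add: zero_less_mult_iff)
      then have "(1 - d) * (u \<bullet> x') > (1 - d) * c" using d by simp
      moreover have "u \<bullet> (x + d *\<^sub>R e) \<le> c" using x e(1) u(3) by (auto simp: mem_erosion)
      ultimately show False by (simp add: xx inner_add_right e(2) algebra_simps)
    qed
    then show "x \<in> (*\<^sub>R) (1 - d) ` T" using xx by blast
  qed
qed

section \<open>The isoperimetric ratio under erosion\<close>

lemma vol_affine:
  fixes K :: "'n::finite body"
  shows "vol ((\<lambda>y. a *\<^sub>R y + x) ` K) = \<bar>a\<bar> ^ CARD('n) * vol K"
  using measure_lebesgue_affine[of a x K] by simp

lemma vol_mono:
  assumes "K \<subseteq> L" "full_body K" "full_body L"
  shows "vol K \<le> vol L"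
  by (intro measure_mono_fmeasurable fmeasurableD lmeasurable_compact full_bodyD(1) assms)

lemma set_plus_zero_scaled:
  fixes K E :: "'a::real_vector set"
  assumes "E \<noteq> {}"
  shows "K + (*\<^sub>R) 0 ` E = K"
  using assms by (auto simp: set_plus_def)

lemma steiner_coeffs_exist:
  fixes K E :: "'n::finite body"
  assumes K: "full_body K" and E: "full_body E"
  shows "\<exists>w. steiner_coeffs K E w \<and>
    ((\<lambda>l. (vol (K + (*\<^sub>R) l ` E) - vol K) / l) \<longlongrightarrow> real CARD('n) * w 1) (at_right 0)"
proof -
  let ?n = "CARD('n)"
  obtain p where p: "degree p \<le> ?n" "\<And>l. l \<ge> 0 \<Longrightarrow> vol (K + (*\<^sub>R) l ` E) = poly p l"
    using steiner_polynomial[OF full_bodyD(1-3)[OF K] full_bodyD(1-3)[OF E]] by blast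
  define w where "w i = (if i \<le> ?n then coeff p i / real (?n choose i) else 0)" for i
  have "poly p l = (\<Sum>i\<le>?n. real (?n choose i) * w i * l ^ i)" for l
  proof -
    have "poly p l = (\<Sum>i\<le>?n. coeff p i * l ^ i)"
      unfolding poly_altdef using p(1) by (intro sum.mono_neutral_left) (auto simp: coeff_eq_0)
    also have "\<dots> = (\<Sum>i\<le>?n. real (?n choose i) * w i * l ^ i)"
      by (intro sum.cong) (auto simp: w_def)
    finally show ?thesis .
  qed
  then have "steiner_coeffs K E w" by (simp add: steiner_coeffs_def p(2) w_def)
  moreover have "((\<lambda>l. (vol (K + (*\<^sub>R) l ` E) - vol K) / l) \<longlongrightarrow> real ?n * w 1) (at_right 0)"
  proof -
    have "(poly p has_real_derivative poly (pderiv p) 0) (at 0)" by (rule poly_DERIV)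
    then have "((\<lambda>l. (poly p l - poly p 0) / l) \<longlongrightarrow> poly (pderiv p) 0) (at_right 0)"
      by (simp add: DERIV_def filterlim_at_split)
    moreover have "poly (pderiv p) 0 = real ?n * w 1"
      by (simp add: poly_0_coeff_0 coeff_pderiv w_def Suc_le_eq)
    moreover have "\<forall>\<^sub>F l in at_right 0. (poly p l - poly p 0) / l = (vol (K + (*\<^sub>R) l ` E) - vol K) / l"
      using p(2) p(2)[of 0] set_plus_zero_scaled[OF full_bodyD(4)[OF E], of K]
      by (intro eventually_mono[OF eventually_at_right_less]) auto
    ultimately show ?thesis by (simp add: tendsto_cong)
  qed
  ultimately show ?thesis by blast
qed

lemma surface_area_limit:
  fixes K E :: "'n::finite body"
  assumes "full_body K" "full_body E"
  shows "((\<lambda>l. (vol (K + (*\<^sub>R) l ` E) - vol K) / l) \<longlongrightarrow> surface_area K E) (at_right 0)"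
proof -
  obtain w where w: "steiner_coeffs K E w"
    "((\<lambda>l. (vol (K + (*\<^sub>R) l ` E) - vol K) / l) \<longlongrightarrow> real CARD('n) * w 1) (at_right 0)"
    using steiner_coeffs_exist[OF assms] by blast
  have "(THE w. steiner_coeffs K E w) = w"
    using w(1) steiner_coeffs_unique by (intro the_equality) auto
  then show ?thesis using w(2) by (simp add: surface_area_def quermassintegral_def)
qed

lemma surface_area_unique:
  assumes "full_body K" "full_body E"
    and "((\<lambda>l. (vol (K + (*\<^sub>R) l ` E) - vol K) / l) \<longlongrightarrow> s) (at_right 0)"
  shows "surface_area K E = s"
  by (rule tendsto_unique[OF trivial_limit_at_right_real surface_area_limit[OF assms(1,2)] assms(3)])

lemma translate_subset_set_plus:
  fixes K L :: "'a::ab_group_add set"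
  assumes "x \<in> L"
  shows "(+) x ` K \<subseteq> K + L"
proof
  fix z assume "z \<in> (+) x ` K"
  then obtain k where "k \<in> K" "z = x + k" by blast
  moreover have "k + x \<in> K + L" using \<open>k \<in> K\<close> assms by (rule set_plus_intro)
  ultimately show "z \<in> K + L" by (simp only: add.commute)
qed

lemma surface_area_nonneg:
  assumes K: "full_body K" and E: "full_body E"
  shows "surface_area K E \<ge> 0"
proof (rule tendsto_lowerbound[OF surface_area_limit[OF K E]])
  obtain e where e: "e \<in> E" using full_bodyD(4)[OF E] by blast
  show "\<forall>\<^sub>F l in at_right 0. 0 \<le> (vol (K + (*\<^sub>R) l ` E) - vol K) / l"
  proof (rule eventually_mono[OF eventually_at_right_less])
    fix l :: real assume l: "0 < l"
    have "compact (K + (*\<^sub>R) l ` E)" by (rule full_bodyD(1)[OF full_body_add_scaled[OF K E]])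
    moreover have "compact ((+) (l *\<^sub>R e) ` K)" by (intro compact_translation full_bodyD(1)[OF K])
    moreover have "(+) (l *\<^sub>R e) ` K \<subseteq> K + (*\<^sub>R) l ` E"
      by (intro translate_subset_set_plus imageI e)
    ultimately have "vol ((+) (l *\<^sub>R e) ` K) \<le> vol (K + (*\<^sub>R) l ` E)"
      by (intro measure_mono_fmeasurable fmeasurableD lmeasurable_compact)
    then show "0 \<le> (vol (K + (*\<^sub>R) l ` E) - vol K) / l" using l by (simp add: measure_translation)
  qed
next
  show "at_right (0::real) \<noteq> bot" by (rule trivial_limit_at_right_real)
qed

lemma surface_area_affine:
  fixes K E :: "'n::finite body"
  assumes K: "full_body K" and E: "full_body E" and a: "a > 0"
  shows "surface_area ((\<lambda>y. a *\<^sub>R y + x) ` K) E = a ^ (CARD('n) - 1) * surface_area K E"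
proof (rule surface_area_unique[OF full_body_affine[OF K a] E])
  let ?f = "\<lambda>y. a *\<^sub>R y + x"
  define c where "c = 1 / a"
  have "c > 0" using a by (simp add: c_def)
  then have "LIM l at_right 0. c * l :> at_right (0::real)"
    by (intro filterlim_times_pos[of _ _ _ c]) (auto simp: filterlim_ident)
  then have "LIM l at_right 0. l / a :> at_right (0::real)" by (simp add: c_def)
  from filterlim_compose[OF surface_area_limit[OF K E] this]
  have lim: "((\<lambda>l. a ^ (CARD('n) - 1) * ((vol (K + (*\<^sub>R) (l / a) ` E) - vol K) / (l / a)))
      \<longlongrightarrow> a ^ (CARD('n) - 1) * surface_area K E) (at_right 0)"
    by (rule tendsto_mult_left)
  have scale: "a ^ (CARD('n) - 1) * ((vol (K + (*\<^sub>R) (l / a) ` E) - vol K) / (l / a))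
      = (vol (?f ` K + (*\<^sub>R) l ` E) - vol (?f ` K)) / l" for l
  proof -
    have "?f ` K + (*\<^sub>R) l ` E = ?f ` (K + (*\<^sub>R) (l / a) ` E)"
    proof safe
      fix z assume "z \<in> ?f ` K + (*\<^sub>R) l ` E"
      then obtain k e where ke: "k \<in> K" "e \<in> E" "z = ?f k + l *\<^sub>R e" by (auto elim!: set_plus_elim)
      have "z = ?f (k + (l / a) *\<^sub>R e)" using a by (simp add: ke(3) scaleR_add_right)
      then show "z \<in> ?f ` (K + (*\<^sub>R) (l / a) ` E)"
        using ke(1,2) by (simp only:) (intro imageI set_plus_intro)
    next
      fix z assume "z \<in> K + (*\<^sub>R) (l / a) ` E"
      then obtain k e where ke: "k \<in> K" "e \<in> E" "z = k + (l / a) *\<^sub>R e" by (auto elim!: set_plus_elim)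
      have "?f z = ?f k + l *\<^sub>R e" using a by (simp add: ke(3) scaleR_add_right)
      then show "?f z \<in> ?f ` K + (*\<^sub>R) l ` E"
        using ke(1,2) by (simp only:) (intro imageI set_plus_intro)
    qed
    then have "(vol (?f ` K + (*\<^sub>R) l ` E) - vol (?f ` K)) / l = a ^ CARD('n) * (vol (K + (*\<^sub>R) (l / a) ` E) - vol K) / l"
      using a by (simp add: vol_affine right_diff_distrib)
    also have "a ^ CARD('n) = a * a ^ (CARD('n) - 1)"
      by (simp add: power_minus_mult mult.commute[of a] del: One_nat_def)
    finally have eq: "(vol (?f ` K + (*\<^sub>R) l ` E) - vol (?f ` K)) / l
      = a * a ^ (CARD('n) - 1) * (vol (K + (*\<^sub>R) (l / a) ` E) - vol K) / l" .
    show ?thesis unfolding eq by simp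
  qed
  show "((\<lambda>l. (vol (?f ` K + (*\<^sub>R) l ` E) - vol (?f ` K)) / l)
      \<longlongrightarrow> a ^ (CARD('n) - 1) * surface_area K E) (at_right 0)"
    using lim unfolding scale .
qed

definition body_ratio :: "'n::finite body \<Rightarrow> 'n body \<Rightarrow> real" where
  "body_ratio K E = surface_area K E ^ CARD('n) / vol K ^ (CARD('n) - 1)"

lemma isoperimetric_ratio_eq: "isoperimetric_ratio K E l = body_ratio (parallel_body K E l) E"
  by (simp add: isoperimetric_ratio_def body_ratio_def)

lemma body_ratio_homothetic:
  fixes K L E :: "'n::finite body"
  assumes K: "full_body K" and E: "full_body E" and hom: "homothetic K L"
  shows "body_ratio L E = body_ratio K E"
proof -
  obtain a x where a: "a > 0" "L = (\<lambda>y. a *\<^sub>R y + x) ` K" using hom by (auto simp: homothetic_def)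
  let ?n = "CARD('n)"
  have "body_ratio L E = (a ^ (?n - 1) * surface_area K E) ^ ?n / (a ^ ?n * vol K) ^ (?n - 1)"
    using a by (simp add: body_ratio_def surface_area_affine[OF K E] vol_affine)
  also have "\<dots> = (a ^ ((?n - 1) * ?n) * surface_area K E ^ ?n) / (a ^ ((?n - 1) * ?n) * vol K ^ (?n - 1))"
    by (simp only: power_mult_distrib power_mult[symmetric] mult.commute[of ?n "?n - 1"])
  also have "\<dots> = body_ratio K E" using a(1) by (simp add: body_ratio_def)
  finally show ?thesis .
qed

definition vol_root :: "'n::finite body \<Rightarrow> real" where
  "vol_root K = root CARD('n) (vol K)"

lemma vol_root_power: "vol_root (K :: 'n::finite body) ^ CARD('n) = vol K"
  by (simp add: vol_root_def)

lemma vol_root_pos: "full_body K \<Longrightarrow> vol_root K > 0"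
  using vol_pos by (simp add: vol_root_def)

lemma vol_root_mono:
  fixes K L :: "'n::finite body"
  shows "vol K \<le> vol L \<Longrightarrow> vol_root K \<le> vol_root L"
  by (simp add: vol_root_def)

lemma vol_root_scaleR: "a > 0 \<Longrightarrow> vol_root ((*\<^sub>R) a ` K) = a * vol_root (K :: 'n::finite body)"
  by (simp add: vol_root_def measure_scaleR real_root_mult real_root_power_cancel)

lemma full_body_scaleR: "full_body K \<Longrightarrow> a > 0 \<Longrightarrow> full_body ((*\<^sub>R) a ` K)"
  using full_body_affine[of K a 0] by simp

lemma brunn_minkowski_body:
  assumes "full_body K" "full_body L"
  shows "vol_root K + vol_root L \<le> vol_root (K + L)"
    and "vol_root (K + L) \<le> vol_root K + vol_root L \<Longrightarrow> homothetic K L"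
  using brunn_minkowski[OF full_bodyD(1,2)[OF assms(1)] vol_pos[OF assms(1)] full_bodyD(1,2)[OF assms(2)] vol_pos[OF assms(2)]]
  by (auto simp: vol_root_def homothetic_def)

lemma full_body_plus: "full_body K \<Longrightarrow> full_body L \<Longrightarrow> full_body (K + L)"
  using full_bodyD[of L] by (intro full_body_set_plus) auto

lemma brunn_minkowski_combination:
  assumes K: "full_body K" and L: "full_body L" and M: "full_body M" and s: "0 < s" "s < 1"
    and sub: "(*\<^sub>R) (1 - s) ` K + (*\<^sub>R) s ` L \<subseteq> M"
  shows "(1 - s) * vol_root K + s * vol_root L \<le> vol_root M"
proof -
  have K': "full_body ((*\<^sub>R) (1 - s) ` K)" and L': "full_body ((*\<^sub>R) s ` L)"
    using K L s by (auto intro: full_body_scaleR)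
  have "(1 - s) * vol_root K + s * vol_root L \<le> vol_root ((*\<^sub>R) (1 - s) ` K + (*\<^sub>R) s ` L)"
    using brunn_minkowski_body(1)[OF K' L'] s by (simp add: vol_root_scaleR)
  also have "\<dots> \<le> vol_root M"
    by (intro vol_root_mono vol_mono sub full_body_plus K' L' M)
  finally show ?thesis .
qed

lemma power_quotient_limit:
  "((\<lambda>t. ((x + t * y) ^ n - x ^ n) / t) \<longlongrightarrow> real n * x ^ (n - 1) * y) (at_right (0::real))"
proof -
  have "((\<lambda>t. (x + t * y) ^ n) has_real_derivative real n * x ^ (n - 1) * y) (at 0)"
    by (auto intro!: derivative_eq_intros)
  then show ?thesis by (simp add: DERIV_def filterlim_at_split)
qed

lemma surface_area_upper_bound:
  fixes M L E :: "'n::finite body"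
  assumes M: "full_body M" and L: "full_body L" and E: "full_body E" and \<delta>: "\<delta> > 0"
    and sub: "M + (*\<^sub>R) \<delta> ` E \<subseteq> L"
  shows "\<delta> * surface_area L E \<le> real CARD('n) * vol_root L ^ (CARD('n) - 1) * (vol_root L - vol_root M)"
proof -
  let ?n = "CARD('n)"
  define \<sigma> where "\<sigma> = (vol_root L - vol_root M) / \<delta>"
  have "(vol (L + (*\<^sub>R) \<epsilon> ` E) - vol L) / \<epsilon> \<le> ((vol_root L + \<epsilon> * \<sigma>) ^ ?n - vol_root L ^ ?n) / \<epsilon>"
    if \<epsilon>: "\<epsilon> > 0" for \<epsilon>
  proof -
    define s where "s = \<delta> / (\<delta> + \<epsilon>)"
    have s: "0 < s" "s < 1" "s * \<epsilon> = (1 - s) * \<delta>" "(1 - s) * (\<delta> + \<epsilon>) = \<epsilon>" "s * (\<delta> + \<epsilon>) = \<delta>"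
      using \<delta> \<epsilon> by (auto simp: s_def field_simps)
    have LE: "full_body (L + (*\<^sub>R) \<epsilon> ` E)" by (rule full_body_add_scaled[OF L E])
    have "(1 - s) * vol_root M + s * vol_root (L + (*\<^sub>R) \<epsilon> ` E) \<le> vol_root L"
    proof (rule brunn_minkowski_combination[OF M LE L s(1,2)], safe elim!: set_plus_elim)
      fix m l e assume "m \<in> M" "l \<in> L" "e \<in> E"
      then have "m + \<delta> *\<^sub>R e \<in> L" using sub by (auto intro!: set_plus_intro)
      then have "(1 - s) *\<^sub>R (m + \<delta> *\<^sub>R e) + s *\<^sub>R l \<in> L"
        using \<open>l \<in> L\<close> s full_bodyD(2)[OF L] by (intro convexD) auto
      also have "(1 - s) *\<^sub>R (m + \<delta> *\<^sub>R e) + s *\<^sub>R l = (1 - s) *\<^sub>R m + s *\<^sub>R (l + \<epsilon> *\<^sub>R e)"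
        using s(3) by (simp add: scaleR_add_right)
      finally show "(1 - s) *\<^sub>R m + s *\<^sub>R (l + \<epsilon> *\<^sub>R e) \<in> L" .
    qed
    then have "(\<delta> + \<epsilon>) * ((1 - s) * vol_root M + s * vol_root (L + (*\<^sub>R) \<epsilon> ` E)) \<le> (\<delta> + \<epsilon>) * vol_root L"
      using \<delta> \<epsilon> by (intro mult_left_mono) auto
    moreover have "(\<delta> + \<epsilon>) * ((1 - s) * vol_root M + s * vol_root (L + (*\<^sub>R) \<epsilon> ` E))
      = ((1 - s) * (\<delta> + \<epsilon>)) * vol_root M + (s * (\<delta> + \<epsilon>)) * vol_root (L + (*\<^sub>R) \<epsilon> ` E)"
      by (simp add: algebra_simps)
    ultimately have "\<epsilon> * vol_root M + \<delta> * vol_root (L + (*\<^sub>R) \<epsilon> ` E) \<le> (\<delta> + \<epsilon>) * vol_root L"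
      unfolding s(4,5) by simp
    then have "vol_root (L + (*\<^sub>R) \<epsilon> ` E) \<le> vol_root L + \<epsilon> * \<sigma>"
      using \<delta> by (simp add: \<sigma>_def field_simps)
    then have "vol_root (L + (*\<^sub>R) \<epsilon> ` E) ^ ?n \<le> (vol_root L + \<epsilon> * \<sigma>) ^ ?n"
      using vol_root_pos[OF LE] by (intro power_mono) auto
    then show ?thesis using \<epsilon> by (simp add: vol_root_power divide_right_mono)
  qed
  then have "\<forall>\<^sub>F \<epsilon> in at_right 0. (vol (L + (*\<^sub>R) \<epsilon> ` E) - vol L) / \<epsilon> \<le> ((vol_root L + \<epsilon> * \<sigma>) ^ ?n - vol_root L ^ ?n) / \<epsilon>"
    by (intro eventually_mono[OF eventually_at_right_less]) auto
  then have "surface_area L E \<le> real ?n * vol_root L ^ (?n - 1) * \<sigma>"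
    by (rule tendsto_le[OF trivial_limit_at_right_real power_quotient_limit surface_area_limit[OF L E]])
  then show ?thesis using \<delta> by (simp add: \<sigma>_def field_simps)
qed

lemma first_variation_body:
  fixes M L E :: "'n::finite body"
  assumes M: "full_body M" "M = erosion L \<delta> E" and L: "full_body L" and E: "full_body E" and \<delta>: "\<delta> > 0"
    and t: "\<And>m. 0 < t m" "\<And>m. t m \<le> 1" "t \<longlonglongrightarrow> 0"
  shows "(\<lambda>m. (vol (M + (*\<^sub>R) (t m) ` L) - vol (M + (*\<^sub>R) (t m) ` (M + (*\<^sub>R) \<delta> ` E))) / t m) \<longlonglongrightarrow> 0"
proof -
  obtain m0 where m0: "m0 \<in> interior M" using full_bodyD(3)[OF M(1)] by blast
  obtain e0 where e0: "e0 \<in> E" using full_bodyD(4)[OF E] by blast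
  define M' L' E' where "M' = (+) (- m0) ` M" and "L' = (+) (- m0 - \<delta> *\<^sub>R e0) ` L" and "E' = (+) (- e0) ` E"
  have mem: "x \<in> (+) (- a) ` X \<longleftrightarrow> x + a \<in> X" for x a and X :: "'n body"
    by (auto simp: image_iff algebra_simps intro: bexI[of _ "x + a"])
  have mem2: "x \<in> (+) (- a - b) ` X \<longleftrightarrow> x + (a + b) \<in> X" for x a b and X :: "'n body"
    using mem[of x "a + b" X] by simp
  have M'E: "M' = erosion L' \<delta> E'"
  proof (rule set_eqI)
    fix x
    show "x \<in> M' \<longleftrightarrow> x \<in> erosion L' \<delta> E'"
      unfolding mem_erosion M'_def L'_def mem mem2 by (simp add: M(2) mem_erosion E'_def algebra_simps)
  qed
  have gb: "gauge_body M'"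
  proof
    show "compact M'" "convex M'"
      unfolding M'_def by (intro compact_translation convex_translation full_bodyD[OF M(1)])+
    show "0 \<in> interior M'" unfolding M'_def interior_translation mem using m0 by simp
  qed
  have L': "compact L'" "convex L'"
    unfolding L'_def by (intro compact_translation convex_translation full_bodyD[OF L])+
  have E': "compact E'" "convex E'"
    unfolding E'_def by (intro compact_translation convex_translation full_bodyD[OF E])+
  have E'0: "0 \<in> E'" unfolding E'_def mem using e0 by simp
  have 1: "M' + (*\<^sub>R) s ` L' = (+) (- m0 - s *\<^sub>R (m0 + \<delta> *\<^sub>R e0)) ` (M + (*\<^sub>R) s ` L)" for s
  proof safe
    fix z assume "z \<in> M' + (*\<^sub>R) s ` L'"
    then obtain m l where "m \<in> M" "l \<in> L" "z = (- m0 + m) + s *\<^sub>R ((- m0 - \<delta> *\<^sub>R e0) + l)"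
      by (auto simp: M'_def L'_def elim!: set_plus_elim)
    then show "z \<in> (+) (- m0 - s *\<^sub>R (m0 + \<delta> *\<^sub>R e0)) ` (M + (*\<^sub>R) s ` L)"
      by (intro image_eqI[of _ _ "m + s *\<^sub>R l"] set_plus_intro imageI) (auto simp: algebra_simps)
  next
    fix z assume "z \<in> M + (*\<^sub>R) s ` L"
    then obtain m l where "m \<in> M" "l \<in> L" "z = m + s *\<^sub>R l" by (auto elim!: set_plus_elim)
    then have "- m0 - s *\<^sub>R (m0 + \<delta> *\<^sub>R e0) + z = (- m0 + m) + s *\<^sub>R ((- m0 - \<delta> *\<^sub>R e0) + l)"
      by (simp add: algebra_simps)
    then show "- m0 - s *\<^sub>R (m0 + \<delta> *\<^sub>R e0) + z \<in> M' + (*\<^sub>R) s ` L'"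
      using \<open>m \<in> M\<close> \<open>l \<in> L\<close> unfolding M'_def L'_def by (simp only:) (intro set_plus_intro imageI)
  qed
  have 2: "M' + (*\<^sub>R) s ` (M' + (*\<^sub>R) \<delta> ` E') = (+) (- m0 - s *\<^sub>R (m0 + \<delta> *\<^sub>R e0)) ` (M + (*\<^sub>R) s ` (M + (*\<^sub>R) \<delta> ` E))" for s
  proof safe
    fix z assume "z \<in> M' + (*\<^sub>R) s ` (M' + (*\<^sub>R) \<delta> ` E')"
    then obtain m m' e where "m \<in> M" "m' \<in> M" "e \<in> E" "z = (- m0 + m) + s *\<^sub>R ((- m0 + m') + \<delta> *\<^sub>R (- e0 + e))"
      by (auto simp: M'_def E'_def elim!: set_plus_elim)
    then show "z \<in> (+) (- m0 - s *\<^sub>R (m0 + \<delta> *\<^sub>R e0)) ` (M + (*\<^sub>R) s ` (M + (*\<^sub>R) \<delta> ` E))"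
      by (intro image_eqI[of _ _ "m + s *\<^sub>R (m' + \<delta> *\<^sub>R e)"] set_plus_intro imageI) (auto simp: algebra_simps)
  next
    fix z assume "z \<in> M + (*\<^sub>R) s ` (M + (*\<^sub>R) \<delta> ` E)"
    then obtain m m' e where z: "m \<in> M" "m' \<in> M" "e \<in> E" "z = m + s *\<^sub>R (m' + \<delta> *\<^sub>R e)" by (auto elim!: set_plus_elim)
    then have "- m0 - s *\<^sub>R (m0 + \<delta> *\<^sub>R e0) + z = (- m0 + m) + s *\<^sub>R ((- m0 + m') + \<delta> *\<^sub>R (- e0 + e))"
      by (simp add: algebra_simps)
    then show "- m0 - s *\<^sub>R (m0 + \<delta> *\<^sub>R e0) + z \<in> M' + (*\<^sub>R) s ` (M' + (*\<^sub>R) \<delta> ` E')"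
      using z(1-3) unfolding M'_def E'_def by (simp only:) (intro set_plus_intro imageI)
  qed
  show ?thesis
    using gauge_body.first_variation[OF gb L' E' E'0 M'E t] by (simp add: 1 2 measure_translation)
qed

lemma surface_area_lower_bound:
  fixes M L E :: "'n::finite body"
  assumes M: "full_body M" "M = erosion L \<delta> E" and L: "full_body L" and E: "full_body E" and \<delta>: "\<delta> > 0"
  shows "real CARD('n) * vol_root M ^ (CARD('n) - 1) * (vol_root (M + L) - vol_root M)
    \<le> real CARD('n) * vol M + \<delta> * surface_area M E"
proof -
  let ?n = "CARD('n)"
  let ?C = "M + (*\<^sub>R) \<delta> ` E"
  define X where "X = vol_root (M + L) - vol_root M"
  define t where "t m = 1 / real (Suc (Suc m))" for m
  have t: "0 < t m" "t m \<le> 1" "t m < 1" for m by (auto simp: t_def)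
  have t0: "t \<longlonglongrightarrow> 0"
    unfolding t_def using LIMSEQ_Suc[OF LIMSEQ_Suc[OF lim_1_over_n]] by simp
  have tr: "filterlim t (at_right 0) sequentially"
    using t0 t by (intro tendsto_imp_filterlim_at_right) auto
  define V where "V l = vol (M + (*\<^sub>R) l ` E)" for l
  define l where "l m = t m * \<delta> / (1 + t m)" for m
  have l: "0 < l m" for m using t[of m] \<delta> by (simp add: l_def add_pos_pos)
  have "l \<longlonglongrightarrow> 0 * \<delta> / (1 + 0)" unfolding l_def by (intro tendsto_intros t0) auto
  then have lr: "filterlim l (at_right 0) sequentially"
    using l by (intro tendsto_imp_filterlim_at_right) auto
  have sum_full: "full_body (M + L)" by (rule full_body_plus[OF M(1) L])
  have C: "full_body ?C" by (rule full_body_add_scaled[OF M(1) E])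
  have lower: "(vol_root M + t m * X) ^ ?n \<le> vol (M + (*\<^sub>R) (t m) ` L)" for m
  proof -
    have full: "full_body (M + (*\<^sub>R) (t m) ` L)" by (rule full_body_add_scaled[OF M(1) L])
    have "(1 - t m) * vol_root M + t m * vol_root (M + L) \<le> vol_root (M + (*\<^sub>R) (t m) ` L)"
    proof (rule brunn_minkowski_combination[OF M(1) sum_full full t(1,3)], safe elim!: set_plus_elim)
      fix x y z assume "x \<in> M" "y \<in> M" "z \<in> L"
      then have "((1 - t m) *\<^sub>R x + t m *\<^sub>R y) + t m *\<^sub>R z \<in> M + (*\<^sub>R) (t m) ` L"
        using full_bodyD(2)[OF M(1)] t[of m] by (intro set_plus_intro imageI convexD) auto
      then show "(1 - t m) *\<^sub>R x + t m *\<^sub>R (y + z) \<in> M + (*\<^sub>R) (t m) ` L"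
        by (simp add: scaleR_add_right add.assoc)
    qed
    then have "vol_root M + t m * X \<le> vol_root (M + (*\<^sub>R) (t m) ` L)" by (simp add: X_def algebra_simps)
    moreover have "0 \<le> vol_root M + t m * X"
      using vol_root_pos[OF M(1)] vol_root_pos[OF L] brunn_minkowski_body(1)[OF M(1) L] t(1)[of m]
      by (simp add: X_def)
    ultimately have "(vol_root M + t m * X) ^ ?n \<le> vol_root (M + (*\<^sub>R) (t m) ` L) ^ ?n" by (intro power_mono)
    then show ?thesis by (simp add: vol_root_power)
  qed
  have upper: "vol (M + (*\<^sub>R) (t m) ` ?C) \<le> (1 + t m) ^ ?n * V (l m)" for m
  proof -
    have t1: "1 + t m > 0" using t(1)[of m] by simp
    have full: "full_body (M + (*\<^sub>R) (l m) ` E)" by (rule full_body_add_scaled[OF M(1) E])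
    have "M + (*\<^sub>R) (t m) ` ?C \<subseteq> (*\<^sub>R) (1 + t m) ` (M + (*\<^sub>R) (l m) ` E)"
    proof (safe elim!: set_plus_elim)
      fix x y e assume xy: "x \<in> M" "y \<in> M" "e \<in> E"
      have "(1 / (1 + t m)) *\<^sub>R x + (t m / (1 + t m)) *\<^sub>R y \<in> M"
        using full_bodyD(2)[OF M(1)] t(1)[of m] t1 xy by (intro convexD) (auto simp: add_divide_distrib[symmetric])
      moreover have "x + t m *\<^sub>R (y + \<delta> *\<^sub>R e) = (1 + t m) *\<^sub>R (((1 / (1 + t m)) *\<^sub>R x + (t m / (1 + t m)) *\<^sub>R y) + l m *\<^sub>R e)"
        using t1 by (simp add: scaleR_add_right l_def add.assoc)
      ultimately show "x + t m *\<^sub>R (y + \<delta> *\<^sub>R e) \<in> (*\<^sub>R) (1 + t m) ` (M + (*\<^sub>R) (l m) ` E)"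
        using xy(3) by (simp only:) (intro imageI set_plus_intro)
    qed
    then have "vol (M + (*\<^sub>R) (t m) ` ?C) \<le> vol ((*\<^sub>R) (1 + t m) ` (M + (*\<^sub>R) (l m) ` E))"
      using t1 by (intro vol_mono full_body_add_scaled full_body_scaleR M(1) C full)
    then show ?thesis using t1 by (simp add: measure_scaleR V_def)
  qed
  let ?err = "\<lambda>m. (vol (M + (*\<^sub>R) (t m) ` L) - vol (M + (*\<^sub>R) (t m) ` ?C)) / t m"
  let ?rhs = "\<lambda>m. (1 + t m) ^ ?n * ((V (l m) - vol M) / l m) * (\<delta> / (1 + t m)) + vol M * (((1 + t m * 1) ^ ?n - 1 ^ ?n) / t m) + ?err m"
  have le: "((vol_root M + t m * X) ^ ?n - vol_root M ^ ?n) / t m \<le> ?rhs m" for m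
  proof -
    have t1: "1 + t m > 0" using t(1)[of m] by simp
    have "((vol_root M + t m * X) ^ ?n - vol M) / t m \<le> (vol (M + (*\<^sub>R) (t m) ` L) - vol M) / t m"
      using lower[of m] t(1)[of m] by (simp add: divide_right_mono)
    also have "\<dots> = (vol (M + (*\<^sub>R) (t m) ` ?C) - vol M) / t m + ?err m"
      by (simp add: add_divide_distrib[symmetric])
    also have "(vol (M + (*\<^sub>R) (t m) ` ?C) - vol M) / t m \<le> ((1 + t m) ^ ?n * V (l m) - vol M) / t m"
      using upper[of m] t(1)[of m] by (simp add: divide_right_mono)
    also have "((1 + t m) ^ ?n * V (l m) - vol M) / t m
      = (1 + t m) ^ ?n * ((V (l m) - vol M) / t m) + vol M * (((1 + t m * 1) ^ ?n - 1 ^ ?n) / t m)"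
      using t(1)[of m] by (simp add: field_simps)
    also have "(V (l m) - vol M) / t m = ((V (l m) - vol M) / l m) * (\<delta> / (1 + t m))"
      using t(1)[of m] t1 \<delta> by (simp add: l_def)
    finally show ?thesis by (simp add: vol_root_power mult.assoc)
  qed
  have rhs: "?rhs \<longlonglongrightarrow> (1 + 0) ^ ?n * surface_area M E * (\<delta> / (1 + 0)) + vol M * (real ?n * 1 ^ (?n - 1) * 1) + 0"
    unfolding V_def
    by (intro tendsto_intros t0 filterlim_compose[OF surface_area_limit[OF M(1) E] lr]
        filterlim_compose[OF power_quotient_limit tr] first_variation_body[OF M L E \<delta> t(1,2) t0]) auto
  have lhs: "(\<lambda>m. ((vol_root M + t m * X) ^ ?n - vol_root M ^ ?n) / t m) \<longlonglongrightarrow> real ?n * vol_root M ^ (?n - 1) * X"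
    by (rule filterlim_compose[OF power_quotient_limit tr])
  have "real ?n * vol_root M ^ (?n - 1) * X
      \<le> (1 + 0) ^ ?n * surface_area M E * (\<delta> / (1 + 0)) + vol M * (real ?n * 1 ^ (?n - 1) * 1) + 0"
    by (rule LIMSEQ_le[OF lhs rhs]) (use le in blast)
  then show ?thesis by (simp add: X_def mult.commute)
qed

lemma body_ratio_erosion:
  fixes M L E :: "'n::finite body"
  assumes M: "full_body M" "M = erosion L \<delta> E" and L: "full_body L" and E: "full_body E" and \<delta>: "\<delta> > 0"
  shows "body_ratio L E \<le> body_ratio M E"
    and "body_ratio L E = body_ratio M E \<Longrightarrow> homothetic M L"
proof -
  let ?n = "CARD('n)"
  define a b where "a = surface_area L E / vol_root L ^ (?n - 1)" and "b = surface_area M E / vol_root M ^ (?n - 1)"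
  have ratio: "body_ratio K E = (surface_area K E / vol_root K ^ (?n - 1)) ^ ?n" for K :: "'n body"
  proof -
    have "vol K ^ (?n - 1) = (vol_root K ^ (?n - 1)) ^ ?n"
      by (simp only: vol_root_power[symmetric] power_mult[symmetric] mult.commute[of ?n "?n - 1"])
    then show ?thesis by (simp add: body_ratio_def power_divide)
  qed
  have pos: "vol_root L ^ (?n - 1) > 0" "vol_root M ^ (?n - 1) > 0"
    using vol_root_pos[OF L] vol_root_pos[OF M(1)] by auto
  have ab0: "a \<ge> 0" "b \<ge> 0"
    using surface_area_nonneg[OF L E] surface_area_nonneg[OF M(1) E] pos by (auto simp: a_def b_def)
  define X where "X = vol_root (M + L) - vol_root M"
  have LX: "vol_root L \<le> X" using brunn_minkowski_body(1)[OF M(1) L] by (simp add: X_def)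
  have "M + (*\<^sub>R) \<delta> ` E \<subseteq> L" unfolding M(2) by (rule erosion_sum_subset)
  from surface_area_upper_bound[OF M(1) L E \<delta> this]
  have 1: "\<delta> * a \<le> real ?n * (vol_root L - vol_root M)"
    using pos by (simp add: a_def pos_divide_le_eq mult_ac)
  have volM: "vol M = vol_root M ^ (?n - 1) * vol_root M"
    by (simp add: vol_root_power[symmetric] power_minus_mult del: One_nat_def)
  have "vol_root M ^ (?n - 1) * (real ?n * X) \<le> vol_root M ^ (?n - 1) * (real ?n * vol_root M + \<delta> * b)"
  proof -
    have "surface_area M E = vol_root M ^ (?n - 1) * b" using vol_root_pos[OF M(1)] by (simp add: b_def)
    then show ?thesis
      using surface_area_lower_bound[OF M L E \<delta>, folded X_def] unfolding volM by (simp add: distrib_left mult_ac)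
  qed
  then have "real ?n * X \<le> real ?n * vol_root M + \<delta> * b"
    using pos(2) by (simp add: mult_le_cancel_left_pos)
  then have 2: "real ?n * (X - vol_root M) \<le> \<delta> * b" by (simp add: algebra_simps)
  have mid: "real ?n * (vol_root L - vol_root M) \<le> real ?n * (X - vol_root M)"
    using LX by (intro mult_left_mono) auto
  have "\<delta> * a \<le> \<delta> * b" using 1 2 mid by linarith
  then have "a \<le> b" using \<delta> by simp
  then show "body_ratio L E \<le> body_ratio M E"
    unfolding ratio a_def[symmetric] b_def[symmetric] using ab0 by (intro power_mono)
  assume "body_ratio L E = body_ratio M E"
  then have "a ^ ?n = b ^ ?n" unfolding ratio a_def[symmetric] b_def[symmetric] .
  then have "a = b" using ab0 by (simp add: power_eq_iff_eq_base)
  then have "real ?n * (X - vol_root M) \<le> real ?n * (vol_root L - vol_root M)" using 1[unfolded \<open>a = b\<close>] 2 by linarith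
  then have "X \<le> vol_root L" by simp
  then show "homothetic M L"
    using brunn_minkowski_body(2)[OF M(1) L] by (simp add: X_def)
qed

section \<open>Parallel bodies\<close>

lemma parallel_body_neg: "l < 0 \<Longrightarrow> parallel_body K E l = erosion K (- l) E"
  by (simp add: parallel_body_def erosion_def)

lemma full_body_parallel_body:
  fixes K E :: "'n::finite body"
  assumes K: "full_body K" and E: "full_body E" and l: "- inradius K E < l"
  shows "full_body (parallel_body K E l)"
proof (cases "l < 0")
  case False
  then show ?thesis using full_body_add_scaled[OF K E] by (simp add: parallel_body_def)
next
  case True
  let ?S = "{r. 0 \<le> r \<and> (\<exists>x. (\<lambda>y. x + r *\<^sub>R y) ` E \<subseteq> K)}"
  have "0 \<in> ?S" using full_bodyD(4)[OF K] by auto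
  then have ne: "?S \<noteq> {}" by blast
  have "- l < Sup ?S" using l by (simp add: inradius_def)
  then obtain r where "r \<in> ?S" and r: "- l < r" by (rule less_cSupE[OF _ ne])
  then obtain x where x: "(\<lambda>y. x + r *\<^sub>R y) ` E \<subseteq> K" by blast
  have "(\<lambda>y. (r + l) *\<^sub>R y + x) ` E \<subseteq> erosion K (- l) E"
  proof (rule image_subsetI, unfold mem_erosion, rule ballI)
    fix e f assume ef: "e \<in> E" "f \<in> E"
    have "((r + l) / r) *\<^sub>R e + (- l / r) *\<^sub>R f \<in> E"
      using ef r True by (intro convexD[OF full_bodyD(2)[OF E]]) (auto simp: field_simps)
    then have "x + r *\<^sub>R (((r + l) / r) *\<^sub>R e + (- l / r) *\<^sub>R f) \<in> K" using x by blast
    also have "x + r *\<^sub>R (((r + l) / r) *\<^sub>R e + (- l / r) *\<^sub>R f) = (r + l) *\<^sub>R e + x + (- l) *\<^sub>R f"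
      using r True by (simp add: scaleR_add_right scaleR_diff_right)
    finally show "(r + l) *\<^sub>R e + x + (- l) *\<^sub>R f \<in> K" .
  qed
  from interior_mono[OF this] have "interior (erosion K (- l) E) \<noteq> {}"
    using full_bodyD(3)[OF full_body_affine[OF E, of "r + l" x]] r by auto
  then show ?thesis
    unfolding parallel_body_neg[OF True]
    by (intro full_bodyI compact_erosion convex_erosion full_bodyD[OF K] full_bodyD[OF E])
qed

lemma parallel_body_erosion:
  fixes K E :: "'n::finite body"
  assumes K: "full_body K" and E: "full_body E" and l: "l0 < l1"
  shows "parallel_body K E l0 = erosion (parallel_body K E l1) (l1 - l0) E"
proof -
  note K' = full_bodyD[OF K] and E' = full_bodyD[OF E]
  consider "l1 < 0" | "l0 < 0" "0 \<le> l1" | "0 \<le> l0" using l by linarith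
  then show ?thesis
  proof cases
    case 1
    then show ?thesis
      using l erosion_erosion[OF E'(2), of "- l1" "l1 - l0" K] by (simp add: parallel_body_neg)
  next
    case 2
    then show ?thesis
      using erosion_erosion[OF E'(2), of l1 "- l0" "K + (*\<^sub>R) l1 ` E"] erosion_set_plus[OF K'(1,2) E'(1,4), of l1]
      by (simp add: parallel_body_neg) (simp add: parallel_body_def)
  next
    case 3
    have "K + (*\<^sub>R) l1 ` E = (K + (*\<^sub>R) l0 ` E) + (*\<^sub>R) (l1 - l0) ` E"
      using 3 l set_plus_scaleR_add[OF E'(2), of l0 "l1 - l0"] by (simp add: add.assoc)
    then show ?thesis
      using 3 l erosion_set_plus[OF full_bodyD(1,2)[OF full_body_add_scaled[OF K E, of l0]] E'(1,4), of "l1 - l0"]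
      by (simp add: parallel_body_def)
  qed
qed

lemma vol_root_erosion_less:
  assumes M: "full_body M" "M = erosion L \<delta> E" and L: "full_body L" and E: "full_body E" and \<delta>: "\<delta> > 0"
  shows "vol_root M < vol_root L"
proof -
  have \<delta>E: "full_body ((*\<^sub>R) \<delta> ` E)" by (rule full_body_scaleR[OF E \<delta>])
  have "vol_root M < vol_root M + vol_root ((*\<^sub>R) \<delta> ` E)" using vol_root_pos[OF \<delta>E] by simp
  also have "\<dots> \<le> vol_root (M + (*\<^sub>R) \<delta> ` E)" by (rule brunn_minkowski_body(1)[OF M(1) \<delta>E])
  also have "\<dots> \<le> vol_root L"
    by (intro vol_root_mono vol_mono full_body_plus M(1) \<delta>E L) (simp only: M(2) erosion_sum_subset)
  finally show ?thesis .
qed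

lemma homothety_ratio_greater_one:
  fixes M L :: "'n::finite body"
  assumes "vol_root M < vol_root L" "full_body M" "a > 0" "L = (\<lambda>y. a *\<^sub>R y + x) ` M"
  shows "1 < a"
proof -
  have "vol_root L = a * vol_root M"
    using assms(3) by (simp add: assms(4) vol_root_def vol_affine real_root_mult real_root_power_cancel)
  then show ?thesis using assms(1) vol_root_pos[OF assms(2)] by simp
qed

lemma tangential_of_homothetic_erosion:
  fixes M L E :: "'n::finite body"
  assumes M: "full_body M" "M = erosion L \<delta> E" and L: "full_body L" and E: "full_body E" and \<delta>: "\<delta> > 0"
    and hom: "homothetic M L"
  obtains T where "tangential_body T E" "homothetic L T"
proof -
  obtain a x where a: "a > 0" "L = (\<lambda>y. a *\<^sub>R y + x) ` M" using hom by (auto simp: homothetic_def)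
  have a1: "1 < a" by (rule homothety_ratio_greater_one[OF vol_root_erosion_less[OF M L E \<delta>] M(1) a])
  define b where "b = 1 / a"
  have b: "0 < b" "b < 1" using a1 by (auto simp: b_def)
  define p where "p = (1 / (1 - b)) *\<^sub>R (- (b *\<^sub>R x))"
  have bx: "b *\<^sub>R x = b *\<^sub>R p - p"
  proof -
    have "(1 - b) *\<^sub>R p = - (b *\<^sub>R x)" using b by (simp add: p_def)
    then show ?thesis by (simp add: algebra_simps)
  qed
  define L0 where "L0 = (\<lambda>y. 1 *\<^sub>R y + - p) ` L"
  have L0: "full_body L0" unfolding L0_def by (intro full_body_affine L) simp
  have memL0: "y \<in> L0 \<longleftrightarrow> y + p \<in> L" for y
    unfolding L0_def by (auto intro: image_eqI[of _ _ "y + p"])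
  have memM: "y \<in> M \<longleftrightarrow> a *\<^sub>R y + x \<in> L" for y
    unfolding a(2) using a(1) by (auto simp: inj_image_mem_iff[of "\<lambda>y. a *\<^sub>R y + x"] inj_def)
  have "erosion L0 \<delta> E = (*\<^sub>R) b ` L0"
  proof (rule set_eqI)
    fix y
    have "y \<in> erosion L0 \<delta> E \<longleftrightarrow> y + p \<in> M" by (simp add: M(2) mem_erosion memL0 add_ac)
    also have "\<dots> \<longleftrightarrow> a *\<^sub>R y \<in> L0"
    proof -
      have "a *\<^sub>R (y + p) + x = a *\<^sub>R y + p + a *\<^sub>R (p - b *\<^sub>R p + b *\<^sub>R x)"
        using a(1) by (simp add: b_def scaleR_add_right scaleR_diff_right)
      then show ?thesis unfolding memM memL0 bx by simp
    qed
    also have "\<dots> \<longleftrightarrow> y \<in> (*\<^sub>R) b ` L0"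
      using a(1) by (auto simp: b_def image_iff intro: bexI[of _ "a *\<^sub>R y"])
    finally show "y \<in> erosion L0 \<delta> E \<longleftrightarrow> y \<in> (*\<^sub>R) b ` L0" .
  qed
  from tangential_of_self_similar_erosion[OF L0 E \<delta> b this]
  have "tangential_body ((*\<^sub>R) ((1 - b) / \<delta>) ` L0) E" .
  moreover have "homothetic L ((*\<^sub>R) ((1 - b) / \<delta>) ` L0)"
  proof (rule homothetic_trans)
    show "homothetic L L0" unfolding homothetic_def L0_def by (intro exI[of _ 1] conjI exI[of _ "- p"]) auto
    show "homothetic L0 ((*\<^sub>R) ((1 - b) / \<delta>) ` L0)"
      unfolding homothetic_def using b \<delta> by (intro exI[of _ "(1 - b) / \<delta>"] conjI exI[of _ 0]) auto
  qed
  ultimately show ?thesis by (rule that)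
qed

lemma homothetic_erosion_of_tangential:
  fixes M L E T :: "'n::finite body"
  assumes tan: "tangential_body T E" and hom: "homothetic L T"
    and M: "full_body M" "M = erosion L \<delta> E" and \<delta>: "\<delta> > 0"
  shows "homothetic M L"
proof -
  have T: "full_body T" and E: "full_body E" using tan by (auto simp: tangential_body_def full_body_def)
  obtain c p where c: "c > 0" "L = (\<lambda>y. c *\<^sub>R y + p) ` T"
    using homothetic_sym[OF hom] by (auto simp: homothetic_def)
  define d where "d = \<delta> / c"
  have d: "d > 0" using c(1) \<delta> by (simp add: d_def)
  define N where "N = erosion T d E"
  have "M = (\<lambda>y. c *\<^sub>R y + p) ` N"
  proof (rule set_eqI)
    fix z
    define y where "y = (1 / c) *\<^sub>R (z - p)"
    have z: "z = c *\<^sub>R y + p" using c(1) by (simp add: y_def)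
    have inj: "inj (\<lambda>y. c *\<^sub>R y + p)" using c(1) by (auto simp: inj_def)
    have "z + \<delta> *\<^sub>R e \<in> L \<longleftrightarrow> y + d *\<^sub>R e \<in> T" for e
    proof -
      have "z + \<delta> *\<^sub>R e = c *\<^sub>R (y + d *\<^sub>R e) + p" using c(1) by (simp add: z d_def scaleR_add_right)
      then show ?thesis unfolding c(2) using inj_image_mem_iff[OF inj, of "y + d *\<^sub>R e" T] by simp
    qed
    then have "z \<in> M \<longleftrightarrow> y \<in> N" by (simp add: M(2) N_def mem_erosion)
    also have "\<dots> \<longleftrightarrow> z \<in> (\<lambda>y. c *\<^sub>R y + p) ` N" unfolding z using inj_image_mem_iff[OF inj, of y N] by simp
    finally show "z \<in> M \<longleftrightarrow> z \<in> (\<lambda>y. c *\<^sub>R y + p) ` N" .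
  qed
  then have NM: "homothetic N M" using c(1) by (auto simp: homothetic_def)
  have N: "full_body N"
  proof -
    obtain a x where "a > 0" "N = (\<lambda>y. a *\<^sub>R y + x) ` M"
      using homothetic_sym[OF NM] by (auto simp: homothetic_def)
    then show ?thesis using full_body_affine[OF M(1)] by simp
  qed
  have "d < 1"
  proof (rule ccontr)
    assume "\<not> d < 1"
    then have d1: "1 \<le> d" by simp
    define t where "t = min 1 (vol_root N / (2 * vol_root T))"
    have t: "0 < t" "t \<le> 1" "t * vol_root T < vol_root N"
    proof -
      show "0 < t" "t \<le> 1" using vol_root_pos[OF N] vol_root_pos[OF T] by (auto simp: t_def)
      have "t * vol_root T \<le> vol_root N / (2 * vol_root T) * vol_root T"
        using vol_root_pos[OF T] by (intro mult_right_mono) (auto simp: t_def)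
      also have "\<dots> < vol_root N" using vol_root_pos[OF N] vol_root_pos[OF T] by simp
      finally show "t * vol_root T < vol_root N" .
    qed
    have tT: "erosion T (1 - t) E = (*\<^sub>R) t ` T" using erosion_tangential[OF tan, of "1 - t"] t by simp
    have "N = erosion (erosion T (1 - t) E) (d - (1 - t)) E"
      using erosion_erosion[OF full_bodyD(2)[OF E], of "1 - t" "d - (1 - t)" T] t d1 by (simp add: N_def)
    then have "vol_root N < vol_root ((*\<^sub>R) t ` T)"
      unfolding tT using N T E t d1 by (intro vol_root_erosion_less[of _ _ "d - (1 - t)" E] full_body_scaleR) auto
    then show False using t by (simp add: vol_root_scaleR)
  qed
  then have "N = (*\<^sub>R) (1 - d) ` T" using erosion_tangential[OF tan, of d] d by (simp add: N_def)
  then have "homothetic T N" unfolding homothetic_def using \<open>d < 1\<close> by (intro exI[of _ "1 - d"] conjI exI[of _ 0]) auto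
  then show ?thesis
    by (rule homothetic_sym[OF homothetic_trans[OF hom homothetic_trans[OF _ NM]]])
qed

lemma homothetic_of_homothetic_outer:
  fixes K E :: "'n::finite body"
  assumes K: "full_body K" and E: "full_body E" and l: "l > 0"
    and hom: "homothetic K (K + (*\<^sub>R) l ` E)"
  shows "homothetic K E"
proof -
  let ?lE = "(*\<^sub>R) l ` E"
  obtain a x where a: "a > 0" "K + ?lE = (\<lambda>y. a *\<^sub>R y + x) ` K" using hom by (auto simp: homothetic_def)
  have lE: "full_body ?lE" by (rule full_body_scaleR[OF E l])
  have "K = erosion (K + ?lE) l E" using erosion_set_plus[OF full_bodyD(1,2)[OF K] full_bodyD(1,4)[OF E]] by simp
  from homothety_ratio_greater_one[OF vol_root_erosion_less[OF K this full_body_plus[OF K lE] E l] K a]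
  have a1: "1 < a" .
  define R where "R = (\<lambda>y. (a - 1) *\<^sub>R y + x) ` K"
  have R: "full_body R" using full_body_affine[OF K] a1 by (simp add: R_def)
  have aK: "(*\<^sub>R) a ` K = (*\<^sub>R) (a - 1) ` K + K"
    using set_plus_scaleR_add[OF full_bodyD(2)[OF K], of "a - 1" 1] a1 by simp
  have "?lE + K = (+) x ` (*\<^sub>R) a ` K" using a(2) by (simp add: image_image add.commute)
  also have "\<dots> = R + K"
  proof safe
    fix k assume "k \<in> K"
    then have "a *\<^sub>R k \<in> (*\<^sub>R) (a - 1) ` K + K" unfolding aK[symmetric] by (rule imageI)
    then obtain k1 k2 where k: "k1 \<in> K" "k2 \<in> K" "a *\<^sub>R k = (a - 1) *\<^sub>R k1 + k2" by (auto elim!: set_plus_elim)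
    have "((a - 1) *\<^sub>R k1 + x) + k2 \<in> R + K" unfolding R_def using k(1,2) by (intro set_plus_intro imageI)
    then show "x + a *\<^sub>R k \<in> R + K" by (simp add: k(3) add_ac)
  next
    fix z assume "z \<in> R + K"
    then obtain k1 k2 where k: "k1 \<in> K" "k2 \<in> K" "z = ((a - 1) *\<^sub>R k1 + x) + k2" by (auto simp: R_def elim!: set_plus_elim)
    have "(a - 1) *\<^sub>R k1 + k2 \<in> (*\<^sub>R) a ` K" unfolding aK using k(1,2) by (intro set_plus_intro imageI)
    then have "x + ((a - 1) *\<^sub>R k1 + k2) \<in> (+) x ` (*\<^sub>R) a ` K" by (rule imageI)
    then show "z \<in> (+) x ` (*\<^sub>R) a ` K" by (simp add: k(3) add_ac)
  qed
  finally have eq: "?lE + K = R + K" .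
  have "?lE = R"
    using set_plus_cancel_subset[OF full_bodyD(1,2)[OF R] full_bodyD(1,4)[OF K], of ?lE]
      set_plus_cancel_subset[OF full_bodyD(1,2)[OF lE] full_bodyD(1,4)[OF K], of R] eq by simp
  then have "homothetic K ?lE" unfolding homothetic_def R_def using a1 by (intro exI[of _ "a - 1"]) auto
  moreover have "homothetic ?lE E"
    by (rule homothetic_sym) (unfold homothetic_def, use l in \<open>intro exI[of _ l] conjI exI[of _ 0]; simp\<close>)
  ultimately show ?thesis by (rule homothetic_trans)
qed

lemma homothetic_outer:
  fixes K E :: "'n::finite body"
  assumes E: "full_body E" and l: "l \<ge> 0" and hom: "homothetic K E"
  shows "homothetic E (K + (*\<^sub>R) l ` E)"
proof -
  obtain a x where a: "a > 0" "K = (\<lambda>y. a *\<^sub>R y + x) ` E"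
    using homothetic_sym[OF hom] by (auto simp: homothetic_def)
  have alE: "(*\<^sub>R) (a + l) ` E = (*\<^sub>R) a ` E + (*\<^sub>R) l ` E"
    using set_plus_scaleR_add[OF full_bodyD(2)[OF E], of a l] a(1) l by simp
  have "K + (*\<^sub>R) l ` E = (\<lambda>y. (a + l) *\<^sub>R y + x) ` E"
  proof safe
    fix z assume "z \<in> K + (*\<^sub>R) l ` E"
    then obtain e f where ef: "e \<in> E" "f \<in> E" "z = (a *\<^sub>R e + x) + l *\<^sub>R f" by (auto simp: a(2) elim!: set_plus_elim)
    have "a *\<^sub>R e + l *\<^sub>R f \<in> (*\<^sub>R) (a + l) ` E" unfolding alE using ef(1,2) by (intro set_plus_intro imageI)
    then obtain g where "g \<in> E" "a *\<^sub>R e + l *\<^sub>R f = (a + l) *\<^sub>R g" by (rule imageE)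
    then show "z \<in> (\<lambda>y. (a + l) *\<^sub>R y + x) ` E" unfolding ef(3) by (intro image_eqI[of _ _ g]) (auto simp: add_ac)
  next
    fix e assume "e \<in> E"
    then have "(a *\<^sub>R e + x) + l *\<^sub>R e \<in> K + (*\<^sub>R) l ` E" unfolding a(2) by (intro set_plus_intro imageI)
    then show "(a + l) *\<^sub>R e + x \<in> K + (*\<^sub>R) l ` E" by (simp add: scaleR_add_left add_ac)
  qed
  then show ?thesis unfolding homothetic_def using a(1) l by (intro exI[of _ "a + l"]) auto
qed

lemma tangential_body_refl:
  assumes E: "full_body E"
  shows "tangential_body E E"
proof -
  have "\<exists>H. x \<in> H \<and> supporting_hyperplane H E" if "x \<in> frontier E" for x
  proof -
    have x: "x \<in> E" "x \<notin> interior E"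
      using \<open>x \<in> frontier E\<close> compact_imp_closed[OF full_bodyD(1)[OF E]] by (auto simp: frontier_def)
    obtain u where "u \<noteq> 0" "\<And>z. z \<in> E \<Longrightarrow> u \<bullet> z \<le> u \<bullet> x"
      using supporting_functional[OF full_bodyD(2,3)[OF E] x] by blast
    then show ?thesis unfolding supporting_hyperplane_def using x(1)
      by (intro exI[of _ "{y. u \<bullet> y = u \<bullet> x}"] conjI exI[of _ u] exI[of _ "u \<bullet> x"]) auto
  qed
  then show ?thesis using E by (auto simp: tangential_body_def full_body_def)
qed

lemma body_ratio_self:
  fixes E :: "'n::finite body"
  assumes E: "full_body E"
  shows "body_ratio E E = real CARD('n) ^ CARD('n) * vol E"
proof -
  let ?n = "CARD('n)"
  have "vol (E + (*\<^sub>R) l ` E) = (1 + l) ^ ?n * vol E" if "l > 0" for l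
    using set_plus_scaleR_add[OF full_bodyD(2)[OF E], of 1 l] \<open>l > 0\<close> by (simp add: measure_scaleR)
  then have "\<forall>\<^sub>F l in at_right 0. (vol (E + (*\<^sub>R) l ` E) - vol E) / l = vol E * (((1 + l * 1) ^ ?n - 1 ^ ?n) / l)"
    by (intro eventually_mono[OF eventually_at_right_less]) (simp add: field_simps)
  moreover have "((\<lambda>l. vol E * (((1 + l * 1) ^ ?n - 1 ^ ?n) / l)) \<longlongrightarrow> vol E * (real ?n * 1 ^ (?n - 1) * 1)) (at_right 0)"
    by (intro tendsto_mult_left power_quotient_limit)
  ultimately have "((\<lambda>l. (vol (E + (*\<^sub>R) l ` E) - vol E) / l) \<longlongrightarrow> vol E * (real ?n * 1 ^ (?n - 1) * 1)) (at_right 0)"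
    by (simp only: tendsto_cong)
  from surface_area_unique[OF E E this] have "surface_area E E = real ?n * vol E" by simp
  moreover have "vol E ^ ?n = vol E * vol E ^ (?n - 1)"
    by (simp add: power_minus_mult mult.commute[of "vol E"] del: One_nat_def)
  ultimately show ?thesis
    using vol_pos[OF E] by (simp add: body_ratio_def power_mult_distrib)
qed

theorem theorem3p4:
  fixes K E :: "(real ^ 'n::finite) set"
  assumes "convex_body K" "interior K \<noteq> {}"
    and "convex_body E" "interior E \<noteq> {}"
  shows "antimono_on {- inradius K E <..} (isoperimetric_ratio K E)
    \<and> (\<forall>l0 l1. - inradius K E < l0 \<and> l0 < l1 \<longrightarrow>
        (isoperimetric_ratio K E l0 = isoperimetric_ratio K E l1
           \<longleftrightarrow> homothetic (parallel_body K E l0) (parallel_body K E l1))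
      \<and> (isoperimetric_ratio K E l0 = isoperimetric_ratio K E l1
           \<longleftrightarrow> (\<exists>L. tangential_body L E \<and> homothetic (parallel_body K E l1) L))
      \<and> (isoperimetric_ratio K E l0 = isoperimetric_ratio K E l1
           \<longleftrightarrow> isoperimetric_ratio K E constant_on {- inradius K E <.. l1})
      \<and> (0 < l1 \<longrightarrow>
          (isoperimetric_ratio K E l0 = isoperimetric_ratio K E l1 \<longleftrightarrow> homothetic K E)
        \<and> (isoperimetric_ratio K E l0 = isoperimetric_ratio K E l1
             \<longleftrightarrow> (\<forall>l > - inradius K E.
                    isoperimetric_ratio K E l = real CARD('n) ^ CARD('n) * vol E))))"
proof -
  have K: "full_body K" and E: "full_body E" using assms by (auto simp: full_body_def)
  let ?P = "parallel_body K E" and ?I = "isoperimetric_ratio K E" and ?r = "inradius K E"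
  have full: "full_body (?P l)" if "- ?r < l" for l by (rule full_body_parallel_body[OF K E that])
  have ero: "?P l0 = erosion (?P l1) (l1 - l0) E" if "l0 < l1" for l0 l1
    by (rule parallel_body_erosion[OF K E that])
  have step: "?I l1 \<le> ?I l0" "?I l1 = ?I l0 \<Longrightarrow> homothetic (?P l0) (?P l1)"
    if "- ?r < l0" "l0 < l1" for l0 l1
    using body_ratio_erosion[OF full ero full E, of l0 l1] that by (auto simp: isoperimetric_ratio_eq)
  have hom: "?I l1 = ?I l0" if "- ?r < l0" "homothetic (?P l0) (?P l1)" for l0 l1
    using body_ratio_homothetic[OF full[OF that(1)] E that(2)] by (simp add: isoperimetric_ratio_eq)
  have anti: "antimono_on {- ?r <..} ?I"
  proof (rule monotone_onI)
    fix l0 l1 assume "l0 \<in> {- ?r <..}" "l0 \<le> l1"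
    then show "?I l1 \<le> ?I l0" using step(1)[of l0 l1] by (cases "l0 = l1") auto
  qed
  have to_tangential: "\<exists>T. tangential_body T E \<and> homothetic (?P l1) T"
    if l: "- ?r < l0" "l0 < l1" and h: "homothetic (?P l0) (?P l1)" for l0 l1
    using tangential_of_homothetic_erosion[OF full[OF l(1)] ero[OF l(2)] full E _ h] l by fastforce
  have from_tangential: "homothetic (?P l) (?P l1)"
    if l: "- ?r < l" "l < l1" and T: "tangential_body T E" "homothetic (?P l1) T" for l l1 T
    using homothetic_erosion_of_tangential[OF T full[OF l(1)] ero[OF l(2)]] l(2) by simp
  have P0: "?P 0 = K"
    using set_plus_zero_scaled[OF full_bodyD(4)[OF E]] by (simp add: parallel_body_def)
  have outer: "?I l0 = ?I l1 \<longleftrightarrow> homothetic K E" and outer_ratio: "homothetic K E \<Longrightarrow> ?I l1 = real CARD('n) ^ CARD('n) * vol E"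
    if l: "- ?r < l0" "l0 < l1" "0 < l1" for l0 l1
  proof -
    have E_P: "homothetic E (?P l1)" if "homothetic K E"
      using homothetic_outer[OF E _ that, of l1] l(3) by (simp add: parallel_body_def)
    show "?I l1 = real CARD('n) ^ CARD('n) * vol E" if "homothetic K E"
      using body_ratio_homothetic[OF E E E_P[OF that]] body_ratio_self[OF E] by (simp add: isoperimetric_ratio_eq)
    show "?I l0 = ?I l1 \<longleftrightarrow> homothetic K E"
    proof
      assume "?I l0 = ?I l1"
      then obtain T where T: "tangential_body T E" "homothetic (?P l1) T"
        using to_tangential[OF l(1,2) step(2)[OF l(1,2)]] by auto
      have "K = erosion (?P l1) l1 E" using ero[OF l(3)] by (simp add: P0)
      from homothetic_erosion_of_tangential[OF T K this l(3)]
      have "homothetic K (K + (*\<^sub>R) l1 ` E)" using l(3) by (simp add: parallel_body_def)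
      then show "homothetic K E" by (rule homothetic_of_homothetic_outer[OF K E l(3)])
    next
      assume "homothetic K E"
      then have "homothetic (?P l1) E" by (rule homothetic_sym[OF E_P])
      from from_tangential[OF l(1,2) tangential_body_refl[OF E] this]
      show "?I l0 = ?I l1" using hom[OF l(1)] by simp
    qed
  qed
  show ?thesis
  proof (intro conjI allI impI)
    show "antimono_on {- ?r <..} ?I" by (rule anti)
  next
    fix l0 l1 assume l: "- ?r < l0 \<and> l0 < l1"
    then have l0: "- ?r < l0" "l0 < l1" by auto
    show 12: "?I l0 = ?I l1 \<longleftrightarrow> homothetic (?P l0) (?P l1)"
      by (rule iffI[OF step(2)[OF l0, OF sym] hom[OF l0(1), symmetric]])
    show 13: "?I l0 = ?I l1 \<longleftrightarrow> (\<exists>L. tangential_body L E \<and> homothetic (?P l1) L)"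
      unfolding 12 using to_tangential[OF l0] from_tangential[OF l0] by blast
    show "?I l0 = ?I l1 \<longleftrightarrow> ?I constant_on {- ?r <.. l1}"
    proof
      assume "?I l0 = ?I l1"
      then obtain T where T: "tangential_body T E" "homothetic (?P l1) T" using 13 by blast
      have "?I l = ?I l1" if "l \<in> {- ?r <.. l1}" for l
      proof (cases "l = l1")
        case False
        then have "- ?r < l" "l < l1" using that by auto
        then show ?thesis by (intro hom[symmetric] from_tangential[OF _ _ T])
      qed simp
      then show "?I constant_on {- ?r <.. l1}" unfolding constant_on_def by blast
    next
      assume "?I constant_on {- ?r <.. l1}"
      then obtain c where "\<And>l. l \<in> {- ?r <.. l1} \<Longrightarrow> ?I l = c" unfolding constant_on_def by blast
      from this[of l0] this[of l1] show "?I l0 = ?I l1" using l0 by simp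
    qed
    assume l1: "0 < l1"
    show 15: "?I l0 = ?I l1 \<longleftrightarrow> homothetic K E" by (rule outer[OF l0 l1])
    show "?I l0 = ?I l1 \<longleftrightarrow> (\<forall>l > - ?r. ?I l = real CARD('n) ^ CARD('n) * vol E)"
    proof
      assume "?I l0 = ?I l1"
      then have KE: "homothetic K E" using 15 by simp
      show "\<forall>l > - ?r. ?I l = real CARD('n) ^ CARD('n) * vol E"
      proof (intro allI impI)
        fix l assume l: "- ?r < l"
        have m: "l < max l 0 + 1" "0 < max l 0 + 1" by auto
        show "?I l = real CARD('n) ^ CARD('n) * vol E"
          using outer[OF l m] outer_ratio[OF l m KE] KE by simp
      qed
    next
      assume "\<forall>l > - ?r. ?I l = real CARD('n) ^ CARD('n) * vol E"
      then show "?I l0 = ?I l1" using l0 by simp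
    qed
  qed
qed

end
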